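(* Let $(\Omega,\mathcal H,\hat{\mathbb E})$ be a sublinear expectation space, let $0<\underline\sigma^2<\overline\sigma^2$, and let $Y=(Y_1,\dots,Y_n)^\top\in\mathcal H^n$ be such that $Y_1\sim\mathcal N(0,[\underline\sigma^2,\overline\sigma^2])$ and, for each $1\le i\le n-1$, $Y_{i+1}\sim Y_i$ and $Y_{i+1}$ is independent from $(Y_1,\dots,Y_i)$. Then for any $m\times n$ real matrix $A$: (i) for all $v\in\mathbb R^m$, $\langle v,AY\rangle$ is a $G$-normal random variable with $$\langle v,AY\rangle\sim\mathcal N\big(0,\big[\|v^\top A\|^2\underline\sigma^2,\ \|v^\top A\|^2\overline\sigma^2\big]\big);$$ (ii) if $A$ has rank less than or equal to one, then $AY$ is an $m$-dimensional $G$-normal random vector, or more precisely, $AY\sim\mathcal N(0,\Gamma')$, where $$\Gamma'=\big\{u\,r\,u^\top : r\in[\|w\|^2\underline\sigma^2,\ \|w\|^2\overline\sigma^2]\big\}$$ and $A=uw^\top$ for $u\in\mathbb R^m$, $w\in\mathbb R^n$; (iii) if $A$ is invertible, then $AY$ is not $G$-normally distributed. (In particular, $Y$ is not $G$-normally distributed.)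
   Context: $\|\cdot\|$ is the Euclidean norm. $C_{l.Lip}(\mathbb R^n)$ is the set of functions $\varphi:\mathbb R^n\to\mathbb R$ for which there exist $C>0$ and $m\in\mathbb N$ (depending on $\varphi$) with $|\varphi(x)-\varphi(y)|\le C(1+|x|^m+|y|^m)|x-y|$ for all $x,y\in\mathbb R^n$. Let $\Omega$ be a set and $\mathcal H$ a linear space of real-valued functions on $\Omega$ which contains all constants and contains $\varphi(X_1,\dots,X_n)$ whenever $X_1,\dots,X_n\in\mathcal H$ and $\varphi\in C_{l.Lip}(\mathbb R^n)$. A sublinear expectation is a map $\hat{\mathbb E}:\mathcal H\to\mathbb R$ such that: $\hat{\mathbb E}[X]\le\hat{\mathbb E}[Y]$ if $X\le Y$; $\hat{\mathbb E}[c]=c$ for $c\in\mathbb R$; $\hat{\mathbb E}[X+Y]\le\hat{\mathbb E}[X]+\hat{\mathbb E}[Y]$; $\hat{\mathbb E}[\lambda X]=\lambda\hat{\mathbb E}[X]$ for $\lambda\ge0$. Then $(\Omega,\mathcal H,\hat{\mathbb E})$ is a sublinear expectation space. Elements of $\mathcal H$ are random variables; elements of $\mathcal H^n$ are $n$-dimensional random vectors. Independence (possibly asymmetric): $Y\in\mathcal H^n$ is independent from $X\in\mathcal H^m$ if $\hat{\mathbb E}[\varphi(X,Y)]=\hat{\mathbb E}\big[\hat{\mathbb E}[\varphi(x,Y)]_{x=X}\big]$ for all $\varphi\in C_{l.Lip}(\mathbb R^{m+n})$. Identical distribution: $X,Y\in\mathcal H^n$ satisfy $X\sim Y$ if $\hat{\mathbb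 E}[\varphi(X)]=\hat{\mathbb E}[\varphi(Y)]$ for all $\varphi\in C_{l.Lip}(\mathbb R^n)$. If $X\sim\bar X$ and $\bar X$ is independent from $X$, then $\bar X$ is an independent copy of $X$. $G$-normality: $X\in\mathcal H^n$ is $G$-normally distributed (a $G$-normal random vector; a $G$-normal random variable if $n=1$) if for any independent copy $\bar X$ of $X$ one has $aX+b\bar X\sim\sqrt{a^2+b^2}\,X$ for all $a,b\ge0$. For a bounded, closed, convex subset $\Gamma$ of the positive semidefinite symmetric $n\times n$ matrices, $X\sim\mathcal N(0,\Gamma)$ means that $X$ is an $n$-dimensional $G$-normal random vector with $\frac12\hat{\mathbb E}[\langle AX,X\rangle]=\frac12\sup_{B\in\Gamma}\mathrm{tr}[AB]$ for all symmetric $n\times n$ matrices $A$. ($\Gamma$ is uniquely determined by $X$, and determines the distribution of $X$.) If $n=1$, $\Gamma=[\underline\sigma^2,\overline\sigma^2]$ with $\overline\sigma^2=\hat{\mathbb E}[X^2]$ and $\underline\sigma^2=-\hat{\mathbb E}[-X^2]$.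
   Formalization: Part (iii) is stated for n ≥ 2, since for n = 1 the vector Y = Y_1 is G-normal by hypothesis. In the definition of G-normality, independent copies may live on an extension of the space over Ω×Ω, so that the property is not vacuous when H contains no copy. *)

theory Defs
  imports "Jordan_Normal_Form.DL_Rank" "Jordan_Normal_Form.Jordan_Normal_Form"
begin

text \<open>
  Vectors of \<open>\<real>\<^sup>k\<close> are the elements of \<^term>\<open>carrier_vec k :: real vec set\<close>, and coordinates are
  numbered from \<open>0\<close>. The set \<open>\<Omega>\<close> is the universe of a type \<open>'a\<close>. A \<open>k\<close>-dimensional random
  vector is a function \<open>'a \<Rightarrow> real vec\<close>; functions \<open>\<phi> :: real vec \<Rightarrow> real\<close> only matter on
  \<^term>\<open>carrier_vec k\<close>.
\<close>

section \<open>Sublinear expectation spaces\<close>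

definition vnorm :: "real vec \<Rightarrow> real" where
  "vnorm x = sqrt (x \<bullet> x)"

definition C_lLip :: "nat \<Rightarrow> (real vec \<Rightarrow> real) set" where
  "C_lLip k = {\<phi>. \<exists>C>0. \<exists>m::nat. \<forall>x\<in>carrier_vec k. \<forall>y\<in>carrier_vec k.
     \<bar>\<phi> x - \<phi> y\<bar> \<le> C * (1 + vnorm x ^ m + vnorm y ^ m) * vnorm (x - y)}"

definition random_vector :: "('a \<Rightarrow> real) set \<Rightarrow> nat \<Rightarrow> ('a \<Rightarrow> real vec) \<Rightarrow> bool" where
  "random_vector H k X \<longleftrightarrow>
     (\<forall>\<omega>. X \<omega> \<in> carrier_vec k) \<and> (\<forall>i<k. (\<lambda>\<omega>. X \<omega> $ i) \<in> H)"

definition vec1 :: "('a \<Rightarrow> real) \<Rightarrow> 'a \<Rightarrow> real vec" where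
  "vec1 X = (\<lambda>\<omega>. vec 1 (\<lambda>_. X \<omega>))"

text \<open>\<open>E\<close> is a total function in HOL, but only its values on \<open>H\<close> are constrained or used.\<close>

locale sublinear_expectation_space =
  fixes H :: "('a \<Rightarrow> real) set" and E :: "('a \<Rightarrow> real) \<Rightarrow> real"
  assumes const_in: "(\<lambda>_. c) \<in> H"
    and add_in: "X \<in> H \<Longrightarrow> Y \<in> H \<Longrightarrow> (\<lambda>\<omega>. X \<omega> + Y \<omega>) \<in> H"
    and scale_in: "X \<in> H \<Longrightarrow> (\<lambda>\<omega>. c * X \<omega>) \<in> H"
    and comp_in: "random_vector H k Z \<Longrightarrow> \<phi> \<in> C_lLip k \<Longrightarrow> (\<lambda>\<omega>. \<phi> (Z \<omega>)) \<in> H"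
    and E_mono: "X \<in> H \<Longrightarrow> Y \<in> H \<Longrightarrow> (\<And>\<omega>. X \<omega> \<le> Y \<omega>) \<Longrightarrow> E X \<le> E Y"
    and E_const: "E (\<lambda>_. c) = c"
    and E_subadd: "X \<in> H \<Longrightarrow> Y \<in> H \<Longrightarrow> E (\<lambda>\<omega>. X \<omega> + Y \<omega>) \<le> E X + E Y"
    and E_scale: "X \<in> H \<Longrightarrow> 0 \<le> c \<Longrightarrow> E (\<lambda>\<omega>. c * X \<omega>) = c * E X"

section \<open>Independence and identical distribution\<close>

text \<open>\<open>indep H E k X l Y\<close>: the \<open>l\<close>-dimensional \<open>Y\<close> is independent from the \<open>k\<close>-dimensional \<open>X\<close>.
  This relation is not symmetric.\<close>

definition indep ::
  "('a \<Rightarrow> real) set \<Rightarrow> (('a \<Rightarrow> real) \<Rightarrow> real) \<Rightarrow> nat \<Rightarrow> ('a \<Rightarrow> real vec) \<Rightarrow> nat \<Rightarrow> ('a \<Rightarrow> real vec) \<Rightarrow> bool"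
  where
  "indep H E k X l Y \<longleftrightarrow> random_vector H k X \<and> random_vector H l Y \<and>
     (\<forall>\<phi>\<in>C_lLip (k + l).
        E (\<lambda>\<omega>. \<phi> (X \<omega> @\<^sub>v Y \<omega>)) = E (\<lambda>\<omega>. E (\<lambda>\<omega>'. \<phi> (X \<omega> @\<^sub>v Y \<omega>'))))"

definition ident_dist ::
  "('a \<Rightarrow> real) set \<Rightarrow> (('a \<Rightarrow> real) \<Rightarrow> real) \<Rightarrow> nat \<Rightarrow> ('a \<Rightarrow> real vec) \<Rightarrow> ('a \<Rightarrow> real vec) \<Rightarrow> bool"
  where
  "ident_dist H E k X Y \<longleftrightarrow> random_vector H k X \<and> random_vector H k Y \<and>
     (\<forall>\<phi>\<in>C_lLip k. E (\<lambda>\<omega>. \<phi> (X \<omega>)) = E (\<lambda>\<omega>. \<phi> (Y \<omega>)))"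

definition indep_copy ::
  "('a \<Rightarrow> real) set \<Rightarrow> (('a \<Rightarrow> real) \<Rightarrow> real) \<Rightarrow> nat \<Rightarrow> ('a \<Rightarrow> real vec) \<Rightarrow> ('a \<Rightarrow> real vec) \<Rightarrow> bool"
  where
  "indep_copy H E k X X' \<longleftrightarrow> ident_dist H E k X X' \<and> indep H E k X k X'"

section \<open>G-normality\<close>

text \<open>
  A given space need not contain any independent copy of a given random vector, in which case
  quantifying only over copies in that space would make G-normality vacuously true. As usual in the
  theory, an independent copy may therefore live on an extension of the space.
  Extensions with underlying set \<open>\<Omega> \<times> \<Omega>\<close> suffice: the product space is one and
  carries an independent copy of every random vector, and a copy \<open>X'\<close> on \<open>\<Omega>\<close> itself is covered,
  as \<open>X' \<circ> fst\<close>, by the extension \<open>{f \<circ> fst | f. f \<in> H}\<close>.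
\<close>

definition extension ::
  "('b \<Rightarrow> 'a) \<Rightarrow> ('b \<Rightarrow> real) set \<Rightarrow> (('b \<Rightarrow> real) \<Rightarrow> real) \<Rightarrow> ('a \<Rightarrow> real) set \<Rightarrow> (('a \<Rightarrow> real) \<Rightarrow> real) \<Rightarrow> bool"
  where
  "extension p H' E' H E \<longleftrightarrow> sublinear_expectation_space H' E' \<and>
     (\<forall>X\<in>H. X \<circ> p \<in> H' \<and> E' (X \<circ> p) = E X)"

definition G_normal ::
  "('a \<Rightarrow> real) set \<Rightarrow> (('a \<Rightarrow> real) \<Rightarrow> real) \<Rightarrow> nat \<Rightarrow> ('a \<Rightarrow> real vec) \<Rightarrow> bool"
  where
  "G_normal H E k X \<longleftrightarrow> random_vector H k X \<and>
     (\<forall>(H' :: ('a \<times> 'a \<Rightarrow> real) set) E' X' a b.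
        extension fst H' E' H E \<longrightarrow> indep_copy H' E' k (X \<circ> fst) X' \<longrightarrow> 0 \<le> a \<longrightarrow> 0 \<le> b \<longrightarrow>
        ident_dist H' E' k
          (\<lambda>\<omega>. a \<cdot>\<^sub>v (X \<circ> fst) \<omega> + b \<cdot>\<^sub>v X' \<omega>)
          (\<lambda>\<omega>. sqrt (a\<^sup>2 + b\<^sup>2) \<cdot>\<^sub>v (X \<circ> fst) \<omega>))"

definition sym_mats :: "nat \<Rightarrow> real mat set" where
  "sym_mats k = {A \<in> carrier_mat k k. transpose_mat A = A}"

definition psd_mats :: "nat \<Rightarrow> real mat set" where
  "psd_mats k = {A \<in> sym_mats k. \<forall>x\<in>carrier_vec k. 0 \<le> (A *\<^sub>v x) \<bullet> x}"

text \<open>\<open>real mat\<close> carries no topology in the library; on \<open>k \<times> k\<close> matrices the usual one is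
  entrywise convergence.\<close>

definition bounded_mats :: "real mat set \<Rightarrow> bool" where
  "bounded_mats S \<longleftrightarrow> (\<exists>c. \<forall>B\<in>S. norm_bound B c)"

definition closed_mats :: "nat \<Rightarrow> real mat set \<Rightarrow> bool" where
  "closed_mats k S \<longleftrightarrow> (\<forall>B. \<forall>L\<in>carrier_mat k k. (\<forall>l. B l \<in> S) \<longrightarrow>
     (\<forall>i<k. \<forall>j<k. (\<lambda>l. B l $$ (i, j)) \<longlonglongrightarrow> L $$ (i, j)) \<longrightarrow> L \<in> S)"

definition convex_mats :: "real mat set \<Rightarrow> bool" where
  "convex_mats S \<longleftrightarrow> (\<forall>A\<in>S. \<forall>B\<in>S. \<forall>t. 0 \<le> t \<longrightarrow> t \<le> 1 \<longrightarrow>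
     (1 - t) \<cdot>\<^sub>m A + t \<cdot>\<^sub>m B \<in> S)"

definition mat_trace :: "real mat \<Rightarrow> real" where
  "mat_trace A = (\<Sum>i<dim_row A. A $$ (i, i))"

text \<open>\<open>X \<sim> \<N>(0, \<Gamma>)\<close>. The set \<open>\<Gamma>\<close> is required to be nonempty so that the
  supremum is a genuine one (\<^term>\<open>Sup {} :: real\<close> is unspecified).\<close>

definition normal_dist ::
  "('a \<Rightarrow> real) set \<Rightarrow> (('a \<Rightarrow> real) \<Rightarrow> real) \<Rightarrow> nat \<Rightarrow> ('a \<Rightarrow> real vec) \<Rightarrow> real mat set \<Rightarrow> bool"
  where
  "normal_dist H E k X \<Gamma> \<longleftrightarrow>
     \<Gamma> \<noteq> {} \<and> \<Gamma> \<subseteq> psd_mats k \<and> bounded_mats \<Gamma> \<and> closed_mats k \<Gamma> \<and> convex_mats \<Gamma> \<and>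
     G_normal H E k X \<and>
     (\<forall>A\<in>sym_mats k.
        1/2 * E (\<lambda>\<omega>. (A *\<^sub>v X \<omega>) \<bullet> X \<omega>) = 1/2 * (SUP B\<in>\<Gamma>. mat_trace (A * B)))"

definition normal_dist1 ::
  "('a \<Rightarrow> real) set \<Rightarrow> (('a \<Rightarrow> real) \<Rightarrow> real) \<Rightarrow> ('a \<Rightarrow> real) \<Rightarrow> real set \<Rightarrow> bool"
  where
  "normal_dist1 H E X I \<longleftrightarrow> normal_dist H E 1 (vec1 X) ((\<lambda>r. mat 1 1 (\<lambda>_. r)) ` I)"

definition outer :: "real vec \<Rightarrow> real vec \<Rightarrow> real mat" where
  "outer u w = mat (dim_vec u) (dim_vec w) (\<lambda>(i, j). u $ i * w $ j)"

end

theory Submission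
  imports "HOL-Analysis.Interval_Integral" "HOL-Analysis.Lipschitz" Defs
begin

text \<open>
  \<^bold>\<open>G-normality is a property of the law.\<close>
  Every random vector \<open>X\<close> has an independent copy on \<open>\<Omega> \<times> \<Omega>\<close>: integrate first over the second
  factor, then over the first. Therefore \<open>X\<close> is G-normal if and only if it is \<^emph>\<open>stable\<close>, that is,
  \<open>E\<^sub>\<omega> E\<^sub>\<eta> \<phi>(a X(\<omega>) + b X(\<eta>)) = E \<phi>(\<surd>(a\<^sup>2 + b\<^sup>2) X)\<close> for all test functions \<open>\<phi>\<close>
  (\<open>stable_imp_G_normal\<close>, \<open>G_normal_imp_stable\<close>). No copy of \<open>X\<close> occurs in this condition, and it
  passes to linear images of \<open>X\<close> and to equally distributed vectors.

  \<^bold>\<open>Uniqueness in dimension one.\<close>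
  Two stable variables \<open>X\<close>, \<open>Z\<close> with \<open>E(c X\<^sup>2) = E(c Z\<^sup>2)\<close> for all \<open>c\<close> have the same law
  (\<open>stable1_unique\<close>). Stability says that \<open>T\<^sub>t f(x) = E f(x + \<surd>t X)\<close> and
  \<open>S\<^sub>t f(x) = E f(x + \<surd>t Z)\<close> are semigroups, and both have the generator
  \<open>f \<mapsto> E(f'' X\<^sup>2)/2\<close>, since stable variables have mean zero. Instead of the regularity theory of the
  G-heat equation, the proof smooths in space by a twofold Steklov mean \<open>M\<close>. By sublinearity
  \<open>T\<^sub>h M f \<le> M T\<^sub>h f\<close>, so \<open>t \<mapsto> M T\<^sub>t f\<close> is a supersolution for the first semigroup; its
  Taylor remainders are of order \<open>h\<^bsup>3/2\<^esup>\<close> uniformly in \<open>t\<close>, which makes it a supersolution for \<open>S\<close> up to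
  such an error. Adding up \<open>1/h\<close> steps and letting \<open>h \<rightarrow> 0\<close> gives \<open>S\<^sub>1 M f \<le> M T\<^sub>1 f\<close>; as \<open>M\<close> tends
  to the identity, \<open>S\<^sub>1 f \<le> T\<^sub>1 f\<close>, and equality follows by exchanging the roles. In particular
  a stable variable has the same law as its negative.

  \<^bold>\<open>Linear forms.\<close>
  By this symmetry the signs of the coefficients in \<open>\<Sum>\<^sub>i w\<^sub>i Y\<^sub>i\<close> do not matter, and stability together with
  the successive independence of the \<open>Y\<^sub>i\<close> collapses the sum, one summand at a time, to the law of
  \<open>\<parallel>w\<parallel> Y\<^sub>0\<close> (\<open>partial_sum_dist\<close>). Since \<open>\<langle>v, A Y\<rangle>\<close> is the linear form with coefficients
  \<open>A\<^sup>\<top> v\<close>, and \<open>u w\<^sup>\<top> Y\<close> is a linear form times the fixed vector \<open>u\<close>, this settles both positive claims.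

  \<^bold>\<open>Failure of joint G-normality.\<close>
  If \<open>A Y\<close> were G-normal with \<open>A\<close> invertible, then \<open>Y\<close> would be stable, and \<open>\<phi>(y) = y\<^sub>0\<^sup>2 y\<^sub>1\<close>,
  \<open>a = b = 1\<close> would give the same value for \<open>Y(\<omega>) + Y(\<eta>)\<close> and for \<open>\<surd>2 Y\<close>. For \<open>\<surd>2 Y\<close> the value is zero,
  because \<open>Y\<^sub>1\<close> has mean zero conditionally on \<open>Y\<^sub>0\<close>. For the sum, the inner expectation contains
  \<open>E(y\<^sub>1 Y\<^sub>0\<^sup>2)\<close> with \<open>y\<^sub>1 = Y\<^sub>1(\<omega>)\<close>, which is a multiple of \<open>y\<^sub>1\<close> plus
  \<open>(\<sigma>\<^sub>u\<^sup>2 - \<sigma>\<^sub>l\<^sup>2) |y\<^sub>1| / 2\<close>; the second term leaves a strictly positive contribution. The variance of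
  \<open>Y\<^sub>0\<close> can be adapted to the sign of \<open>Y\<^sub>1\<close> only where \<open>Y\<^sub>1\<close> is revealed first.
\<close>

(* From here on, $ and \<bullet> are the coordinates and the scalar product of vectors of variable dimension. *)
unbundle no vec_syntax and no inner_syntax

section \<open>Functions with polynomially growing Lipschitz constant\<close>

lemma vnorm_eq_L2_set: "vnorm x = L2_set (\<lambda>i. x $ i) {0..<dim_vec x}"
  by (simp add: vnorm_def L2_set_def scalar_prod_def power2_eq_square)

lemma vnorm_nonneg [simp]: "0 \<le> vnorm x"
  by (simp add: vnorm_eq_L2_set)

lemma vnorm_square: "(vnorm x)\<^sup>2 = (\<Sum>i<dim_vec x. (x $ i)\<^sup>2)"
  by (simp add: vnorm_eq_L2_set L2_set_def sum_nonneg atLeast0LessThan)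

lemma abs_coord_le_vnorm: "i < dim_vec x \<Longrightarrow> \<bar>x $ i\<bar> \<le> vnorm x"
proof -
  assume "i < dim_vec x"
  then have "\<bar>x $ i\<bar> \<le> L2_set (\<lambda>i. \<bar>x $ i\<bar>) {0..<dim_vec x}"
    by (intro member_le_L2_set) auto
  then show ?thesis by (simp add: vnorm_eq_L2_set L2_set_def)
qed

lemma vnorm_le_sum_abs: "vnorm x \<le> (\<Sum>i<dim_vec x. \<bar>x $ i\<bar>)"
  using L2_set_le_sum_abs[of "\<lambda>i. x $ i" "{0..<dim_vec x}"]
  by (simp add: vnorm_eq_L2_set atLeast0LessThan)

lemma vnorm_triangle:
  assumes "x \<in> carrier_vec k" "y \<in> carrier_vec k"
  shows "vnorm (x + y) \<le> vnorm x + vnorm y"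
proof -
  have "vnorm (x + y) = L2_set (\<lambda>i. x $ i + y $ i) {0..<k}"
    using assms by (auto simp: vnorm_eq_L2_set intro!: L2_set_cong)
  also have "\<dots> \<le> vnorm x + vnorm y"
    using assms L2_set_triangle_ineq[of "\<lambda>i. x $ i" "\<lambda>i. y $ i" "{0..<k}"]
    by (simp add: vnorm_eq_L2_set)
  finally show ?thesis .
qed

lemma vnorm_minus_commute:
  assumes "x \<in> carrier_vec k" "y \<in> carrier_vec k"
  shows "vnorm (x - y) = vnorm (y - x)"
proof -
  have "(vnorm (x - y))\<^sup>2 = (vnorm (y - x))\<^sup>2"
    using assms by (auto simp: vnorm_square power2_commute intro!: sum.cong)
  then show ?thesis by (simp add: power2_eq_iff_nonneg)
qed

lemma vnorm_abs_diff_le: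
  assumes "x \<in> carrier_vec k" "y \<in> carrier_vec k"
  shows "\<bar>vnorm x - vnorm y\<bar> \<le> vnorm (x - y)"
proof -
  have "x = (x - y) + y" "y = (y - x) + x" using assms by auto
  then have "vnorm x \<le> vnorm (x - y) + vnorm y" "vnorm y \<le> vnorm (y - x) + vnorm x"
    using assms by (metis minus_carrier_vec vnorm_triangle)+
  then show ?thesis using vnorm_minus_commute[OF assms] by linarith
qed

lemma vnorm_append_le: "vnorm (x @\<^sub>v y) \<le> vnorm x + vnorm y"
proof -
  have "(vnorm (x @\<^sub>v y))\<^sup>2 = (vnorm x)\<^sup>2 + (vnorm y)\<^sup>2"
    by (simp add: vnorm_def scalar_prod_append[of x "dim_vec x" y "dim_vec y"])
       (simp add: scalar_prod_def sum_nonneg)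
  also have "\<dots> \<le> (vnorm x + vnorm y)\<^sup>2"
    by (simp add: power2_sum)
  finally show ?thesis by (rule power2_le_imp_le) simp
qed

lemma vnorm_append_diff:
  assumes "x \<in> carrier_vec k" "x' \<in> carrier_vec k"
  shows "vnorm ((x @\<^sub>v y) - (x' @\<^sub>v y)) = vnorm (x - x')"
proof -
  have "(x @\<^sub>v y) - (x' @\<^sub>v y) = (x - x') @\<^sub>v 0\<^sub>v (dim_vec y)"
    using assms by (intro eq_vecI) (auto simp: append_vec_def)
  moreover have "((x - x') @\<^sub>v 0\<^sub>v (dim_vec y)) \<bullet> ((x - x') @\<^sub>v 0\<^sub>v (dim_vec y)) = (x - x') \<bullet> (x - x')"
    using assms by (subst scalar_prod_append[of _ k _ "dim_vec y"]) auto
  ultimately show ?thesis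
    by (simp add: vnorm_def)
qed

text \<open>
  All estimates for test functions have the form \<open>C P\<^sup>m Q\<close>: \<open>P \<ge> 1\<close> is a weight of which any power is
  allowed, \<open>Q\<close> is a fixed factor such as the distance of two points. Hiding \<open>C\<close> and \<open>m\<close> makes sums and
  products of such estimates compose without bookkeeping.
\<close>

definition poly_dom :: "'z set \<Rightarrow> ('z \<Rightarrow> real) \<Rightarrow> ('z \<Rightarrow> real) \<Rightarrow> ('z \<Rightarrow> real) \<Rightarrow> bool" where
  "poly_dom S P Q g \<longleftrightarrow> (\<exists>C\<ge>0. \<exists>m::nat. \<forall>z\<in>S. \<bar>g z\<bar> \<le> C * P z ^ m * Q z)"

lemma poly_dom_add:
  assumes "poly_dom S P Q f" "poly_dom S P Q g" "\<And>z. z \<in> S \<Longrightarrow> 1 \<le> P z" "\<And>z. z \<in> S \<Longrightarrow> 0 \<le> Q z"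
  shows "poly_dom S P Q (\<lambda>z. \<bar>f z\<bar> + \<bar>g z\<bar>)"
proof -
  obtain C m D p where C: "0 \<le> C" "\<And>z. z \<in> S \<Longrightarrow> \<bar>f z\<bar> \<le> C * P z ^ m * Q z"
    and D: "0 \<le> D" "\<And>z. z \<in> S \<Longrightarrow> \<bar>g z\<bar> \<le> D * P z ^ p * Q z"
    using assms(1,2) unfolding poly_dom_def by blast
  have "\<bar>f z\<bar> + \<bar>g z\<bar> \<le> (C + D) * P z ^ (max m p) * Q z" if z: "z \<in> S" for z
  proof -
    have "P z ^ m \<le> P z ^ max m p" "P z ^ p \<le> P z ^ max m p"
      using assms(3)[OF z] by (auto intro: power_increasing)
    then have "C * P z ^ m * Q z \<le> C * P z ^ max m p * Q z" "D * P z ^ p * Q z \<le> D * P z ^ max m p * Q z"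
      using C D assms(4)[OF z] by (auto intro!: mult_right_mono mult_left_mono)
    then show ?thesis using C(2)[OF z] D(2)[OF z] by (simp add: algebra_simps)
  qed
  then show ?thesis unfolding poly_dom_def using C(1) D(1)
    by (intro exI[of _ "C + D"] conjI exI[of _ "max m p"]) auto
qed

lemma poly_dom_mono:
  assumes "poly_dom S P Q g" "\<And>z. z \<in> S \<Longrightarrow> \<bar>f z\<bar> \<le> \<bar>g z\<bar>"
  shows "poly_dom S P Q f"
  using assms unfolding poly_dom_def by (meson order_trans)

lemma poly_dom_sum:
  fixes g :: "nat \<Rightarrow> 'z \<Rightarrow> real"
  assumes "\<And>i. i < l \<Longrightarrow> poly_dom S P Q (g i)" "\<And>z. z \<in> S \<Longrightarrow> 1 \<le> P z" "\<And>z. z \<in> S \<Longrightarrow> 0 \<le> Q z"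
  shows "poly_dom S P Q (\<lambda>z. \<Sum>i<l. \<bar>g i z\<bar>)"
  using assms(1)
proof (induction l)
  case 0
  show ?case using assms(2,3) by (auto simp: poly_dom_def intro!: exI[of _ 0])
next
  case (Suc l)
  then have "poly_dom S P Q (\<lambda>z. \<Sum>i<l. \<bar>g i z\<bar>)" "poly_dom S P Q (g l)" by auto
  from poly_dom_add[OF this assms(2,3)] show ?case by (simp add: sum_nonneg)
qed

lemma poly_dom_mult:
  assumes "poly_dom S P Q f" "poly_dom S P R g" "\<And>z. z \<in> S \<Longrightarrow> 1 \<le> P z" "\<And>z. z \<in> S \<Longrightarrow> 0 \<le> Q z"
  shows "poly_dom S P (\<lambda>z. Q z * R z) (\<lambda>z. f z * g z)"
proof -
  obtain C m D p where C: "0 \<le> C" "\<And>z. z \<in> S \<Longrightarrow> \<bar>f z\<bar> \<le> C * P z ^ m * Q z"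
    and D: "0 \<le> D" "\<And>z. z \<in> S \<Longrightarrow> \<bar>g z\<bar> \<le> D * P z ^ p * R z"
    using assms(1,2) unfolding poly_dom_def by blast
  have "\<bar>f z * g z\<bar> \<le> (C * D) * P z ^ (m + p) * (Q z * R z)" if z: "z \<in> S" for z
  proof -
    have "\<bar>f z * g z\<bar> \<le> (C * P z ^ m * Q z) * (D * P z ^ p * R z)"
      unfolding abs_mult using C D assms(3,4)[OF z] z by (intro mult_mono mult_nonneg_nonneg) auto
    then show ?thesis by (simp add: power_add mult_ac)
  qed
  then show ?thesis unfolding poly_dom_def using C(1) D(1)
    by (intro exI[of _ "C * D"] conjI exI[of _ "m + p"]) auto
qed

text \<open>
  The weight \<open>1 + |x|\<^sup>m + |y|\<^sup>m\<close> is comparable to \<open>(1 + |x| + |y|)\<^sup>m\<close>. Powers of a single weight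
  multiply, which is what products and compositions need.
\<close>

lemma C_lLip_iff_poly_dom:
  "\<phi> \<in> C_lLip k \<longleftrightarrow> poly_dom (carrier_vec k \<times> carrier_vec k)
     (\<lambda>(x, y). 1 + vnorm x + vnorm y) (\<lambda>(x, y). vnorm (x - y)) (\<lambda>(x, y). \<phi> x - \<phi> y)"
proof
  have pow: "1 + a ^ m + b ^ m \<le> 3 * (1 + a + b) ^ m" if "0 \<le> a" "0 \<le> b" for a b :: real and m :: nat
  proof -
    have "1 ^ m \<le> (1 + a + b) ^ m" "a ^ m \<le> (1 + a + b) ^ m" "b ^ m \<le> (1 + a + b) ^ m"
      using that by (intro power_mono; simp)+
    then show ?thesis by simp
  qed
  assume "\<phi> \<in> C_lLip k"
  then obtain C m where C: "0 < C" and *: "\<And>x y. x \<in> carrier_vec k \<Longrightarrow> y \<in> carrier_vec k \<Longrightarrow>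
      \<bar>\<phi> x - \<phi> y\<bar> \<le> C * (1 + vnorm x ^ m + vnorm y ^ m) * vnorm (x - y)"
    unfolding C_lLip_def by blast
  have "\<bar>\<phi> x - \<phi> y\<bar> \<le> (C * 3) * (1 + vnorm x + vnorm y) ^ m * vnorm (x - y)"
    if "x \<in> carrier_vec k" "y \<in> carrier_vec k" for x y
  proof -
    have "C * (1 + vnorm x ^ m + vnorm y ^ m) * vnorm (x - y)
        \<le> C * (3 * (1 + vnorm x + vnorm y) ^ m) * vnorm (x - y)"
      using C pow[of "vnorm x" "vnorm y" m] by (intro mult_right_mono mult_left_mono) auto
    then show ?thesis using *[OF that] by (simp add: mult_ac)
  qed
  then show "poly_dom (carrier_vec k \<times> carrier_vec k)
     (\<lambda>(x, y). 1 + vnorm x + vnorm y) (\<lambda>(x, y). vnorm (x - y)) (\<lambda>(x, y). \<phi> x - \<phi> y)"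
    unfolding poly_dom_def using C by (intro exI[of _ "C * 3"] conjI exI[of _ m]) auto
next
  have pow: "(1 + a + b) ^ m \<le> 3 ^ m * (1 + a ^ m + b ^ m)" if "0 \<le> a" "0 \<le> b" for a b :: real and m :: nat
  proof -
    define c where "c = max 1 (max a b)"
    have "(1 + a + b) ^ m \<le> (3 * c) ^ m" using that by (intro power_mono) (auto simp: c_def)
    also have "\<dots> = 3 ^ m * c ^ m" by (simp add: power_mult_distrib)
    also have "c ^ m \<le> 1 + a ^ m + b ^ m" using that by (auto simp: c_def max_def)
    finally show ?thesis by simp
  qed
  assume "poly_dom (carrier_vec k \<times> carrier_vec k)
     (\<lambda>(x, y). 1 + vnorm x + vnorm y) (\<lambda>(x, y). vnorm (x - y)) (\<lambda>(x, y). \<phi> x - \<phi> y)"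
  then obtain C m where C: "0 \<le> C" and *: "\<And>x y. x \<in> carrier_vec k \<Longrightarrow> y \<in> carrier_vec k \<Longrightarrow>
      \<bar>\<phi> x - \<phi> y\<bar> \<le> C * (1 + vnorm x + vnorm y) ^ m * vnorm (x - y)"
    unfolding poly_dom_def by auto
  have "\<bar>\<phi> x - \<phi> y\<bar> \<le> (C * 3 ^ m + 1) * (1 + vnorm x ^ m + vnorm y ^ m) * vnorm (x - y)"
    if "x \<in> carrier_vec k" "y \<in> carrier_vec k" for x y
  proof -
    have "C * (1 + vnorm x + vnorm y) ^ m \<le> C * (3 ^ m * (1 + vnorm x ^ m + vnorm y ^ m))"
      using C pow[of "vnorm x" "vnorm y" m] by (intro mult_left_mono) auto
    also have "\<dots> \<le> (C * 3 ^ m + 1) * (1 + vnorm x ^ m + vnorm y ^ m)"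
      by (simp add: distrib_right mult_ac add_nonneg_nonneg)
    finally show ?thesis using *[OF that] by (meson mult_right_mono order_trans vnorm_nonneg)
  qed
  then show "\<phi> \<in> C_lLip k"
    unfolding C_lLip_def using C by (auto intro!: exI[of _ "C * 3 ^ m + 1"] exI[of _ m] add_nonneg_pos)
qed

lemma C_lLip_cong:
  "(\<And>x. x \<in> carrier_vec k \<Longrightarrow> f x = g x) \<Longrightarrow> f \<in> C_lLip k \<longleftrightarrow> g \<in> C_lLip k"
  unfolding C_lLip_def by auto

lemma C_lLip_growth:
  assumes "f \<in> C_lLip k"
  shows "poly_dom (carrier_vec k) (\<lambda>x. 1 + vnorm x) (\<lambda>_. 1) f"
proof -
  obtain C m where C: "0 \<le> C" and *: "\<And>x y. x \<in> carrier_vec k \<Longrightarrow> y \<in> carrier_vec k \<Longrightarrow>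
      \<bar>f x - f y\<bar> \<le> C * (1 + vnorm x + vnorm y) ^ m * vnorm (x - y)"
    using assms unfolding C_lLip_iff_poly_dom poly_dom_def by auto
  have "\<bar>f x\<bar> \<le> (\<bar>f (0\<^sub>v k)\<bar> + C) * (1 + vnorm x) ^ Suc m" if x: "x \<in> carrier_vec k" for x
  proof -
    have "vnorm (0\<^sub>v k) = 0" "x - 0\<^sub>v k = x" using x by (auto simp: vnorm_def)
    then have "\<bar>f x\<bar> \<le> \<bar>f (0\<^sub>v k)\<bar> + C * (1 + vnorm x) ^ m * vnorm x"
      using *[OF x, of "0\<^sub>v k"] by simp
    also have "\<bar>f (0\<^sub>v k)\<bar> \<le> \<bar>f (0\<^sub>v k)\<bar> * (1 + vnorm x) ^ Suc m"
      using mult_left_mono[OF one_le_power[of "1 + vnorm x" "Suc m"], of "\<bar>f (0\<^sub>v k)\<bar>"] by simp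
    also have "C * (1 + vnorm x) ^ m * vnorm x \<le> C * (1 + vnorm x) ^ m * (1 + vnorm x)"
      using C by (intro mult_left_mono) auto
    finally show ?thesis by (simp add: algebra_simps)
  qed
  then show ?thesis unfolding poly_dom_def using C
    by (intro exI[of _ "\<bar>f (0\<^sub>v k)\<bar> + C"] conjI exI[of _ "Suc m"]) auto
qed

lemma C_lLip_growth_pair:
  assumes "f \<in> C_lLip k"
  shows "poly_dom (carrier_vec k \<times> carrier_vec k) (\<lambda>(x, y). 1 + vnorm x + vnorm y) (\<lambda>_. 1) (\<lambda>(x, y). f x)"
    and "poly_dom (carrier_vec k \<times> carrier_vec k) (\<lambda>(x, y). 1 + vnorm x + vnorm y) (\<lambda>_. 1) (\<lambda>(x, y). f y)"
proof -
  obtain C m where C: "0 \<le> C" and *: "\<And>x. x \<in> carrier_vec k \<Longrightarrow> \<bar>f x\<bar> \<le> C * (1 + vnorm x) ^ m"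
    using C_lLip_growth[OF assms] unfolding poly_dom_def by auto
  have "C * (1 + vnorm x) ^ m \<le> C * (1 + vnorm x + vnorm y) ^ m"
       "C * (1 + vnorm y) ^ m \<le> C * (1 + vnorm x + vnorm y) ^ m" for x y
    using C by (auto intro!: mult_left_mono power_mono)
  then show "poly_dom (carrier_vec k \<times> carrier_vec k) (\<lambda>(x, y). 1 + vnorm x + vnorm y) (\<lambda>_. 1) (\<lambda>(x, y). f x)"
    "poly_dom (carrier_vec k \<times> carrier_vec k) (\<lambda>(x, y). 1 + vnorm x + vnorm y) (\<lambda>_. 1) (\<lambda>(x, y). f y)"
    unfolding poly_dom_def using C
    by (auto intro!: exI[of _ C] exI[of _ m] intro: order_trans[OF *])
qed

lemma C_lLip_const: "(\<lambda>_. c) \<in> C_lLip k"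
  unfolding C_lLip_def by (auto intro!: exI[of _ 1])

lemma C_lLip_lipschitz:
  assumes "\<And>x y. x \<in> carrier_vec k \<Longrightarrow> y \<in> carrier_vec k \<Longrightarrow> \<bar>f x - f y\<bar> \<le> L * vnorm (x - y)"
  shows "f \<in> C_lLip k"
  unfolding C_lLip_iff_poly_dom poly_dom_def
proof (intro exI[of _ "\<bar>L\<bar>"] conjI exI[of _ 0])
  have "L * vnorm (x - y) \<le> \<bar>L\<bar> * vnorm (x - y)" for x y by (intro mult_right_mono) auto
  then show "\<forall>z\<in>carrier_vec k \<times> carrier_vec k. \<bar>case z of (x, y) \<Rightarrow> f x - f y\<bar>
      \<le> \<bar>L\<bar> * (case z of (x, y) \<Rightarrow> 1 + vnorm x + vnorm y) ^ 0 * (case z of (x, y) \<Rightarrow> vnorm (x - y))"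
    using assms by (auto intro: order_trans[OF assms])
qed simp

lemma C_lLip_vnorm: "vnorm \<in> C_lLip k"
  using vnorm_abs_diff_le by (intro C_lLip_lipschitz[of _ _ 1]) auto

lemma C_lLip_coord:
  assumes "i < k" shows "(\<lambda>x. x $ i) \<in> C_lLip k"
proof (rule C_lLip_lipschitz[of _ _ 1])
  fix x y :: "real vec" assume "x \<in> carrier_vec k" "y \<in> carrier_vec k"
  then show "\<bar>x $ i - y $ i\<bar> \<le> 1 * vnorm (x - y)"
    using assms abs_coord_le_vnorm[of i "x - y"] by auto
qed

lemma C_lLip_add:
  assumes "f \<in> C_lLip k" "g \<in> C_lLip k" shows "(\<lambda>x. f x + g x) \<in> C_lLip k"
  unfolding C_lLip_iff_poly_dom
  by (rule poly_dom_mono[OF poly_dom_add[OF assms[unfolded C_lLip_iff_poly_dom]]]) auto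

lemma C_lLip_mult:
  assumes "f \<in> C_lLip k" "g \<in> C_lLip k" shows "(\<lambda>x. f x * g x) \<in> C_lLip k"
proof -
  let ?S = "carrier_vec k \<times> carrier_vec k :: (real vec \<times> real vec) set"
  let ?P = "\<lambda>(x, y). 1 + vnorm x + vnorm y" and ?Q = "\<lambda>(x, y). vnorm (x - y)"
  have "poly_dom ?S ?P (\<lambda>z. 1 * ?Q z) (\<lambda>z. (case z of (x, y) \<Rightarrow> f x) * (case z of (x, y) \<Rightarrow> g x - g y))"
    by (rule poly_dom_mult[OF C_lLip_growth_pair(1)[OF assms(1)] assms(2)[unfolded C_lLip_iff_poly_dom]]) auto
  moreover have "poly_dom ?S ?P (\<lambda>z. 1 * ?Q z) (\<lambda>z. (case z of (x, y) \<Rightarrow> g y) * (case z of (x, y) \<Rightarrow> f x - f y))"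
    by (rule poly_dom_mult[OF C_lLip_growth_pair(2)[OF assms(2)] assms(1)[unfolded C_lLip_iff_poly_dom]]) auto
  ultimately have "poly_dom ?S ?P (\<lambda>z. 1 * ?Q z)
     (\<lambda>z. \<bar>(case z of (x, y) \<Rightarrow> f x) * (case z of (x, y) \<Rightarrow> g x - g y)\<bar> + \<bar>(case z of (x, y) \<Rightarrow> g y) * (case z of (x, y) \<Rightarrow> f x - f y)\<bar>)"
    by (intro poly_dom_add) auto
  then have "poly_dom ?S ?P (\<lambda>z. 1 * ?Q z) (\<lambda>(x, y). f x * g x - f y * g y)"
  proof (rule poly_dom_mono)
    fix z assume "z \<in> ?S"
    have "f x * g x - f y * g y = f x * (g x - g y) + g y * (f x - f y)" for x y
      by (simp add: algebra_simps)
    then have "\<bar>f x * g x - f y * g y\<bar> \<le> \<bar>\<bar>f x * (g x - g y)\<bar> + \<bar>g y * (f x - f y)\<bar>\<bar>" for x y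
      by (metis abs_triangle_ineq abs_ge_self order_trans)
    then show "\<bar>case z of (x, y) \<Rightarrow> f x * g x - f y * g y\<bar> \<le> \<bar>\<bar>(case z of (x, y) \<Rightarrow> f x) * (case z of (x, y) \<Rightarrow> g x - g y)\<bar> + \<bar>(case z of (x, y) \<Rightarrow> g y) * (case z of (x, y) \<Rightarrow> f x - f y)\<bar>\<bar>"
      by (auto split: prod.split)
  qed
  then show ?thesis unfolding C_lLip_iff_poly_dom by simp
qed

text \<open>
  Every further closure property, and every change of variables below, is an instance of this: both the
  growth and the increments of \<open>f\<close> are controlled coordinatewise, and a power of a polynomial is a polynomial.
\<close>

lemma C_lLip_compose:
  assumes f: "\<And>i. i < l \<Longrightarrow> (\<lambda>x. f x $ i) \<in> C_lLip k"
    and carr: "\<And>x. x \<in> carrier_vec k \<Longrightarrow> f x \<in> carrier_vec l"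
    and psi: "\<psi> \<in> C_lLip l"
  shows "(\<lambda>x. \<psi> (f x)) \<in> C_lLip k"
proof -
  let ?S = "carrier_vec k \<times> carrier_vec k :: (real vec \<times> real vec) set"
  let ?P = "\<lambda>(x, y). 1 + vnorm x + vnorm y :: real" and ?Q = "\<lambda>(x, y). vnorm (x - y)"
  have "poly_dom ?S ?P ?Q (\<lambda>z. \<Sum>i<l. \<bar>case z of (x, y) \<Rightarrow> f x $ i - f y $ i\<bar>)"
    by (rule poly_dom_sum) (use f[unfolded C_lLip_iff_poly_dom] in auto)
  then obtain D p where D: "0 \<le> D" and Dp: "\<And>x y. x \<in> carrier_vec k \<Longrightarrow> y \<in> carrier_vec k \<Longrightarrow>
      (\<Sum>i<l. \<bar>f x $ i - f y $ i\<bar>) \<le> D * (1 + vnorm x + vnorm y) ^ p * vnorm (x - y)"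
    unfolding poly_dom_def by fastforce
  have diff: "vnorm (f x - f y) \<le> D * (1 + vnorm x + vnorm y) ^ p * vnorm (x - y)"
    if "x \<in> carrier_vec k" "y \<in> carrier_vec k" for x y
    using Dp[OF that] vnorm_le_sum_abs[of "f x - f y"] carr[OF that(1)] carr[OF that(2)] by simp
  have "poly_dom ?S ?P (\<lambda>_. 1) (\<lambda>z. \<bar>\<Sum>i<l. \<bar>case z of (x, y) \<Rightarrow> f x $ i\<bar>\<bar> + \<bar>\<Sum>i<l. \<bar>case z of (x, y) \<Rightarrow> f y $ i\<bar>\<bar>)"
    by (intro poly_dom_add poly_dom_sum C_lLip_growth_pair f) auto
  then obtain C q where C: "0 \<le> C" and Cq: "\<And>x y. x \<in> carrier_vec k \<Longrightarrow> y \<in> carrier_vec k \<Longrightarrow>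
      (\<Sum>i<l. \<bar>f x $ i\<bar>) + (\<Sum>i<l. \<bar>f y $ i\<bar>) \<le> C * (1 + vnorm x + vnorm y) ^ q"
    unfolding poly_dom_def by fastforce
  obtain B m where B: "0 \<le> B" and Bm: "\<And>x y. x \<in> carrier_vec l \<Longrightarrow> y \<in> carrier_vec l \<Longrightarrow>
      \<bar>\<psi> x - \<psi> y\<bar> \<le> B * (1 + vnorm x + vnorm y) ^ m * vnorm (x - y)"
    using psi unfolding C_lLip_iff_poly_dom poly_dom_def by auto
  have "\<bar>\<psi> (f x) - \<psi> (f y)\<bar> \<le> (B * (1 + C) ^ m * D) * (1 + vnorm x + vnorm y) ^ (q * m + p) * vnorm (x - y)"
    if xy: "x \<in> carrier_vec k" "y \<in> carrier_vec k" for x y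
  proof -
    let ?w = "1 + vnorm x + vnorm y"
    have "1 + vnorm (f x) + vnorm (f y) \<le> 1 + C * ?w ^ q"
      using Cq[OF xy] vnorm_le_sum_abs[of "f x"] vnorm_le_sum_abs[of "f y"] carr[OF xy(1)] carr[OF xy(2)]
      by simp
    also have "\<dots> \<le> (1 + C) * ?w ^ q"
      using one_le_power[of ?w q] by (simp add: distrib_right)
    finally have "(1 + vnorm (f x) + vnorm (f y)) ^ m \<le> ((1 + C) * ?w ^ q) ^ m"
      by (intro power_mono) auto
    then have 1: "B * (1 + vnorm (f x) + vnorm (f y)) ^ m \<le> B * ((1 + C) * ?w ^ q) ^ m"
      using B by (intro mult_left_mono) auto
    have "\<bar>\<psi> (f x) - \<psi> (f y)\<bar> \<le> B * ((1 + C) * ?w ^ q) ^ m * (D * ?w ^ p * vnorm (x - y))"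
      by (rule order_trans[OF Bm[OF carr carr, OF xy] mult_mono[OF 1 diff[OF xy]]]) (use B C in auto)
    also have "\<dots> = (B * (1 + C) ^ m * D) * ?w ^ (q * m + p) * vnorm (x - y)"
      by (simp add: power_mult_distrib power_add power_mult)
    finally show ?thesis .
  qed
  then show ?thesis unfolding C_lLip_iff_poly_dom poly_dom_def using B C D
    by (intro exI[of _ "B * (1 + C) ^ m * D"] conjI exI[of _ "q * m + p"]) auto
qed

lemma C_lLip_sum: "(\<And>i. i < (p::nat) \<Longrightarrow> f i \<in> C_lLip k) \<Longrightarrow> (\<lambda>x. \<Sum>i<p. f i x) \<in> C_lLip k"
  by (induction p) (auto intro: C_lLip_const C_lLip_add)

lemma C_lLip_power: "f \<in> C_lLip k \<Longrightarrow> (\<lambda>x. f x ^ p) \<in> C_lLip k"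
  by (induction p) (auto intro: C_lLip_const C_lLip_mult)

lemma C_lLip_diff: "f \<in> C_lLip k \<Longrightarrow> g \<in> C_lLip k \<Longrightarrow> (\<lambda>x. f x - g x) \<in> C_lLip k"
  using C_lLip_add[of f k "\<lambda>x. (- 1) * g x"] C_lLip_mult[OF C_lLip_const[of "- 1"], of g] by simp

lemmas C_lLip_intros = C_lLip_const C_lLip_coord C_lLip_add C_lLip_mult C_lLip_sum C_lLip_power C_lLip_diff

lemma C_lLip_append_left:
  assumes "\<phi> \<in> C_lLip (k + l)" "x \<in> carrier_vec k"
  shows "(\<lambda>y. \<phi> (x @\<^sub>v y)) \<in> C_lLip l"
proof (rule C_lLip_compose[OF _ _ assms(1)])
  fix i assume i: "i < k + l"
  have "(\<lambda>y. (x @\<^sub>v y) $ i) \<in> C_lLip l \<longleftrightarrow> (\<lambda>y. if i < k then x $ i else y $ (i - k)) \<in> C_lLip l"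
    using assms(2) i by (intro C_lLip_cong) auto
  then show "(\<lambda>y. (x @\<^sub>v y) $ i) \<in> C_lLip l"
    using i by (cases "i < k") (auto intro: C_lLip_const C_lLip_coord)
qed (use assms in auto)

lemma C_lLip_linear_combination:
  assumes "\<phi> \<in> C_lLip k"
  shows "(\<lambda>z. \<phi> (a \<cdot>\<^sub>v vec_first z k + b \<cdot>\<^sub>v vec_last z k)) \<in> C_lLip (k + k)"
proof (rule C_lLip_compose[OF _ _ assms])
  fix i assume i: "i < k"
  have "(\<lambda>z. (a \<cdot>\<^sub>v vec_first z k + b \<cdot>\<^sub>v vec_last z k) $ i) \<in> C_lLip (k + k)
      \<longleftrightarrow> (\<lambda>z. a * z $ i + b * z $ (k + i)) \<in> C_lLip (k + k)"
    using i by (intro C_lLip_cong) (auto simp: vec_first_def vec_last_def)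
  then show "(\<lambda>z. (a \<cdot>\<^sub>v vec_first z k + b \<cdot>\<^sub>v vec_last z k) $ i) \<in> C_lLip (k + k)"
    using i by (auto intro!: C_lLip_intros)
qed auto

lemma vec_first_append [simp]: "x \<in> carrier_vec k \<Longrightarrow> vec_first (x @\<^sub>v y) k = x"
  by (auto simp: vec_first_def)

lemma vec_last_append [simp]: "y \<in> carrier_vec k \<Longrightarrow> vec_last (x @\<^sub>v y) k = y"
  by (auto simp: vec_last_def)

text \<open>
  The test functions on the line, as functions of a real number rather than of a vector of length one.
\<close>

definition lLip1 :: "(real \<Rightarrow> real) \<Rightarrow> bool" where
  "lLip1 f \<longleftrightarrow> (\<lambda>v. f (v $ 0)) \<in> C_lLip 1"

lemma C_lLip_lLip1_compose: "lLip1 f \<Longrightarrow> g \<in> C_lLip k \<Longrightarrow> (\<lambda>x. f (g x)) \<in> C_lLip k"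
  unfolding lLip1_def
  by (drule C_lLip_compose[of 1 "\<lambda>x. vec 1 (\<lambda>_. g x)" k, rotated 2]) auto

lemma lLip1_of_C_lLip: "\<phi> \<in> C_lLip 1 \<Longrightarrow> lLip1 (\<lambda>r. \<phi> (vec 1 (\<lambda>_. r)))"
  unfolding lLip1_def by (rule C_lLip_compose[where l = 1]) (auto intro: C_lLip_coord)

lemma lLip1_lipschitz: "(\<And>x y. \<bar>f x - f y\<bar> \<le> L * \<bar>x - y\<bar>) \<Longrightarrow> lLip1 f"
  unfolding lLip1_def
proof (rule C_lLip_lipschitz[of _ _ "\<bar>L\<bar>"])
  fix x y :: "real vec" assume f: "\<And>x y. \<bar>f x - f y\<bar> \<le> L * \<bar>x - y\<bar>" and xy: "x \<in> carrier_vec 1" "y \<in> carrier_vec 1"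
  have "\<bar>f (x $ 0) - f (y $ 0)\<bar> \<le> L * \<bar>x $ 0 - y $ 0\<bar>" by (rule f)
  also have "\<dots> \<le> \<bar>L\<bar> * \<bar>x $ 0 - y $ 0\<bar>" by (intro mult_right_mono) auto
  also have "\<dots> \<le> \<bar>L\<bar> * vnorm (x - y)"
    using xy abs_coord_le_vnorm[of 0 "x - y"] by (intro mult_left_mono) auto
  finally show "\<bar>f (x $ 0) - f (y $ 0)\<bar> \<le> \<bar>L\<bar> * vnorm (x - y)" .
qed

lemma lLip1_id: "lLip1 (\<lambda>x. x)"
  by (rule lLip1_lipschitz[of _ 1]) simp

lemma lLip1_abs: "lLip1 abs"
  by (rule lLip1_lipschitz[of _ 1]) simp

lemma lLip1_const: "lLip1 (\<lambda>_. c)"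
  by (rule lLip1_lipschitz[of _ 0]) simp

lemma lLip1_add: "lLip1 f \<Longrightarrow> lLip1 g \<Longrightarrow> lLip1 (\<lambda>x. f x + g x)"
  unfolding lLip1_def by (rule C_lLip_add)

lemma lLip1_mult: "lLip1 f \<Longrightarrow> lLip1 g \<Longrightarrow> lLip1 (\<lambda>x. f x * g x)"
  unfolding lLip1_def by (rule C_lLip_mult)

lemma lLip1_diff: "lLip1 f \<Longrightarrow> lLip1 g \<Longrightarrow> lLip1 (\<lambda>x. f x - g x)"
  unfolding lLip1_def by (rule C_lLip_diff)

lemma lLip1_power: "lLip1 f \<Longrightarrow> lLip1 (\<lambda>x. f x ^ p)"
  unfolding lLip1_def by (rule C_lLip_power)

lemma lLip1_comp: "lLip1 f \<Longrightarrow> lLip1 g \<Longrightarrow> lLip1 (\<lambda>x. f (g x))"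
  using C_lLip_lLip1_compose[of f "\<lambda>v. g (v $ 0)" 1] unfolding lLip1_def by simp

lemmas lLip1_intros = lLip1_id lLip1_const lLip1_add lLip1_mult lLip1_diff lLip1_power lLip1_comp[OF lLip1_abs]

section \<open>Calculus in a sublinear expectation space\<close>

lemma random_vector_vec1 [simp]: "random_vector H (Suc 0) (vec1 X) \<longleftrightarrow> X \<in> H"
  by (auto simp: random_vector_def vec1_def)

lemma random_vector_append:
  assumes "random_vector H k X" "random_vector H l Y"
  shows "random_vector H (k + l) (\<lambda>\<omega>. X \<omega> @\<^sub>v Y \<omega>)"
  unfolding random_vector_def
proof (intro conjI allI impI)
  fix i assume i: "i < k + l"
  have "dim_vec (X \<omega>) = k" "dim_vec (Y \<omega>) = l" for \<omega> using assms by (auto simp: random_vector_def)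
  then have "(\<lambda>\<omega>. (X \<omega> @\<^sub>v Y \<omega>) $ i) = (if i < k then (\<lambda>\<omega>. X \<omega> $ i) else (\<lambda>\<omega>. Y \<omega> $ (i - k)))"
    using i by auto
  then show "(\<lambda>\<omega>. (X \<omega> @\<^sub>v Y \<omega>) $ i) \<in> H" using assms i by (auto simp: random_vector_def)
qed (use assms in \<open>auto simp: random_vector_def\<close>)

context sublinear_expectation_space
begin

lemma random_vector_map:
  assumes "random_vector H k X" "\<And>i. i < l \<Longrightarrow> (\<lambda>x. f x $ i) \<in> C_lLip k"
    "\<And>x. x \<in> carrier_vec k \<Longrightarrow> f x \<in> carrier_vec l"
  shows "random_vector H l (\<lambda>\<omega>. f (X \<omega>))"
  using assms comp_in[OF assms(1) assms(2)] unfolding random_vector_def by auto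

lemma lLip1_in: "lLip1 f \<Longrightarrow> X \<in> H \<Longrightarrow> (\<lambda>\<omega>. f (X \<omega>)) \<in> H"
  using comp_in[of 1 "vec1 X" "\<lambda>v. f (v $ 0)"] unfolding lLip1_def by (simp, simp add: vec1_def)

lemma mult_in:
  assumes "X \<in> H" "Y \<in> H" shows "(\<lambda>\<omega>. X \<omega> * Y \<omega>) \<in> H"
proof -
  have "random_vector H (1 + 1) (\<lambda>\<omega>. vec1 X \<omega> @\<^sub>v vec1 Y \<omega>)"
    by (rule random_vector_append) (use assms in simp_all)
  from comp_in[OF this, of "\<lambda>v. v $ 0 * v $ 1"] show ?thesis
    by (simp add: vec1_def C_lLip_mult C_lLip_coord)
qed

lemma diff_in: "X \<in> H \<Longrightarrow> Y \<in> H \<Longrightarrow> (\<lambda>\<omega>. X \<omega> - Y \<omega>) \<in> H"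
  using add_in[OF _ scale_in[of Y "- 1"]] by simp

lemma uminus_in: "X \<in> H \<Longrightarrow> (\<lambda>\<omega>. - X \<omega>) \<in> H"
  using scale_in[of X "- 1"] by simp

lemma abs_in: "X \<in> H \<Longrightarrow> (\<lambda>\<omega>. \<bar>X \<omega>\<bar>) \<in> H"
  by (rule lLip1_in[OF lLip1_abs])

lemma power_in: "X \<in> H \<Longrightarrow> (\<lambda>\<omega>. X \<omega> ^ p) \<in> H"
  by (rule lLip1_in[OF lLip1_power[OF lLip1_id]])

lemmas H_intros = const_in add_in scale_in mult_in diff_in uminus_in abs_in power_in

lemma E_nonneg: "X \<in> H \<Longrightarrow> (\<And>\<omega>. 0 \<le> X \<omega>) \<Longrightarrow> 0 \<le> E X"
  using E_mono[of "\<lambda>_. 0" X] by (simp add: const_in E_const)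

lemma E_abs_diff_le:
  assumes "X \<in> H" "Y \<in> H"
  shows "\<bar>E X - E Y\<bar> \<le> E (\<lambda>\<omega>. \<bar>X \<omega> - Y \<omega>\<bar>)"
proof -
  have *: "E X \<le> E Y + E (\<lambda>\<omega>. \<bar>X \<omega> - Y \<omega>\<bar>)" if "X \<in> H" "Y \<in> H" for X Y
  proof -
    have "E X \<le> E (\<lambda>\<omega>. Y \<omega> + \<bar>X \<omega> - Y \<omega>\<bar>)"
      using that by (intro E_mono H_intros) (auto simp: abs_if)
    also have "\<dots> \<le> E Y + E (\<lambda>\<omega>. \<bar>X \<omega> - Y \<omega>\<bar>)"
      using that by (intro E_subadd H_intros)
    finally show ?thesis .
  qed
  from *[OF assms] *[OF assms(2,1)] show ?thesis by (simp add: abs_minus_commute abs_le_iff)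
qed

text \<open>
  A centred summand without mean uncertainty is invisible. This replaces the additivity that a sublinear expectation lacks.
\<close>

lemma E_add_null:
  assumes "X \<in> H" "Z \<in> H" "E Z = 0" "E (\<lambda>\<omega>. - Z \<omega>) = 0"
  shows "E (\<lambda>\<omega>. X \<omega> + Z \<omega>) = E X"
proof (rule antisym)
  show "E (\<lambda>\<omega>. X \<omega> + Z \<omega>) \<le> E X" using E_subadd[of X Z] assms by simp
  have "E (\<lambda>\<omega>. (X \<omega> + Z \<omega>) + - Z \<omega>) \<le> E (\<lambda>\<omega>. X \<omega> + Z \<omega>) + E (\<lambda>\<omega>. - Z \<omega>)"
    using assms by (intro E_subadd H_intros)
  then show "E X \<le> E (\<lambda>\<omega>. X \<omega> + Z \<omega>)" using assms by simp
qed

lemma E_null_scale: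
  assumes "X \<in> H" "E X = 0" "E (\<lambda>\<omega>. - X \<omega>) = 0"
  shows "E (\<lambda>\<omega>. c * X \<omega>) = 0"
proof (cases "0 \<le> c")
  case False
  then have "E (\<lambda>\<omega>. (- c) * (- X \<omega>)) = (- c) * E (\<lambda>\<omega>. - X \<omega>)"
    using assms by (intro E_scale H_intros) auto
  then show ?thesis using assms by simp
qed (use assms E_scale in simp)

lemma E_add_const:
  assumes "X \<in> H" shows "E (\<lambda>\<omega>. X \<omega> + c) = E X + c"
proof (rule antisym)
  show "E (\<lambda>\<omega>. X \<omega> + c) \<le> E X + c" using E_subadd[OF assms const_in[of c]] by (simp add: E_const)
  have "E (\<lambda>\<omega>. (X \<omega> + c) + - c) \<le> E (\<lambda>\<omega>. X \<omega> + c) + E (\<lambda>_. - c)"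
    using assms by (intro E_subadd H_intros)
  then show "E X + c \<le> E (\<lambda>\<omega>. X \<omega> + c)" by (simp add: E_const)
qed

text \<open>
  The inner expectation of an iterated expectation is again a test function, so that the outer one makes
  sense. The increments of \<open>\<phi>\<close> in the first argument are bounded by a deterministic factor times a power
  of \<open>1 + 2 |Y|\<close>, because \<open>1 + |x| + |y| + 2 |Y| \<le> (1 + |x| + |y|) (1 + 2 |Y|)\<close>; that power lies in \<open>H\<close>
  and therefore has a finite expectation.
\<close>

lemma section_C_lLip:
  assumes Y: "random_vector H l Y" and phi: "\<phi> \<in> C_lLip (k + l)"
  shows "(\<lambda>x. E (\<lambda>\<omega>. \<phi> (x @\<^sub>v Y \<omega>))) \<in> C_lLip k"
proof -
  obtain C m where C: "0 \<le> C" and Cm: "\<And>x y. x \<in> carrier_vec (k + l) \<Longrightarrow> y \<in> carrier_vec (k + l) \<Longrightarrow>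
      \<bar>\<phi> x - \<phi> y\<bar> \<le> C * (1 + vnorm x + vnorm y) ^ m * vnorm (x - y)"
    using phi unfolding C_lLip_iff_poly_dom poly_dom_def by auto
  have Yc: "Y \<omega> \<in> carrier_vec l" for \<omega> using Y by (auto simp: random_vector_def)
  have in_H: "(\<lambda>\<omega>. \<phi> (x @\<^sub>v Y \<omega>)) \<in> H" if "x \<in> carrier_vec k" for x
    by (rule comp_in[OF Y C_lLip_append_left[OF phi that]])
  define W where "W = (\<lambda>\<omega>. (1 + 2 * vnorm (Y \<omega>)) ^ m)"
  have W: "W \<in> H" unfolding W_def by (intro H_intros comp_in[OF Y C_lLip_vnorm])
  have "\<bar>E (\<lambda>\<omega>. \<phi> (x @\<^sub>v Y \<omega>)) - E (\<lambda>\<omega>. \<phi> (y @\<^sub>v Y \<omega>))\<bar> \<le> C * E W * (1 + vnorm x + vnorm y) ^ m * vnorm (x - y)"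
    if x: "x \<in> carrier_vec k" and y: "y \<in> carrier_vec k" for x y
  proof -
    let ?c = "C * (1 + vnorm x + vnorm y) ^ m * vnorm (x - y)"
    have "\<bar>E (\<lambda>\<omega>. \<phi> (x @\<^sub>v Y \<omega>)) - E (\<lambda>\<omega>. \<phi> (y @\<^sub>v Y \<omega>))\<bar> \<le> E (\<lambda>\<omega>. \<bar>\<phi> (x @\<^sub>v Y \<omega>) - \<phi> (y @\<^sub>v Y \<omega>)\<bar>)"
      by (rule E_abs_diff_le[OF in_H[OF x] in_H[OF y]])
    also have "\<dots> \<le> E (\<lambda>\<omega>. ?c * W \<omega>)"
    proof (intro E_mono H_intros in_H x y W)
      fix \<omega>
      have "1 + vnorm (x @\<^sub>v Y \<omega>) + vnorm (y @\<^sub>v Y \<omega>) \<le> 1 + vnorm x + vnorm y + 2 * vnorm (Y \<omega>)"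
        using vnorm_append_le[of x "Y \<omega>"] vnorm_append_le[of y "Y \<omega>"] by simp
      also have "\<dots> \<le> (1 + vnorm x + vnorm y) * (1 + 2 * vnorm (Y \<omega>))"
        by (simp add: distrib_left distrib_right)
      finally have "(1 + vnorm (x @\<^sub>v Y \<omega>) + vnorm (y @\<^sub>v Y \<omega>)) ^ m \<le> (1 + vnorm x + vnorm y) ^ m * W \<omega>"
        unfolding W_def power_mult_distrib[symmetric] by (intro power_mono) auto
      then have "C * (1 + vnorm (x @\<^sub>v Y \<omega>) + vnorm (y @\<^sub>v Y \<omega>)) ^ m * vnorm (x - y)
          \<le> C * ((1 + vnorm x + vnorm y) ^ m * W \<omega>) * vnorm (x - y)"
        using C by (intro mult_right_mono mult_left_mono) auto
      then show "\<bar>\<phi> (x @\<^sub>v Y \<omega>) - \<phi> (y @\<^sub>v Y \<omega>)\<bar> \<le> ?c * W \<omega>"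
        using Cm[of "x @\<^sub>v Y \<omega>" "y @\<^sub>v Y \<omega>"] x y Yc[of \<omega>] vnorm_append_diff[OF x y, of "Y \<omega>"]
        by (simp add: mult_ac)
    qed
    also have "\<dots> = ?c * E W" using C W by (intro E_scale) auto
    finally show ?thesis by (simp add: mult_ac)
  qed
  moreover have "0 \<le> E W" by (rule E_nonneg[OF W]) (simp add: W_def)
  ultimately show ?thesis unfolding C_lLip_iff_poly_dom poly_dom_def using C
    by (intro exI[of _ "C * E W"] conjI exI[of _ m]) auto
qed

end

section \<open>Independent copies on the product space\<close>

text \<open>
  G-normality expressed through the law of \<open>X\<close> alone, the independent copy being integrated out first.
\<close>

definition stable :: "(('a \<Rightarrow> real) \<Rightarrow> real) \<Rightarrow> nat \<Rightarrow> ('a \<Rightarrow> real vec) \<Rightarrow> bool" where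
  "stable E k X \<longleftrightarrow> (\<forall>\<phi>\<in>C_lLip k. \<forall>a\<ge>0. \<forall>b\<ge>0.
     E (\<lambda>\<omega>. E (\<lambda>\<omega>'. \<phi> (a \<cdot>\<^sub>v X \<omega> + b \<cdot>\<^sub>v X \<omega>'))) = E (\<lambda>\<omega>. \<phi> (sqrt (a\<^sup>2 + b\<^sup>2) \<cdot>\<^sub>v X \<omega>)))"

text \<open>
  The second factor carries just the one vector \<open>X\<close> that is to be copied, the first factor arbitrary finite
  families from \<open>H\<close>. The iterated expectation is then defined without reference to a representation, so
  it needs no proof of well-definedness.
\<close>

definition product_H :: "('a \<Rightarrow> real) set \<Rightarrow> nat \<Rightarrow> ('a \<Rightarrow> real vec) \<Rightarrow> ('a \<times> 'a \<Rightarrow> real) set" where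
  "product_H H k X = {f. \<exists>l Z \<phi>. random_vector H l Z \<and> \<phi> \<in> C_lLip (l + k) \<and>
     f = (\<lambda>(\<omega>, \<omega>'). \<phi> (Z \<omega> @\<^sub>v X \<omega>'))}"

definition product_E :: "(('a \<Rightarrow> real) \<Rightarrow> real) \<Rightarrow> ('a \<times> 'a \<Rightarrow> real) \<Rightarrow> real" where
  "product_E E f = E (\<lambda>\<omega>. E (\<lambda>\<omega>'. f (\<omega>, \<omega>')))"

context sublinear_expectation_space
begin

lemma product_H_sections:
  assumes X: "random_vector H k X" and f: "f \<in> product_H H k X"
  shows "(\<lambda>\<omega>'. f (\<omega>, \<omega>')) \<in> H" and "(\<lambda>\<omega>. E (\<lambda>\<omega>'. f (\<omega>, \<omega>'))) \<in> H"
proof -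
  obtain l Z \<phi> where Z: "random_vector H l Z" and phi: "\<phi> \<in> C_lLip (l + k)"
    and f: "f = (\<lambda>(\<omega>, \<omega>'). \<phi> (Z \<omega> @\<^sub>v X \<omega>'))"
    using f unfolding product_H_def by blast
  have "Z \<omega> \<in> carrier_vec l" using Z by (auto simp: random_vector_def)
  from comp_in[OF X C_lLip_append_left[OF phi this]]
  show "(\<lambda>\<omega>'. f (\<omega>, \<omega>')) \<in> H" by (simp add: f)
  from comp_in[OF Z section_C_lLip[OF X phi]]
  show "(\<lambda>\<omega>. E (\<lambda>\<omega>'. f (\<omega>, \<omega>'))) \<in> H" by (simp add: f)
qed

text \<open>
  Closure under test functions of several arguments requires representing finitely many elements by one and
  the same vector on the first factor: concatenate the vectors and precompose with the projections
  \<open>P\<close>, \<open>P'\<close>.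
\<close>

lemma product_H_common_vector:
  assumes X: "random_vector H k X" and "\<And>i. i < (p::nat) \<Longrightarrow> f i \<in> product_H H k X"
  shows "\<exists>l Z \<phi>. random_vector H l Z \<and> (\<forall>i<p. \<phi> i \<in> C_lLip (l + k)) \<and>
     (\<forall>i<p. f i = (\<lambda>(\<omega>, \<omega>'). \<phi> i (Z \<omega> @\<^sub>v X \<omega>')))"
  using assms(2)
proof (induction p)
  case 0
  have "random_vector H 0 (\<lambda>_. 0\<^sub>v 0)" by (simp add: random_vector_def)
  then show ?case by blast
next
  case (Suc p)
  then obtain l Z \<phi> where Z: "random_vector H l Z" and phi: "\<forall>i<p. \<phi> i \<in> C_lLip (l + k)"
    and f: "\<forall>i<p. f i = (\<lambda>(\<omega>, \<omega>'). \<phi> i (Z \<omega> @\<^sub>v X \<omega>'))" by fastforce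
  have "f p \<in> product_H H k X" using Suc.prems by simp
  then obtain l' Z' \<phi>' where Z': "random_vector H l' Z'" and phi': "\<phi>' \<in> C_lLip (l' + k)"
    and fp: "f p = (\<lambda>(\<omega>, \<omega>'). \<phi>' (Z' \<omega> @\<^sub>v X \<omega>'))"
    unfolding product_H_def by blast
  have carr: "Z \<omega> \<in> carrier_vec l" "Z' \<omega> \<in> carrier_vec l'" "X \<omega> \<in> carrier_vec k" for \<omega>
    using Z Z' X by (auto simp: random_vector_def)
  define P where "P = (\<lambda>z :: real vec. vec (l + k) (\<lambda>i. if i < l then z $ i else z $ (i + l')))"
  define P' where "P' = (\<lambda>z :: real vec. vec (l' + k) (\<lambda>i. z $ (l + i)))"
  have P: "(\<lambda>z. \<psi> (P z)) \<in> C_lLip ((l + l') + k)" if "\<psi> \<in> C_lLip (l + k)" for \<psi>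
  proof (rule C_lLip_compose[OF _ _ that])
    fix i assume "i < l + k"
    then show "(\<lambda>z. P z $ i) \<in> C_lLip (l + l' + k)"
      by (cases "i < l") (simp_all add: P_def C_lLip_coord)
  qed (simp add: P_def)
  have P': "(\<lambda>z. \<psi> (P' z)) \<in> C_lLip ((l + l') + k)" if "\<psi> \<in> C_lLip (l' + k)" for \<psi>
    by (rule C_lLip_compose[OF _ _ that]) (auto simp: P'_def C_lLip_coord)
  have Peq: "P ((Z \<omega> @\<^sub>v Z' \<omega>) @\<^sub>v X \<omega>') = Z \<omega> @\<^sub>v X \<omega>'" for \<omega> \<omega>'
    using carr[of \<omega>] carr[of \<omega>'] by (intro eq_vecI) (auto simp: P_def)
  have P'eq: "P' ((Z \<omega> @\<^sub>v Z' \<omega>) @\<^sub>v X \<omega>') = Z' \<omega> @\<^sub>v X \<omega>'" for \<omega> \<omega>'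
    using carr[of \<omega>] carr[of \<omega>'] by (intro eq_vecI) (auto simp: P'_def)
  define \<chi> where "\<chi> = (\<lambda>i. if i < p then (\<lambda>z. \<phi> i (P z)) else (\<lambda>z. \<phi>' (P' z)))"
  have "random_vector H (l + l') (\<lambda>\<omega>. Z \<omega> @\<^sub>v Z' \<omega>)" by (rule random_vector_append[OF Z Z'])
  moreover have "\<forall>i<Suc p. \<chi> i \<in> C_lLip ((l + l') + k)"
    using P P' phi phi' by (auto simp: \<chi>_def)
  moreover have "\<forall>i<Suc p. f i = (\<lambda>(\<omega>, \<omega>'). \<chi> i ((Z \<omega> @\<^sub>v Z' \<omega>) @\<^sub>v X \<omega>'))"
    using f fp by (auto simp: \<chi>_def Peq P'eq less_Suc_eq)
  ultimately show ?case by blast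
qed

lemma product_H_comp:
  assumes X: "random_vector H k X" and F: "random_vector (product_H H k X) p F" and psi: "\<psi> \<in> C_lLip p"
  shows "(\<lambda>\<omega>. \<psi> (F \<omega>)) \<in> product_H H k X"
proof -
  have "(\<lambda>\<omega>. F \<omega> $ i) \<in> product_H H k X" if "i < p" for i using F that by (auto simp: random_vector_def)
  then obtain l Z \<phi> where Z: "random_vector H l Z" and phi: "\<forall>i<p. \<phi> i \<in> C_lLip (l + k)"
    and f: "\<forall>i<p. (\<lambda>\<omega>. F \<omega> $ i) = (\<lambda>(\<omega>, \<omega>'). \<phi> i (Z \<omega> @\<^sub>v X \<omega>'))"
    using product_H_common_vector[OF X, of p "\<lambda>i \<omega>. F \<omega> $ i"] by blast
  have "F (\<omega>, \<omega>') $ i = \<phi> i (Z \<omega> @\<^sub>v X \<omega>')" if "i < p" for i \<omega> \<omega>'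
    using f that by (metis (mono_tags, lifting) case_prod_conv)
  moreover have "dim_vec (F \<omega>) = p" for \<omega> using F unfolding random_vector_def by (metis carrier_vecD)
  ultimately have eq: "F (\<omega>, \<omega>') = vec p (\<lambda>i. \<phi> i (Z \<omega> @\<^sub>v X \<omega>'))" for \<omega> \<omega>'
    by (intro eq_vecI) auto
  have "(\<lambda>z. \<psi> (vec p (\<lambda>i. \<phi> i z))) \<in> C_lLip (l + k)"
    by (rule C_lLip_compose[OF _ _ psi]) (use phi in auto)
  then show ?thesis unfolding product_H_def using Z eq
    by (intro CollectI exI[of _ l] exI[of _ Z] exI[of _ "\<lambda>z. \<psi> (vec p (\<lambda>i. \<phi> i z))"]) auto
qed

lemma product_H_comp_fst:
  assumes "f \<in> H" shows "f \<circ> fst \<in> product_H H k X"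
proof -
  have "(\<lambda>z. z $ 0) \<in> C_lLip (1 + k)" by (simp add: C_lLip_coord)
  moreover have "f \<circ> fst = (\<lambda>(\<omega>, \<omega>'). (vec1 f \<omega> @\<^sub>v X \<omega>') $ 0)"
    by (auto simp: vec1_def fun_eq_iff)
  moreover have "random_vector H 1 (vec1 f)" using assms by simp
  ultimately show ?thesis unfolding product_H_def by blast
qed

lemma product_H_comp_snd:
  assumes X: "random_vector H k X" and "i < k" shows "(\<lambda>\<omega>. X (snd \<omega>) $ i) \<in> product_H H k X"
proof -
  have "(\<lambda>z. z $ i) \<in> C_lLip (0 + k)" using assms by (simp add: C_lLip_coord)
  moreover have "(\<lambda>\<omega>. X (snd \<omega>) $ i) = (\<lambda>(\<omega>, \<omega>'). ((\<lambda>_. 0\<^sub>v 0) \<omega> @\<^sub>v X \<omega>') $ i)"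
    using X \<open>i < k\<close> by (auto simp: fun_eq_iff random_vector_def)
  moreover have "random_vector H 0 (\<lambda>_. 0\<^sub>v 0)" by (simp add: random_vector_def)
  ultimately show ?thesis unfolding product_H_def by blast
qed

lemma product_space:
  assumes X: "random_vector H k X"
  shows "sublinear_expectation_space (product_H H k X) (product_E E)"
proof
  note sec = product_H_sections[OF X]
  show const: "(\<lambda>_. c) \<in> product_H H k X" for c
    using product_H_comp_fst[OF const_in[of c], of k X] by (simp add: comp_def)
  show add: "(\<lambda>\<omega>. f \<omega> + g \<omega>) \<in> product_H H k X" if "f \<in> product_H H k X" "g \<in> product_H H k X" for f g
  proof -
    have "random_vector (product_H H k X) 2 (\<lambda>\<omega>. vec 2 (\<lambda>i. if i = 0 then f \<omega> else g \<omega>))"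
      unfolding random_vector_def
    proof (intro conjI allI impI)
      fix i :: nat assume "i < 2"
      then have "(\<lambda>\<omega>. vec 2 (\<lambda>i. if i = 0 then f \<omega> else g \<omega>) $ i) = (if i = 0 then f else g)" by auto
      then show "(\<lambda>\<omega>. vec 2 (\<lambda>i. if i = 0 then f \<omega> else g \<omega>) $ i) \<in> product_H H k X" using that by simp
    qed auto
    from product_H_comp[OF X this, of "\<lambda>v. v $ 0 + v $ 1"] show ?thesis
      by (simp add: C_lLip_add C_lLip_coord)
  qed
  show "(\<lambda>\<omega>. c * f \<omega>) \<in> product_H H k X" if "f \<in> product_H H k X" for f c
  proof -
    have "random_vector (product_H H k X) 1 (vec1 f)" using that by simp
    from product_H_comp[OF X this, of "\<lambda>v. c * v $ 0"] show ?thesis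
      by (simp add: C_lLip_mult C_lLip_const C_lLip_coord vec1_def)
  qed
  show "(\<lambda>\<omega>. \<phi> (F \<omega>)) \<in> product_H H k X" if "random_vector (product_H H k X) p F" "\<phi> \<in> C_lLip p" for p F \<phi>
    using product_H_comp[OF X] that by blast
  show "product_E E f \<le> product_E E g"
    if "f \<in> product_H H k X" "g \<in> product_H H k X" "\<And>\<omega>. f \<omega> \<le> g \<omega>" for f g
    unfolding product_E_def using that by (intro E_mono sec)
  show "product_E E (\<lambda>_. c) = c" for c by (simp add: product_E_def E_const)
  show "product_E E (\<lambda>\<omega>. f \<omega> + g \<omega>) \<le> product_E E f + product_E E g"
    if fg: "f \<in> product_H H k X" "g \<in> product_H H k X" for f g
  proof -
    have "product_E E (\<lambda>\<omega>. f \<omega> + g \<omega>) \<le> E (\<lambda>\<omega>. E (\<lambda>\<omega>'. f (\<omega>, \<omega>')) + E (\<lambda>\<omega>'. g (\<omega>, \<omega>')))"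
      unfolding product_E_def using fg by (intro E_mono sec[OF add] add_in sec(2) E_subadd sec(1))
    also have "\<dots> \<le> product_E E f + product_E E g"
      unfolding product_E_def using fg by (intro E_subadd sec)
    finally show ?thesis .
  qed
  show "product_E E (\<lambda>\<omega>. c * f \<omega>) = c * product_E E f" if "f \<in> product_H H k X" "0 \<le> c" for f c
    unfolding product_E_def using that by (simp add: E_scale sec)
qed

lemma product_extension:
  assumes X: "random_vector H k X"
  shows "extension fst (product_H H k X) (product_E E) H E"
  unfolding extension_def using product_space[OF X] product_H_comp_fst
  by (auto simp: product_E_def E_const)

lemma product_indep_copy:
  assumes X: "random_vector H k X"
  shows "indep_copy (product_H H k X) (product_E E) k (X \<circ> fst) (X \<circ> snd)"
proof -
  have "random_vector (product_H H k X) k (X \<circ> snd)"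
    using X product_H_comp_snd[OF X] by (auto simp: random_vector_def)
  moreover have "random_vector (product_H H k X) k (X \<circ> fst)"
    unfolding random_vector_def
  proof (intro conjI allI impI)
    fix i assume "i < k"
    then have "(\<lambda>\<omega>. X \<omega> $ i) \<in> H" using X by (auto simp: random_vector_def)
    from product_H_comp_fst[OF this] show "(\<lambda>\<omega>. (X \<circ> fst) \<omega> $ i) \<in> product_H H k X"
      by (simp add: comp_def)
  qed (use X in \<open>auto simp: random_vector_def\<close>)
  ultimately show ?thesis
    by (simp add: indep_copy_def ident_dist_def indep_def product_E_def E_const)
qed

text \<open>
  On any extension, independence and identity of laws turn the expectation of \<open>\<phi>(a X + b X')\<close> into the
  iterated expectation over the original space, where stability applies.
\<close>

lemma stable_imp_G_normal:
  fixes X :: "'a \<Rightarrow> real vec"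
  assumes X: "random_vector H k X" and st: "stable E k X"
  shows "G_normal H E k X"
  unfolding G_normal_def
proof (intro conjI allI impI X)
  fix H' :: "('a \<times> 'a \<Rightarrow> real) set" and E' X' and a b :: real
  assume ext: "extension fst H' E' H E" and copy: "indep_copy H' E' k (X \<circ> fst) X'"
    and ab: "0 \<le> a" "0 \<le> b"
  interpret ext: sublinear_expectation_space H' E' using ext by (simp add: extension_def)
  have E': "E' (\<lambda>\<omega>. f (fst \<omega>)) = E f" if "f \<in> H" for f
    using ext that by (auto simp: extension_def comp_def)
  have X': "random_vector H' k (X \<circ> fst)" "random_vector H' k X'"
    using copy by (auto simp: indep_copy_def ident_dist_def)
  have carr: "X \<omega> \<in> carrier_vec k" "X' \<eta> \<in> carrier_vec k" for \<omega> \<eta>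
    using X X' unfolding random_vector_def by blast+
  have rv_scale: "random_vector H' k (\<lambda>\<omega>. c \<cdot>\<^sub>v (X \<circ> fst) \<omega>)" for c
    by (rule ext.random_vector_map[OF X'(1)])
      (auto simp: C_lLip_cong[where f = "\<lambda>x. (c \<cdot>\<^sub>v x) $ i" and g = "\<lambda>x. c * x $ i" for i] intro!: C_lLip_intros)
  have rv_sum: "random_vector H' k (\<lambda>\<omega>. a \<cdot>\<^sub>v (X \<circ> fst) \<omega> + b \<cdot>\<^sub>v X' \<omega>)"
    using random_vector_append[OF X'] carr
      ext.random_vector_map[OF random_vector_append[OF X'], of k "\<lambda>z. a \<cdot>\<^sub>v vec_first z k + b \<cdot>\<^sub>v vec_last z k"]
      C_lLip_linear_combination[OF C_lLip_coord, of _ k a b]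
    by simp
  show "ident_dist H' E' k (\<lambda>\<omega>. a \<cdot>\<^sub>v (X \<circ> fst) \<omega> + b \<cdot>\<^sub>v X' \<omega>) (\<lambda>\<omega>. sqrt (a\<^sup>2 + b\<^sup>2) \<cdot>\<^sub>v (X \<circ> fst) \<omega>)"
    unfolding ident_dist_def
  proof (intro conjI ballI rv_scale rv_sum)
    fix \<phi> assume phi: "\<phi> \<in> C_lLip k"
    let ?\<psi> = "\<lambda>z. \<phi> (a \<cdot>\<^sub>v vec_first z k + b \<cdot>\<^sub>v vec_last z k)"
    have psi: "?\<psi> \<in> C_lLip (k + k)" by (rule C_lLip_linear_combination[OF phi])
    have "\<forall>\<psi>\<in>C_lLip (k + k). E' (\<lambda>\<omega>. \<psi> ((X \<circ> fst) \<omega> @\<^sub>v X' \<omega>))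
        = E' (\<lambda>\<omega>. E' (\<lambda>\<omega>'. \<psi> ((X \<circ> fst) \<omega> @\<^sub>v X' \<omega>')))"
      using copy by (simp add: indep_copy_def indep_def)
    from bspec[OF this psi] have "E' (\<lambda>\<omega>. \<phi> (a \<cdot>\<^sub>v (X \<circ> fst) \<omega> + b \<cdot>\<^sub>v X' \<omega>))
        = E' (\<lambda>\<omega>. E' (\<lambda>\<omega>'. ?\<psi> ((X \<circ> fst) \<omega> @\<^sub>v X' \<omega>')))"
      using carr by simp
    also have "\<dots> = E' (\<lambda>\<omega>. E (\<lambda>\<omega>'. ?\<psi> (X (fst \<omega>) @\<^sub>v X \<omega>')))"
    proof -
      have "\<forall>\<phi>\<in>C_lLip k. E' (\<lambda>\<omega>. \<phi> (X (fst \<omega>))) = E' (\<lambda>\<omega>. \<phi> (X' \<omega>))"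
        using copy by (simp add: indep_copy_def ident_dist_def)
      note id = bspec[OF this]
      have "E' (\<lambda>\<omega>'. ?\<psi> (x @\<^sub>v X' \<omega>')) = E (\<lambda>\<omega>'. ?\<psi> (x @\<^sub>v X \<omega>'))" if "x \<in> carrier_vec k" for x
        by (rule trans[OF sym[OF id[OF C_lLip_append_left[OF psi that]]] E'[OF comp_in[OF X C_lLip_append_left[OF psi that]]]])
      then show ?thesis using carr by simp
    qed
    also have "\<dots> = E (\<lambda>\<omega>. E (\<lambda>\<omega>'. ?\<psi> (X \<omega> @\<^sub>v X \<omega>')))"
      by (rule E'[OF comp_in[OF X section_C_lLip[OF X psi]]])
    also have "\<dots> = E (\<lambda>\<omega>. \<phi> (sqrt (a\<^sup>2 + b\<^sup>2) \<cdot>\<^sub>v X \<omega>))"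
      using st phi ab carr by (simp add: stable_def)
    also have "\<dots> = E' (\<lambda>\<omega>. \<phi> (sqrt (a\<^sup>2 + b\<^sup>2) \<cdot>\<^sub>v (X \<circ> fst) \<omega>))"
    proof -
      have "(\<lambda>x. \<phi> (sqrt (a\<^sup>2 + b\<^sup>2) \<cdot>\<^sub>v x)) \<in> C_lLip k"
        by (rule C_lLip_compose[OF _ _ phi])
          (auto simp: C_lLip_cong[where f = "\<lambda>x. (c \<cdot>\<^sub>v x) $ i" and g = "\<lambda>x. c * x $ i" for c i] intro!: C_lLip_intros)
      from E'[OF comp_in[OF X this]] show ?thesis by simp
    qed
    finally show "E' (\<lambda>\<omega>. \<phi> (a \<cdot>\<^sub>v (X \<circ> fst) \<omega> + b \<cdot>\<^sub>v X' \<omega>)) = E' (\<lambda>\<omega>. \<phi> (sqrt (a\<^sup>2 + b\<^sup>2) \<cdot>\<^sub>v (X \<circ> fst) \<omega>))" .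
  qed
qed

text \<open>
  On the product space, G-normality with the copy \<open>X \<circ> snd\<close> is literally stability.
\<close>

lemma G_normal_imp_stable:
  assumes "G_normal H E k X"
  shows "stable E k X"
  unfolding stable_def
proof (intro ballI allI impI)
  fix \<phi> and a b :: real assume phi: "\<phi> \<in> C_lLip k" and ab: "0 \<le> a" "0 \<le> b"
  have X: "random_vector H k X" using assms by (simp add: G_normal_def)
  have "ident_dist (product_H H k X) (product_E E) k
      (\<lambda>\<omega>. a \<cdot>\<^sub>v (X \<circ> fst) \<omega> + b \<cdot>\<^sub>v (X \<circ> snd) \<omega>) (\<lambda>\<omega>. sqrt (a\<^sup>2 + b\<^sup>2) \<cdot>\<^sub>v (X \<circ> fst) \<omega>)"
    using assms product_extension[OF X] product_indep_copy[OF X] ab unfolding G_normal_def by blast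
  then have "product_E E (\<lambda>\<omega>. \<phi> (a \<cdot>\<^sub>v (X \<circ> fst) \<omega> + b \<cdot>\<^sub>v (X \<circ> snd) \<omega>))
      = product_E E (\<lambda>\<omega>. \<phi> (sqrt (a\<^sup>2 + b\<^sup>2) \<cdot>\<^sub>v (X \<circ> fst) \<omega>))"
    using phi by (simp add: ident_dist_def)
  then show "E (\<lambda>\<omega>. E (\<lambda>\<omega>'. \<phi> (a \<cdot>\<^sub>v X \<omega> + b \<cdot>\<^sub>v X \<omega>'))) = E (\<lambda>\<omega>. \<phi> (sqrt (a\<^sup>2 + b\<^sup>2) \<cdot>\<^sub>v X \<omega>))"
    by (simp add: product_E_def E_const)
qed

end

section \<open>Steklov means\<close>

lemma lipschitz_on_UNIV_iff:
  fixes w :: "real \<Rightarrow> real"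
  shows "L-lipschitz_on UNIV w \<longleftrightarrow> 0 \<le> L \<and> (\<forall>x y. \<bar>w x - w y\<bar> \<le> L * \<bar>x - y\<bar>)"
  by (auto simp: lipschitz_on_def dist_real_def)

lemma lipschitz_abs_le:
  fixes w :: "real \<Rightarrow> real"
  assumes "L-lipschitz_on UNIV w" shows "\<bar>w x - w y\<bar> \<le> L * \<bar>x - y\<bar>"
  using assms by (simp add: lipschitz_on_UNIV_iff)

lemma lipschitz_imp_lLip1: "L-lipschitz_on UNIV w \<Longrightarrow> lLip1 w"
  by (rule lLip1_lipschitz[of _ L]) (simp add: lipschitz_abs_le)

lemma lipschitz_shift:
  fixes w :: "real \<Rightarrow> real"
  assumes "L-lipschitz_on UNIV w" shows "L-lipschitz_on UNIV (\<lambda>r. w (x + r))"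
  using assms unfolding lipschitz_on_UNIV_iff by (metis add_diff_cancel_left)

text \<open>
  Some antiderivative on the whole line; the constant of integration cancels in the Steklov mean.
\<close>

definition antiderivative :: "(real \<Rightarrow> real) \<Rightarrow> real \<Rightarrow> real" where
  "antiderivative w = (SOME U. \<forall>x. (U has_real_derivative w x) (at x))"

lemma antiderivative:
  assumes "continuous_on UNIV w"
  shows "(antiderivative w has_real_derivative w x) (at x)"
proof -
  have "\<exists>U. \<forall>x. - \<infinity> < ereal x \<longrightarrow> ereal x < \<infinity> \<longrightarrow> (U has_vector_derivative w x) (at x)"
    using assms by (intro einterval_antiderivative) (auto simp: continuous_on_eq_continuous_at)
  then have "\<exists>U. \<forall>x. (U has_real_derivative w x) (at x)"
    by (simp add: has_real_derivative_iff_has_vector_derivative)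
  then show ?thesis unfolding antiderivative_def by (rule someI2_ex) blast
qed

lemma mvt_real:
  fixes f :: "real \<Rightarrow> real"
  assumes "\<And>x. (f has_real_derivative f' x) (at x)"
  shows "\<exists>c. min a b \<le> c \<and> c \<le> max a b \<and> f b - f a = (b - a) * f' c"
proof -
  consider "a < b" | "b < a" | "a = b" by linarith
  then show ?thesis
  proof cases
    case 1
    then show ?thesis using MVT2[of a b f f'] assms by (auto intro: less_imp_le)
  next
    case 2
    then obtain c where "b < c" "c < a" "f a - f b = (a - b) * f' c" using MVT2[of b a f f'] assms by auto
    then show ?thesis using 2 by (intro exI[of _ c]) (auto simp: algebra_simps)
  qed auto
qed

text \<open>
  For continuous \<open>w\<close> and \<open>\<epsilon> > 0\<close>, the mean of \<open>w\<close> over the interval \<open>[x, x + \<epsilon>]\<close>.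
\<close>

definition steklov :: "real \<Rightarrow> (real \<Rightarrow> real) \<Rightarrow> real \<Rightarrow> real" where
  "steklov \<epsilon> w x = (antiderivative w (x + \<epsilon>) - antiderivative w x) / \<epsilon>"

text \<open>
  On each of the \<open>N\<close> cells the mean value theorem replaces the increment of the antiderivative by a value of
  \<open>w\<close> in that cell, which differs from the value at the left end by at most \<open>L \<epsilon> / N\<close>. Finite averages are
  what a sublinear expectation can be interchanged with.
\<close>

lemma steklov_riemann_sum:
  assumes lip: "L-lipschitz_on UNIV w" and "0 < \<epsilon>" "0 < N"
  shows "\<bar>steklov \<epsilon> w x - (\<Sum>k<N. w (x + real k * \<epsilon> / real N)) / real N\<bar> \<le> L * \<epsilon> / real N"
proof -
  define U where "U = antiderivative w"
  define d where "d = \<epsilon> / real N"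
  have d: "0 < d" using assms by (simp add: d_def)
  have U: "(U has_real_derivative w x) (at x)" for x
    unfolding U_def by (rule antiderivative[OF lipschitz_on_continuous_on[OF lip]])
  have cell: "\<bar>(U (y + d) - U y) - d * w y\<bar> \<le> L * d\<^sup>2" for y
  proof -
    obtain c where c: "y \<le> c" "c \<le> y + d" "U (y + d) - U y = d * w c"
      using mvt_real[OF U, of y "y + d"] d by auto
    have "L * \<bar>c - y\<bar> \<le> L * d" using c lip by (intro mult_left_mono) (auto simp: lipschitz_on_def)
    then have "\<bar>w c - w y\<bar> \<le> L * d" using lipschitz_abs_le[OF lip, of c y] by simp
    then have "d * \<bar>w c - w y\<bar> \<le> d * (L * d)" using d by (intro mult_left_mono) auto
    moreover have "(U (y + d) - U y) - d * w y = d * (w c - w y)" using c by (simp add: algebra_simps)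
    ultimately show ?thesis using d by (simp add: abs_mult power2_eq_square mult_ac)
  qed
  have tele: "(\<Sum>k<n. U ((x + real k * d) + d) - U (x + real k * d)) = U (x + real n * d) - U x" for n
    by (induction n) (auto simp: algebra_simps)
  have "\<bar>(U (x + real N * d) - U x) - d * (\<Sum>k<N. w (x + real k * d))\<bar>
      = \<bar>\<Sum>k<N. (U ((x + real k * d) + d) - U (x + real k * d)) - d * w (x + real k * d)\<bar>"
    by (simp only: tele[symmetric] sum_subtractf sum_distrib_left)
  also have "\<dots> \<le> (\<Sum>k<N. L * d\<^sup>2)" by (intro order_trans[OF sum_abs] sum_mono cell)
  finally have "\<bar>(U (x + real N * d) - U x) - d * (\<Sum>k<N. w (x + real k * d))\<bar> / \<epsilon> \<le> (real N * (L * d\<^sup>2)) / \<epsilon>"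
    using assms(2) by (intro divide_right_mono) auto
  moreover have "(real N * (L * d\<^sup>2)) / \<epsilon> = L * \<epsilon> / real N"
    using assms by (simp add: d_def power2_eq_square)
  moreover have "\<bar>(U (x + real N * d) - U x) - d * (\<Sum>k<N. w (x + real k * d))\<bar> / \<epsilon>
      = \<bar>((U (x + real N * d) - U x) - d * (\<Sum>k<N. w (x + real k * d))) / \<epsilon>\<bar>"
    using assms(2) by (simp add: abs_divide)
  moreover have "((U (x + real N * d) - U x) - d * (\<Sum>k<N. w (x + real k * d))) / \<epsilon>
      = steklov \<epsilon> w x - (\<Sum>k<N. w (x + real k * \<epsilon> / real N)) / real N"
    using assms(2,3) by (simp add: steklov_def U_def d_def diff_divide_distrib)
  ultimately show ?thesis by simp
qed

lemma steklov_close: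
  assumes "L-lipschitz_on UNIV w" "0 < \<epsilon>" shows "\<bar>steklov \<epsilon> w x - w x\<bar> \<le> L * \<epsilon>"
  using steklov_riemann_sum[OF assms, of 1 x] by simp

lemma steklov_mono:
  assumes "L-lipschitz_on UNIV w" "M-lipschitz_on UNIV v" "\<And>x. w x \<le> v x" "0 < \<epsilon>"
  shows "steklov \<epsilon> w x \<le> steklov \<epsilon> v x"
proof -
  have "((\<lambda>x. antiderivative v x - antiderivative w x) has_real_derivative v x - w x) (at x)" for x
    using assms(1,2) by (intro DERIV_diff antiderivative lipschitz_on_continuous_on)
  from mvt_real[OF this, of x "x + \<epsilon>"] obtain c where
    "(antiderivative v (x + \<epsilon>) - antiderivative w (x + \<epsilon>)) - (antiderivative v x - antiderivative w x) = \<epsilon> * (v c - w c)"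
    by auto
  moreover have "0 \<le> \<epsilon> * (v c - w c)" using assms(3)[of c] assms(4) by simp
  ultimately show ?thesis unfolding steklov_def using assms(4) by (intro divide_right_mono) auto
qed

lemma steklov_derivative:
  assumes "continuous_on UNIV w"
  shows "(steklov \<epsilon> w has_real_derivative (w (x + \<epsilon>) - w x) / \<epsilon>) (at x)"
proof -
  have "((\<lambda>x. antiderivative w (x + \<epsilon>)) has_real_derivative w (x + \<epsilon>)) (at x)"
    using antiderivative[OF assms, of "x + \<epsilon>"] by (simp add: DERIV_shift)
  from DERIV_cdivide[OF DERIV_diff[OF this antiderivative[OF assms]], of \<epsilon>]
  show ?thesis unfolding steklov_def[abs_def] .
qed

lemma steklov_lipschitz:
  assumes lip: "L-lipschitz_on UNIV w" and "0 < \<epsilon>"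
  shows "L-lipschitz_on UNIV (steklov \<epsilon> w)"
  unfolding lipschitz_on_UNIV_iff
proof (intro conjI allI)
  show "0 \<le> L" using lip by (simp add: lipschitz_on_def)
  fix x y
  obtain c where c: "steklov \<epsilon> w x - steklov \<epsilon> w y = (x - y) * ((w (c + \<epsilon>) - w c) / \<epsilon>)"
    using mvt_real[OF steklov_derivative[OF lipschitz_on_continuous_on[OF lip]], of y x \<epsilon>] by auto
  have "\<bar>w (c + \<epsilon>) - w c\<bar> / \<epsilon> \<le> L" using lipschitz_abs_le[OF lip, of "c + \<epsilon>" c] assms(2)
    by (simp add: divide_simps)
  then have "\<bar>x - y\<bar> * (\<bar>w (c + \<epsilon>) - w c\<bar> / \<epsilon>) \<le> \<bar>x - y\<bar> * L" by (intro mult_left_mono) auto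
  then show "\<bar>steklov \<epsilon> w x - steklov \<epsilon> w y\<bar> \<le> L * \<bar>x - y\<bar>"
    unfolding c using assms(2) by (simp add: abs_mult abs_divide mult.commute)
qed

text \<open>
  A function whose second derivative is Lipschitz has a cubic Taylor remainder: apply the mean value theorem
  to the remainder, whose derivative is the quadratic remainder of \<open>U\<close>.
\<close>

lemma second_antiderivative_taylor:
  assumes lip: "L-lipschitz_on UNIV w"
    and U: "\<And>x. (U has_real_derivative w x) (at x)" and V: "\<And>x. (V has_real_derivative U x) (at x)"
  shows "\<bar>V (x + y) - (V x + U x * y + w x * y\<^sup>2 / 2)\<bar> \<le> L * \<bar>y\<bar> ^ 3"
proof -
  have L: "0 \<le> L" using lip by (simp add: lipschitz_on_def)
  have first: "\<bar>U (x + z) - (U x + w x * z)\<bar> \<le> L * z\<^sup>2" for z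
  proof -
    obtain c where c: "min x (x + z) \<le> c" "c \<le> max x (x + z)" "U (x + z) - U x = z * w c"
      using mvt_real[OF U, of x "x + z"] by auto
    have "\<bar>w c - w x\<bar> \<le> L * \<bar>z\<bar>"
      by (rule order_trans[OF lipschitz_abs_le[OF lip] mult_left_mono[OF _ L]]) (use c in auto)
    then have "\<bar>z\<bar> * \<bar>w c - w x\<bar> \<le> \<bar>z\<bar> * (L * \<bar>z\<bar>)" by (intro mult_left_mono) auto
    moreover have "U (x + z) - (U x + w x * z) = z * (w c - w x)" using c(3) by (simp add: algebra_simps)
    ultimately show ?thesis by (simp add: abs_mult power2_eq_square mult_ac)
  qed
  define D where "D = (\<lambda>z. V (x + z) - (V x + U x * z + w x * z\<^sup>2 / 2))"
  have "(D has_real_derivative U (x + z) - (U x + w x * z)) (at z)" for z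
  proof -
    have "((\<lambda>z. V (z + x)) has_real_derivative U (z + x)) (at z)"
      using V[of "z + x"] by (simp add: DERIV_shift)
    then have "((\<lambda>z. V (x + z)) has_real_derivative U (x + z)) (at z)"
      by (simp only: add.commute[of x])
    then show ?thesis unfolding D_def by (auto intro!: derivative_eq_intros)
  qed
  from mvt_real[OF this, of 0 y] obtain c where c: "min 0 y \<le> c" "c \<le> max 0 y"
    "D y - D 0 = (y - 0) * (U (x + c) - (U x + w x * c))" by blast
  have "\<bar>c\<bar> \<le> \<bar>y\<bar>" using c by auto
  then have "c\<^sup>2 \<le> y\<^sup>2" by (simp add: abs_le_square_iff)
  then have "L * c\<^sup>2 \<le> L * y\<^sup>2" using L by (intro mult_left_mono)
  then have "\<bar>y\<bar> * \<bar>U (x + c) - (U x + w x * c)\<bar> \<le> \<bar>y\<bar> * (L * y\<^sup>2)"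
    using first[of c] by (intro mult_left_mono) auto
  moreover have "D 0 = 0" by (simp add: D_def)
  ultimately have "\<bar>D y\<bar> \<le> \<bar>y\<bar> * (L * y\<^sup>2)" using c(3) by (simp add: abs_mult)
  moreover have "\<bar>y\<bar> * (L * y\<^sup>2) = L * \<bar>y\<bar> ^ 3" by (simp add: power3_eq_cube power2_eq_square)
  ultimately show ?thesis by (simp add: D_def)
qed

text \<open>
  The twofold Steklov mean is a second difference quotient of a second antiderivative \<open>V\<close> of \<open>w\<close>. The
  remainder bound depends on \<open>w\<close> through its Lipschitz constant only; this uniformity is what allows it to be
  used at every time step.
\<close>

lemma steklov_steklov_taylor:
  assumes lip: "L-lipschitz_on UNIV w" and eps: "0 < \<epsilon>"
  shows "\<exists>p q. \<forall>y. \<bar>steklov \<epsilon> (steklov \<epsilon> w) (x + y) - (steklov \<epsilon> (steklov \<epsilon> w) x + p * y + q * y\<^sup>2)\<bar>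
    \<le> 4 * L / \<epsilon>\<^sup>2 * \<bar>y\<bar> ^ 3"
proof -
  define U where "U = antiderivative w"
  have U: "(U has_real_derivative w x) (at x)" for x
    unfolding U_def by (rule antiderivative[OF lipschitz_on_continuous_on[OF lip]])
  have contU: "continuous_on UNIV U" using U by (meson DERIV_isCont continuous_at_imp_continuous_on)
  define V where "V = antiderivative U"
  have V: "(V has_real_derivative U x) (at x)" for x unfolding V_def by (rule antiderivative[OF contU])
  define W where "W = antiderivative (steklov \<epsilon> w)"
  have W: "(W has_real_derivative steklov \<epsilon> w x) (at x)" for x
    unfolding W_def by (rule antiderivative[OF lipschitz_on_continuous_on[OF steklov_lipschitz[OF lip eps]]])
  have W': "(steklov \<epsilon> U has_real_derivative steklov \<epsilon> w x) (at x)" for x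
    using steklov_derivative[OF contU] by (simp add: steklov_def[of \<epsilon> w] U_def)
  \<comment> \<open>Both are antiderivatives of \<open>steklov \<epsilon> w\<close>, so they differ by a constant.\<close>
  have "W s - steklov \<epsilon> U s = W t - steklov \<epsilon> U t" for s t
    using mvt_real[OF DERIV_diff[OF W W'], of t s] by auto
  then have diff: "W s - W t = steklov \<epsilon> U s - steklov \<epsilon> U t" for s t
    by (metis add.commute diff_add_cancel diff_diff_eq2)
  have second: "steklov \<epsilon> (steklov \<epsilon> w) t = (V (t + 2 * \<epsilon>) - 2 * V (t + \<epsilon>) + V t) / \<epsilon>\<^sup>2" for t
    unfolding steklov_def[of \<epsilon> "steklov \<epsilon> w"] W_def[symmetric] diff
    unfolding steklov_def V_def[symmetric] using eps by (simp add: field_simps power2_eq_square)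
  define p where "p = (U (x + 2 * \<epsilon>) - 2 * U (x + \<epsilon>) + U x) / \<epsilon>\<^sup>2"
  define q where "q = (w (x + 2 * \<epsilon>) - 2 * w (x + \<epsilon>) + w x) / \<epsilon>\<^sup>2 / 2"
  define R where "R = (\<lambda>t y. V (t + y) - (V t + U t * y + w t * y\<^sup>2 / 2))"
  have R: "\<bar>R t y\<bar> \<le> L * \<bar>y\<bar> ^ 3" for t y
    unfolding R_def by (rule second_antiderivative_taylor[OF lip U V])
  have "\<bar>steklov \<epsilon> (steklov \<epsilon> w) (x + y) - (steklov \<epsilon> (steklov \<epsilon> w) x + p * y + q * y\<^sup>2)\<bar>
    \<le> 4 * L / \<epsilon>\<^sup>2 * \<bar>y\<bar> ^ 3" for y
  proof -
    have "steklov \<epsilon> (steklov \<epsilon> w) (x + y) - (steklov \<epsilon> (steklov \<epsilon> w) x + p * y + q * y\<^sup>2)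
        = (R (x + 2 * \<epsilon>) y - 2 * R (x + \<epsilon>) y + R x y) / \<epsilon>\<^sup>2"
      unfolding second p_def q_def R_def using eps
      by (simp add: divide_simps) (simp add: algebra_simps)
    moreover have "\<bar>R (x + 2 * \<epsilon>) y - 2 * R (x + \<epsilon>) y + R x y\<bar> \<le> 4 * (L * \<bar>y\<bar> ^ 3)"
      using R[of "x + 2 * \<epsilon>" y] R[of "x + \<epsilon>" y] R[of x y] by linarith
    then have "\<bar>R (x + 2 * \<epsilon>) y - 2 * R (x + \<epsilon>) y + R x y\<bar> / \<epsilon>\<^sup>2 \<le> 4 * (L * \<bar>y\<bar> ^ 3) / \<epsilon>\<^sup>2"
      by (intro divide_right_mono) auto
    ultimately show ?thesis by (simp add: abs_divide mult_ac)
  qed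
  then show ?thesis by blast
qed

section \<open>Uniqueness of the one-dimensional G-normal distribution\<close>

definition stable1 :: "(('a \<Rightarrow> real) \<Rightarrow> real) \<Rightarrow> ('a \<Rightarrow> real) \<Rightarrow> bool" where
  "stable1 E X \<longleftrightarrow> (\<forall>f. lLip1 f \<longrightarrow> (\<forall>a\<ge>0. \<forall>b\<ge>0.
     E (\<lambda>\<omega>. E (\<lambda>\<omega>'. f (a * X \<omega> + b * X \<omega>'))) = E (\<lambda>\<omega>. f (sqrt (a\<^sup>2 + b\<^sup>2) * X \<omega>))))"

lemma stable_1_iff_stable1: "stable E 1 (vec1 X) \<longleftrightarrow> stable1 E X"
proof
  assume st: "stable E 1 (vec1 X)"
  show "stable1 E X" unfolding stable1_def
  proof (intro allI impI)
    fix f and a b :: real assume "lLip1 f" "0 \<le> a" "0 \<le> b"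
    then show "E (\<lambda>\<omega>. E (\<lambda>\<omega>'. f (a * X \<omega> + b * X \<omega>'))) = E (\<lambda>\<omega>. f (sqrt (a\<^sup>2 + b\<^sup>2) * X \<omega>))"
      using st[unfolded stable_def, rule_format, of "\<lambda>v. f (v $ 0)" a b]
      unfolding lLip1_def by (simp add: vec1_def)
  qed
next
  assume st: "stable1 E X"
  show "stable E 1 (vec1 X)" unfolding stable_def
  proof (intro allI impI ballI)
    fix \<phi> and a b :: real assume phi: "\<phi> \<in> C_lLip 1" and ab: "0 \<le> a" "0 \<le> b"
    have "a \<cdot>\<^sub>v vec1 X \<omega> + b \<cdot>\<^sub>v vec1 X \<omega>' = vec 1 (\<lambda>_. a * X \<omega> + b * X \<omega>')"
         "c \<cdot>\<^sub>v vec1 X \<omega> = vec 1 (\<lambda>_. c * X \<omega>)" for \<omega> \<omega>' c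
      by (auto simp: vec1_def)
    then show "E (\<lambda>\<omega>. E (\<lambda>\<omega>'. \<phi> (a \<cdot>\<^sub>v vec1 X \<omega> + b \<cdot>\<^sub>v vec1 X \<omega>')))
        = E (\<lambda>\<omega>. \<phi> (sqrt (a\<^sup>2 + b\<^sup>2) \<cdot>\<^sub>v vec1 X \<omega>))"
      using st[unfolded stable1_def, rule_format, OF lLip1_of_C_lLip[OF phi] ab] by simp
  qed
qed

lemma lLip1_bound:
  assumes "lLip1 f"
  shows "\<exists>C\<ge>0. \<exists>m. \<forall>x y. \<bar>f x - f y\<bar> \<le> C * (1 + \<bar>x\<bar> + \<bar>y\<bar>) ^ m * \<bar>x - y\<bar>"
proof -
  obtain C m where C: "0 \<le> C" and *: "\<And>x y. x \<in> carrier_vec 1 \<Longrightarrow> y \<in> carrier_vec 1 \<Longrightarrow>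
    \<bar>f (x $ 0) - f (y $ 0)\<bar> \<le> C * (1 + vnorm x + vnorm y) ^ m * vnorm (x - y)"
    using assms unfolding lLip1_def C_lLip_iff_poly_dom poly_dom_def by auto
  have "vnorm (vec 1 (\<lambda>_. x)) = \<bar>x\<bar>" "vec 1 (\<lambda>_. x) - vec 1 (\<lambda>_. y) = vec 1 (\<lambda>_. x - y)" for x y :: real
    by (auto simp: vnorm_eq_L2_set L2_set_def)
  then have "\<bar>f x - f y\<bar> \<le> C * (1 + \<bar>x\<bar> + \<bar>y\<bar>) ^ m * \<bar>x - y\<bar>" for x y
    using *[of "vec 1 (\<lambda>_. x)" "vec 1 (\<lambda>_. y)"] by simp
  then show ?thesis using C by blast
qed

context sublinear_expectation_space
begin

lemma E_sum_subadd:
  fixes N :: nat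
  assumes "\<And>k. k < N \<Longrightarrow> g k \<in> H"
  shows "(\<lambda>\<omega>. \<Sum>k<N. g k \<omega>) \<in> H \<and> E (\<lambda>\<omega>. \<Sum>k<N. g k \<omega>) \<le> (\<Sum>k<N. E (g k))"
  using assms
proof (induction N)
  case 0
  then show ?case by (simp add: const_in E_const)
next
  case (Suc N)
  then have IH: "(\<lambda>\<omega>. \<Sum>k<N. g k \<omega>) \<in> H" "E (\<lambda>\<omega>. \<Sum>k<N. g k \<omega>) \<le> (\<Sum>k<N. E (g k))"
    and gN: "g N \<in> H" by auto
  then show ?case using add_in[OF IH(1) gN] E_subadd[OF IH(1) gN] by simp
qed

lemma E_le_add_const:
  assumes "X \<in> H" "Y \<in> H" "\<And>\<omega>. X \<omega> \<le> Y \<omega> + c"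
  shows "E X \<le> E Y + c"
  using E_mono[of X "\<lambda>\<omega>. Y \<omega> + c"] assms E_add_const[of Y c] by (simp add: add_in const_in)

lemma lipschitz_in:
  assumes "L-lipschitz_on UNIV f" "X \<in> H"
  shows "(\<lambda>\<omega>. f (x + s * X \<omega>)) \<in> H"
  using lLip1_in[OF lipschitz_imp_lLip1[OF lipschitz_shift[OF assms(1)]] scale_in[OF assms(2)]] by simp

lemma expectation_lipschitz:
  assumes lip: "L-lipschitz_on UNIV f" and X: "X \<in> H"
  shows "L-lipschitz_on UNIV (\<lambda>x. E (\<lambda>\<omega>. f (x + s * X \<omega>)))"
  unfolding lipschitz_on_UNIV_iff
proof (intro conjI allI)
  show "0 \<le> L" using lip by (simp add: lipschitz_on_def)
  have *: "E (\<lambda>\<omega>. f (x + s * X \<omega>)) \<le> E (\<lambda>\<omega>. f (y + s * X \<omega>)) + L * \<bar>x - y\<bar>" for x y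
  proof (rule E_le_add_const[OF lipschitz_in[OF lip X] lipschitz_in[OF lip X]])
    show "f (x + s * X \<omega>) \<le> f (y + s * X \<omega>) + L * \<bar>x - y\<bar>" for \<omega>
      using lipschitz_abs_le[OF lip, of "x + s * X \<omega>" "y + s * X \<omega>"] by simp
  qed
  show "\<bar>E (\<lambda>\<omega>. f (x + s * X \<omega>)) - E (\<lambda>\<omega>. f (y + s * X \<omega>))\<bar> \<le> L * \<bar>x - y\<bar>" for x y
    using *[of x y] *[of y x] by (simp add: abs_le_iff abs_minus_commute)
qed

text \<open>
  Jensen's inequality for the averaging operator: subadditivity gives it for Riemann sums, and these converge
  uniformly.
\<close>

lemma expectation_steklov_le:
  assumes lip: "L-lipschitz_on UNIV f" and X: "X \<in> H" and eps: "0 < \<epsilon>"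
  shows "E (\<lambda>\<omega>. steklov \<epsilon> f (x + s * X \<omega>)) \<le> steklov \<epsilon> (\<lambda>z. E (\<lambda>\<omega>. f (z + s * X \<omega>))) x"
proof -
  let ?T = "\<lambda>z. E (\<lambda>\<omega>. f (z + s * X \<omega>))"
  have bound: "E (\<lambda>\<omega>. steklov \<epsilon> f (x + s * X \<omega>)) \<le> steklov \<epsilon> ?T x + 2 * L * \<epsilon> / real (Suc n)" for n
  proof -
    let ?N = "Suc n"
    define g where "g = (\<lambda>k \<omega>. f ((x + real k * \<epsilon> / real ?N) + s * X \<omega>))"
    have g: "g k \<in> H" for k unfolding g_def by (rule lipschitz_in[OF lip X])
    have avg: "(\<lambda>\<omega>. (1 / real ?N) * (\<Sum>k<?N. g k \<omega>)) \<in> H" using E_sum_subadd[of ?N g] g scale_in by blast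
    have "E (\<lambda>\<omega>. steklov \<epsilon> f (x + s * X \<omega>)) \<le> E (\<lambda>\<omega>. (1 / real ?N) * (\<Sum>k<?N. g k \<omega>)) + L * \<epsilon> / real ?N"
    proof (rule E_le_add_const[OF lipschitz_in[OF steklov_lipschitz[OF lip eps] X] avg])
      fix \<omega>
      have "(\<Sum>k<?N. f ((x + s * X \<omega>) + real k * \<epsilon> / real ?N)) = (\<Sum>k<?N. g k \<omega>)"
        unfolding g_def by (intro sum.cong refl arg_cong[of _ _ f]) simp
      then show "steklov \<epsilon> f (x + s * X \<omega>) \<le> (1 / real ?N) * (\<Sum>k<?N. g k \<omega>) + L * \<epsilon> / real ?N"
        using steklov_riemann_sum[OF lip eps, of ?N "x + s * X \<omega>"] by simp
    qed
    also have "E (\<lambda>\<omega>. (1 / real ?N) * (\<Sum>k<?N. g k \<omega>)) = (1 / real ?N) * E (\<lambda>\<omega>. \<Sum>k<?N. g k \<omega>)"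
      using E_sum_subadd[of ?N g] g by (intro E_scale) auto
    also have "\<dots> \<le> (1 / real ?N) * (\<Sum>k<?N. E (g k))"
      using E_sum_subadd[of ?N g] g by (intro mult_left_mono) auto
    also have "(1 / real ?N) * (\<Sum>k<?N. E (g k)) \<le> steklov \<epsilon> ?T x + L * \<epsilon> / real ?N"
      using steklov_riemann_sum[OF expectation_lipschitz[OF lip X] eps, of ?N s x]
      by (simp add: g_def)
    finally show ?thesis by (simp add: add_divide_distrib)
  qed
  have "(\<lambda>n. steklov \<epsilon> ?T x + 2 * L * \<epsilon> / real (Suc n)) \<longlonglongrightarrow> steklov \<epsilon> ?T x + 0"
    by (intro tendsto_intros LIMSEQ_Suc[OF lim_const_over_n])
  then show ?thesis using bound by (intro LIMSEQ_le_const[of _ "steklov \<epsilon> ?T x"]) auto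
qed

text \<open>
  Both expectations agree up to third order: the linear Taylor term is invisible because \<open>X\<close> and \<open>Z\<close> have
  no mean uncertainty, and the quadratic terms have equal expectations by \<open>var\<close>.
\<close>

lemma one_step_comparison:
  assumes lip: "L-lipschitz_on UNIV g" and X: "X \<in> H" and Z: "Z \<in> H" and K: "0 \<le> K" and s: "0 \<le> s"
    and taylor: "\<And>y. \<bar>g (x + y) - (g x + p * y + q * y\<^sup>2)\<bar> \<le> K * \<bar>y\<bar> ^ 3"
    and mean: "E X = 0" "E (\<lambda>\<omega>. - X \<omega>) = 0" "E Z = 0" "E (\<lambda>\<omega>. - Z \<omega>) = 0"
    and var: "\<And>c. E (\<lambda>\<omega>. c * (X \<omega>)\<^sup>2) = E (\<lambda>\<omega>. c * (Z \<omega>)\<^sup>2)"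
  shows "E (\<lambda>\<omega>. g (x + s * Z \<omega>)) \<le> E (\<lambda>\<omega>. g (x + s * X \<omega>)) + K * (E (\<lambda>\<omega>. \<bar>X \<omega>\<bar> ^ 3) + E (\<lambda>\<omega>. \<bar>Z \<omega>\<bar> ^ 3)) * s ^ 3"
proof -
  define c where "c = q * s\<^sup>2"
  have bound: "\<bar>E (\<lambda>\<omega>. g (x + s * W \<omega>)) - (E (\<lambda>\<omega>. c * (W \<omega>)\<^sup>2) + g x)\<bar> \<le> K * s ^ 3 * E (\<lambda>\<omega>. \<bar>W \<omega>\<bar> ^ 3)"
    if W: "W \<in> H" "E W = 0" "E (\<lambda>\<omega>. - W \<omega>) = 0" for W
  proof -
    let ?P = "\<lambda>\<omega>. (c * (W \<omega>)\<^sup>2 + g x) + (p * s) * W \<omega>"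
    have P: "?P \<in> H" using W by (intro H_intros)
    have "E ?P = E (\<lambda>\<omega>. c * (W \<omega>)\<^sup>2 + g x)"
      using W E_null_scale[of W "p * s"] E_null_scale[of W "- (p * s)"] by (intro E_add_null H_intros) simp_all
    also have "\<dots> = E (\<lambda>\<omega>. c * (W \<omega>)\<^sup>2) + g x" using W by (intro E_add_const H_intros)
    finally have eq: "E ?P = E (\<lambda>\<omega>. c * (W \<omega>)\<^sup>2) + g x" .
    have "\<bar>E (\<lambda>\<omega>. g (x + s * W \<omega>)) - E ?P\<bar> \<le> E (\<lambda>\<omega>. \<bar>g (x + s * W \<omega>) - ?P \<omega>\<bar>)"
      by (rule E_abs_diff_le[OF lipschitz_in[OF lip W(1)] P])
    also have "\<dots> \<le> E (\<lambda>\<omega>. (K * s ^ 3) * \<bar>W \<omega>\<bar> ^ 3)"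
    proof (intro E_mono H_intros lipschitz_in[OF lip] W)
      fix \<omega>
      show "\<bar>g (x + s * W \<omega>) - ?P \<omega>\<bar> \<le> (K * s ^ 3) * \<bar>W \<omega>\<bar> ^ 3"
        using taylor[of "s * W \<omega>"] s by (simp add: c_def power_mult_distrib abs_mult algebra_simps)
    qed
    also have "\<dots> = (K * s ^ 3) * E (\<lambda>\<omega>. \<bar>W \<omega>\<bar> ^ 3)" using K s W by (intro E_scale H_intros) auto
    finally show ?thesis unfolding eq .
  qed
  from bound[OF X mean(1,2)] bound[OF Z mean(3,4)] show ?thesis
    unfolding var[of c] by (simp add: abs_le_iff algebra_simps)
qed

lemma stable1_shifted:
  assumes "stable1 E X" "L-lipschitz_on UNIV f" "0 \<le> a" "0 \<le> b"
  shows "E (\<lambda>\<omega>. E (\<lambda>\<omega>'. f (x + a * X \<omega> + b * X \<omega>'))) = E (\<lambda>\<omega>. f (x + sqrt (a\<^sup>2 + b\<^sup>2) * X \<omega>))"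
  using assms(1)[unfolded stable1_def, rule_format, OF lipschitz_imp_lLip1[OF lipschitz_shift[OF assms(2)]] assms(3,4), of x]
  by (simp add: add.assoc)

text \<open>
  Discrete form of the statement that \<open>t \<mapsto> M T\<^sub>t f\<close>, with \<open>M\<close> the twofold Steklov mean, is a supersolution
  for the semigroup of \<open>Z\<close>. The increments \<open>s\<close> have variance parameter \<open>s\<^sup>2\<close>, so after \<open>n\<close> of them the
  scale is \<open>s \<surd>n\<close>. One step first splits off an increment of \<open>Z\<close>, exchanges it for an increment of \<open>X\<close> at the
  price \<open>\<delta>\<close>, and then pulls the expectation inside the two means.
\<close>

lemma comparison_iterated:
  assumes lip: "L-lipschitz_on UNIV f" and eps: "0 < \<epsilon>" and s: "0 \<le> s"
    and X: "X \<in> H" "stable1 E X" and Z: "Z \<in> H" "stable1 E Z"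
    and mean: "E X = 0" "E (\<lambda>\<omega>. - X \<omega>) = 0" "E Z = 0" "E (\<lambda>\<omega>. - Z \<omega>) = 0"
    and var: "\<And>c. E (\<lambda>\<omega>. c * (X \<omega>)\<^sup>2) = E (\<lambda>\<omega>. c * (Z \<omega>)\<^sup>2)"
  defines "\<delta> \<equiv> 4 * L / \<epsilon>\<^sup>2 * (E (\<lambda>\<omega>. \<bar>X \<omega>\<bar> ^ 3) + E (\<lambda>\<omega>. \<bar>Z \<omega>\<bar> ^ 3)) * s ^ 3"
  shows "E (\<lambda>\<omega>. steklov \<epsilon> (steklov \<epsilon> f) (x + (s * sqrt (real n)) * Z \<omega>))
    \<le> steklov \<epsilon> (steklov \<epsilon> (\<lambda>z. E (\<lambda>\<omega>. f (z + (s * sqrt (real n)) * X \<omega>)))) x + real n * \<delta>"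
proof (induction n arbitrary: x)
  case 0
  then show ?case by (simp add: E_const)
next
  case (Suc n)
  let ?r = "s * sqrt (real n)"
  define T where "T = (\<lambda>z. E (\<lambda>\<omega>. f (z + ?r * X \<omega>)))"
  let ?M = "steklov \<epsilon>"
  have lipT: "L-lipschitz_on UNIV T" unfolding T_def by (rule expectation_lipschitz[OF lip X(1)])
  have lipMf: "L-lipschitz_on UNIV (?M (?M f))" by (intro steklov_lipschitz lip eps)
  have lipMT: "L-lipschitz_on UNIV (?M T)" "L-lipschitz_on UNIV (?M (?M T))" by (intro steklov_lipschitz lipT eps)+
  have L: "0 \<le> L" using lip by (simp add: lipschitz_on_def)
  have r: "s * sqrt (real (Suc n)) = sqrt (s\<^sup>2 + ?r\<^sup>2)"
  proof -
    have "s\<^sup>2 + ?r\<^sup>2 = (s * sqrt (real (Suc n)))\<^sup>2" by (simp add: power_mult_distrib distrib_left)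
    moreover have "0 \<le> s * sqrt (real (Suc n))" using s by simp
    ultimately show ?thesis by (simp only: real_sqrt_abs abs_of_nonneg)
  qed
  have "E (\<lambda>\<omega>. ?M (?M f) (x + (s * sqrt (real (Suc n))) * Z \<omega>))
      = E (\<lambda>\<omega>. E (\<lambda>\<omega>'. ?M (?M f) (x + s * Z \<omega> + ?r * Z \<omega>')))"
    unfolding r using s by (intro stable1_shifted[OF Z(2) lipMf, symmetric]) auto
  also have "\<dots> \<le> E (\<lambda>\<omega>. ?M (?M T) (x + s * Z \<omega>)) + real n * \<delta>"
    by (intro E_le_add_const lipschitz_in[OF expectation_lipschitz[OF lipMf Z(1)] Z(1)]
        lipschitz_in[OF lipMT(2) Z(1)]) (rule Suc.IH[folded T_def])
  also have "E (\<lambda>\<omega>. ?M (?M T) (x + s * Z \<omega>)) \<le> E (\<lambda>\<omega>. ?M (?M T) (x + s * X \<omega>)) + \<delta>"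
  proof -
    obtain p q where "\<forall>y. \<bar>?M (?M T) (x + y) - (?M (?M T) x + p * y + q * y\<^sup>2)\<bar> \<le> 4 * L / \<epsilon>\<^sup>2 * \<bar>y\<bar> ^ 3"
      using steklov_steklov_taylor[OF lipT eps] by blast
    then show ?thesis unfolding \<delta>_def using L s
      by (intro one_step_comparison[OF lipMT(2) X(1) Z(1) _ s _ mean var]) auto
  qed
  also have "E (\<lambda>\<omega>. ?M (?M T) (x + s * X \<omega>)) \<le> ?M (\<lambda>z. E (\<lambda>\<omega>. ?M T (z + s * X \<omega>))) x"
    by (rule expectation_steklov_le[OF lipMT(1) X(1) eps])
  also have "\<dots> \<le> ?M (?M (\<lambda>z. E (\<lambda>\<omega>. T (z + s * X \<omega>)))) x"
    by (intro steklov_mono[OF expectation_lipschitz[OF lipMT(1) X(1)]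
          steklov_lipschitz[OF expectation_lipschitz[OF lipT X(1)] eps] _ eps]
        expectation_steklov_le[OF lipT X(1) eps])
  also have "(\<lambda>z. E (\<lambda>\<omega>. T (z + s * X \<omega>))) = (\<lambda>z. E (\<lambda>\<omega>. f (z + (s * sqrt (real (Suc n))) * X \<omega>)))"
    unfolding r T_def using s by (intro ext stable1_shifted[OF X(2) lip]) auto
  finally show ?case by (simp add: algebra_simps)
qed

text \<open>
  With \<open>s = 1 / \<surd>n\<close> the accumulated error \<open>n \<delta>\<close> is of order \<open>1 / \<surd>n\<close>; afterwards the smoothing is removed,
  which costs \<open>2 L \<epsilon>\<close> on either side.
\<close>

lemma stable1_lipschitz_le:
  assumes lip: "L-lipschitz_on UNIV f"
    and X: "X \<in> H" "stable1 E X" and Z: "Z \<in> H" "stable1 E Z"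
    and mean: "E X = 0" "E (\<lambda>\<omega>. - X \<omega>) = 0" "E Z = 0" "E (\<lambda>\<omega>. - Z \<omega>) = 0"
    and var: "\<And>c. E (\<lambda>\<omega>. c * (X \<omega>)\<^sup>2) = E (\<lambda>\<omega>. c * (Z \<omega>)\<^sup>2)"
  shows "E (\<lambda>\<omega>. f (Z \<omega>)) \<le> E (\<lambda>\<omega>. f (X \<omega>))"
proof -
  have L: "0 \<le> L" using lip by (simp add: lipschitz_on_def)
  define T where "T = (\<lambda>z. E (\<lambda>\<omega>. f (z + 1 * X \<omega>)))"
  have lipT: "L-lipschitz_on UNIV T" unfolding T_def by (rule expectation_lipschitz[OF lip X(1)])
  have close: "\<bar>steklov \<epsilon> (steklov \<epsilon> w) x - w x\<bar> \<le> 2 * L * \<epsilon>"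
    if "L-lipschitz_on UNIV w" "0 < \<epsilon>" for w \<epsilon> x
    using steklov_close[OF steklov_lipschitz[OF that] that(2), of x] steklov_close[OF that, of x] by linarith
  have "E (\<lambda>\<omega>. f (Z \<omega>)) \<le> E (\<lambda>\<omega>. f (X \<omega>)) + 4 * L * \<epsilon>" if eps: "0 < \<epsilon>" for \<epsilon>
  proof -
    let ?M = "steklov \<epsilon>"
    have lipM: "L-lipschitz_on UNIV (?M (?M f))" by (intro steklov_lipschitz lip eps)
    define D where "D = 4 * L / \<epsilon>\<^sup>2 * (E (\<lambda>\<omega>. \<bar>X \<omega>\<bar> ^ 3) + E (\<lambda>\<omega>. \<bar>Z \<omega>\<bar> ^ 3))"
    have "E (\<lambda>\<omega>. ?M (?M f) (0 + 1 * Z \<omega>)) \<le> ?M (?M T) 0 + D * (1 / sqrt (real (Suc n)))" for n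
    proof -
      define s where "s = 1 / sqrt (real (Suc n))"
      have "s * sqrt (real (Suc n)) = 1" by (simp add: s_def)
      moreover have "real (Suc n) * s\<^sup>2 = 1" by (simp add: s_def power_divide)
      moreover have "real (Suc n) * (D * s ^ 3) = D * s * (real (Suc n) * s\<^sup>2)"
        by (simp add: power3_eq_cube power2_eq_square)
      moreover have "0 \<le> s" by (simp add: s_def)
      ultimately have "E (\<lambda>\<omega>. ?M (?M f) (0 + 1 * Z \<omega>)) \<le> ?M (?M T) 0 + D * s * 1"
        using comparison_iterated[OF lip eps _ X Z mean var, of s 0 "Suc n", folded D_def]
        by (simp only: T_def)
      then show ?thesis by (simp only: s_def mult_1_right)
    qed
    moreover have "(\<lambda>n. ?M (?M T) 0 + D * (1 / sqrt (real (Suc n)))) \<longlonglongrightarrow> ?M (?M T) 0 + D * 0"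
      by (intro tendsto_intros) real_asymp
    ultimately have "E (\<lambda>\<omega>. ?M (?M f) (0 + 1 * Z \<omega>)) \<le> ?M (?M T) 0"
      by (intro LIMSEQ_le_const[of _ "?M (?M T) 0"]) auto
    moreover have "E (\<lambda>\<omega>. f (0 + 1 * Z \<omega>)) \<le> E (\<lambda>\<omega>. ?M (?M f) (0 + 1 * Z \<omega>)) + 2 * L * \<epsilon>"
    proof (intro E_le_add_const lipschitz_in[OF lip Z(1)] lipschitz_in[OF lipM Z(1)])
      show "f (0 + 1 * Z \<omega>) \<le> ?M (?M f) (0 + 1 * Z \<omega>) + 2 * L * \<epsilon>" for \<omega>
        using close[OF lip eps, of "0 + 1 * Z \<omega>"] by linarith
    qed
    ultimately show ?thesis using close[OF lipT eps, of 0] by (simp add: T_def abs_le_iff)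
  qed
  note bound = this
  have "E (\<lambda>\<omega>. f (Z \<omega>)) \<le> E (\<lambda>\<omega>. f (X \<omega>)) + e" if e: "0 < e" for e
  proof -
    have "4 * L * (e / (4 * L + 1)) \<le> e" "0 < e / (4 * L + 1)"
      using L e by (auto simp: divide_simps)
    then show ?thesis using bound[of "e / (4 * L + 1)"] by linarith
  qed
  then show ?thesis by (rule field_le_epsilon)
qed

text \<open>
  Truncating the argument at height \<open>N\<close> moves it by at most \<open>X\<^sup>2 / N\<close>, and all moments of \<open>X\<close> are finite.
\<close>

lemma truncation_bound:
  assumes f: "lLip1 f" and X: "X \<in> H"
  shows "\<exists>B. \<forall>N>0. \<bar>E (\<lambda>\<omega>. f (X \<omega>)) - E (\<lambda>\<omega>. f (max (- N) (min N (X \<omega>))))\<bar> \<le> B / N"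
proof -
  obtain C m where C: "0 \<le> C" and Cm: "\<And>x y. \<bar>f x - f y\<bar> \<le> C * (1 + \<bar>x\<bar> + \<bar>y\<bar>) ^ m * \<bar>x - y\<bar>"
    using lLip1_bound[OF f] by blast
  define B where "B = E (\<lambda>\<omega>. C * (1 + 2 * \<bar>X \<omega>\<bar>) ^ m * (X \<omega>)\<^sup>2)"
  have "\<bar>E (\<lambda>\<omega>. f (X \<omega>)) - E (\<lambda>\<omega>. f (max (- N) (min N (X \<omega>))))\<bar> \<le> B / N" if N: "0 < N" for N
  proof -
    have lip: "lLip1 (\<lambda>r. max (- N) (min N r))" by (rule lLip1_lipschitz[of _ 1]) auto
    note H = lLip1_in[OF f X] lLip1_in[OF lLip1_comp[OF f lip] X]
    have "\<bar>E (\<lambda>\<omega>. f (X \<omega>)) - E (\<lambda>\<omega>. f (max (- N) (min N (X \<omega>))))\<bar>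
        \<le> E (\<lambda>\<omega>. \<bar>f (X \<omega>) - f (max (- N) (min N (X \<omega>)))\<bar>)" by (rule E_abs_diff_le[OF H])
    also have "\<dots> \<le> E (\<lambda>\<omega>. (1 / N) * (C * (1 + 2 * \<bar>X \<omega>\<bar>) ^ m * (X \<omega>)\<^sup>2))"
    proof (intro E_mono H_intros H X)
      fix \<omega>
      define r where "r = X \<omega>"
      let ?t = "max (- N) (min N r)"
      have t: "\<bar>?t\<bar> \<le> \<bar>r\<bar>" using N by auto
      have "N * \<bar>r - ?t\<bar> \<le> r\<^sup>2"
      proof (cases "\<bar>r\<bar> \<le> N")
        case False
        have "N * \<bar>r - ?t\<bar> \<le> \<bar>r\<bar> * \<bar>r\<bar>" using False N by (intro mult_mono) auto
        then show ?thesis by (simp add: power2_eq_square)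
      qed (auto simp: min_def max_def)
      then have d: "\<bar>r - ?t\<bar> \<le> r\<^sup>2 / N" using N by (simp add: field_simps)
      have "(1 + \<bar>r\<bar> + \<bar>?t\<bar>) ^ m \<le> (1 + 2 * \<bar>r\<bar>) ^ m" using t by (intro power_mono) auto
      then have "C * (1 + \<bar>r\<bar> + \<bar>?t\<bar>) ^ m * \<bar>r - ?t\<bar> \<le> C * (1 + 2 * \<bar>r\<bar>) ^ m * (r\<^sup>2 / N)"
        using C d by (intro mult_mono mult_left_mono) auto
      then show "\<bar>f (X \<omega>) - f (max (- N) (min N (X \<omega>)))\<bar> \<le> (1 / N) * (C * (1 + 2 * \<bar>X \<omega>\<bar>) ^ m * (X \<omega>)\<^sup>2)"
        using Cm[of r ?t] unfolding r_def by simp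
    qed
    also have "\<dots> = (1 / N) * B" unfolding B_def using N X by (intro E_scale H_intros) auto
    finally show ?thesis by simp
  qed
  then show ?thesis by blast
qed

lemma truncated_lipschitz:
  assumes f: "lLip1 f" and N: "0 < N"
  shows "\<exists>L. L-lipschitz_on UNIV (\<lambda>r. f (max (- N) (min N r)))"
proof -
  obtain C m where C: "0 \<le> C" and Cm: "\<And>x y. \<bar>f x - f y\<bar> \<le> C * (1 + \<bar>x\<bar> + \<bar>y\<bar>) ^ m * \<bar>x - y\<bar>"
    using lLip1_bound[OF f] by blast
  have "\<bar>f (max (- N) (min N x)) - f (max (- N) (min N y))\<bar> \<le> C * (1 + 2 * N) ^ m * \<bar>x - y\<bar>" for x y
  proof -
    let ?t = "\<lambda>x. max (- N) (min N x)"
    have "C * (1 + \<bar>?t x\<bar> + \<bar>?t y\<bar>) ^ m * \<bar>?t x - ?t y\<bar> \<le> C * (1 + 2 * N) ^ m * \<bar>x - y\<bar>"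
      using C N by (intro mult_mono mult_left_mono power_mono) auto
    then show ?thesis using Cm[of "?t x" "?t y"] by simp
  qed
  then show ?thesis unfolding lipschitz_on_UNIV_iff using C N
    by (intro exI[of _ "C * (1 + 2 * N) ^ m"]) auto
qed

lemma stable1_le:
  assumes f: "lLip1 f"
    and X: "X \<in> H" "stable1 E X" and Z: "Z \<in> H" "stable1 E Z"
    and mean: "E X = 0" "E (\<lambda>\<omega>. - X \<omega>) = 0" "E Z = 0" "E (\<lambda>\<omega>. - Z \<omega>) = 0"
    and var: "\<And>c. E (\<lambda>\<omega>. c * (X \<omega>)\<^sup>2) = E (\<lambda>\<omega>. c * (Z \<omega>)\<^sup>2)"
  shows "E (\<lambda>\<omega>. f (Z \<omega>)) \<le> E (\<lambda>\<omega>. f (X \<omega>))"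
proof -
  obtain B where B: "\<And>N. 0 < N \<Longrightarrow> \<bar>E (\<lambda>\<omega>. f (X \<omega>)) - E (\<lambda>\<omega>. f (max (- N) (min N (X \<omega>))))\<bar> \<le> B / N"
    using truncation_bound[OF f X(1)] by blast
  obtain D where D: "\<And>N. 0 < N \<Longrightarrow> \<bar>E (\<lambda>\<omega>. f (Z \<omega>)) - E (\<lambda>\<omega>. f (max (- N) (min N (Z \<omega>))))\<bar> \<le> D / N"
    using truncation_bound[OF f Z(1)] by blast
  have "E (\<lambda>\<omega>. f (Z \<omega>)) \<le> E (\<lambda>\<omega>. f (X \<omega>)) + (B + D) / real (Suc n)" for n
  proof -
    obtain L where "L-lipschitz_on UNIV (\<lambda>r. f (max (- real (Suc n)) (min (real (Suc n)) r)))"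
      using truncated_lipschitz[OF f, of "real (Suc n)"] by auto
    from stable1_lipschitz_le[OF this X Z mean var] B[of "real (Suc n)"] D[of "real (Suc n)"]
    show ?thesis by (simp add: add_divide_distrib abs_le_iff)
  qed
  moreover have "(\<lambda>n. E (\<lambda>\<omega>. f (X \<omega>)) + (B + D) / real (Suc n)) \<longlonglongrightarrow> E (\<lambda>\<omega>. f (X \<omega>)) + 0"
    by (intro tendsto_intros LIMSEQ_Suc[OF lim_const_over_n])
  ultimately show ?thesis by (intro LIMSEQ_le_const[of _ "E (\<lambda>\<omega>. f (X \<omega>))"]) auto
qed

text \<open>
  This takes the place of uniqueness of solutions of the G-heat equation.
\<close>

lemma stable1_unique:
  assumes f: "lLip1 f"
    and X: "X \<in> H" "stable1 E X" and Z: "Z \<in> H" "stable1 E Z"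
    and mean: "E X = 0" "E (\<lambda>\<omega>. - X \<omega>) = 0" "E Z = 0" "E (\<lambda>\<omega>. - Z \<omega>) = 0"
    and var: "\<And>c. E (\<lambda>\<omega>. c * (X \<omega>)\<^sup>2) = E (\<lambda>\<omega>. c * (Z \<omega>)\<^sup>2)"
  shows "E (\<lambda>\<omega>. f (X \<omega>)) = E (\<lambda>\<omega>. f (Z \<omega>))"
  using stable1_le[OF f X Z mean var] stable1_le[OF f Z X mean(3,4,1,2) var[symmetric]] by simp

lemma stable1_uminus:
  assumes "stable1 E X" shows "stable1 E (\<lambda>\<omega>. - X \<omega>)"
  unfolding stable1_def
proof (intro allI impI)
  fix f and a b :: real assume f: "lLip1 f" and ab: "0 \<le> a" "0 \<le> b"
  have "lLip1 (\<lambda>r. 0 - r)" by (intro lLip1_intros)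
  from assms[unfolded stable1_def, rule_format, OF lLip1_comp[OF f this] ab]
  show "E (\<lambda>\<omega>. E (\<lambda>\<omega>'. f (a * - X \<omega> + b * - X \<omega>'))) = E (\<lambda>\<omega>. f (sqrt (a\<^sup>2 + b\<^sup>2) * - X \<omega>))"
    by simp
qed

lemma stable1_scale:
  assumes "stable1 E X" shows "stable1 E (\<lambda>\<omega>. c * X \<omega>)"
  unfolding stable1_def
proof (intro allI impI)
  fix f and a b :: real assume f: "lLip1 f" and ab: "0 \<le> a" "0 \<le> b"
  have "lLip1 (\<lambda>r. c * r)" by (intro lLip1_intros)
  from assms[unfolded stable1_def, rule_format, OF lLip1_comp[OF f this] ab]
  show "E (\<lambda>\<omega>. E (\<lambda>\<omega>'. f (a * (c * X \<omega>) + b * (c * X \<omega>')))) = E (\<lambda>\<omega>. f (sqrt (a\<^sup>2 + b\<^sup>2) * (c * X \<omega>)))"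
    by (simp add: algebra_simps)
qed

text \<open>
  For \<open>a = b = 1\<close> and the identity as test function, stability reads \<open>2 E X = \<surd>2 E X\<close>.
\<close>

lemma stable1_mean_zero:
  assumes X: "X \<in> H" and st: "stable1 E X" shows "E X = 0"
proof -
  have "E (\<lambda>\<omega>. E (\<lambda>\<omega>'. 1 * X \<omega> + 1 * X \<omega>')) = E (\<lambda>\<omega>. sqrt (1\<^sup>2 + 1\<^sup>2) * X \<omega>)"
    using st[unfolded stable1_def, rule_format, OF lLip1_id, of 1 1] by simp
  moreover have "E (\<lambda>\<omega>'. 1 * X \<omega> + 1 * X \<omega>') = X \<omega> + E X" for \<omega>
    using E_add_const[OF X, of "X \<omega>"] by (simp add: add.commute)
  ultimately have "E X + E X = sqrt 2 * E X"
    using E_add_const[OF X, of "E X"] E_scale[OF X, of "sqrt 2"] by simp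
  then have "(2 - sqrt 2) * E X = 0" by (simp add: algebra_simps)
  moreover have "sqrt 2 < 2" by (rule real_less_lsqrt) auto
  ultimately show ?thesis by simp
qed

lemma stable1_scaled_mean_zero:
  assumes "X \<in> H" "stable1 E X" shows "E (\<lambda>\<omega>. c * X \<omega>) = 0"
  using assms stable1_mean_zero[OF scale_in stable1_scale] by blast

text \<open>
  The variable and its negative are both stable and have the same square.
\<close>

lemma stable1_symmetric:
  assumes "X \<in> H" "stable1 E X" "lLip1 f"
  shows "E (\<lambda>\<omega>. f (- X \<omega>)) = E (\<lambda>\<omega>. f (X \<omega>))"
  using assms stable1_mean_zero stable1_mean_zero[OF uminus_in stable1_uminus]
  by (intro stable1_unique[OF assms(3)] uminus_in stable1_uminus) auto

lemma stable1_abs_scale: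
  assumes "X \<in> H" "stable1 E X" "lLip1 f"
  shows "E (\<lambda>\<omega>. f (x + \<bar>c\<bar> * X \<omega>)) = E (\<lambda>\<omega>. f (x + c * X \<omega>))"
proof (cases "0 \<le> c")
  case False
  have "lLip1 (\<lambda>r. f (x + c * r))" by (intro lLip1_comp[OF assms(3)] lLip1_intros)
  from stable1_symmetric[OF assms(1,2) this] show ?thesis using False by simp
qed simp

lemma section_lLip1:
  assumes X: "X \<in> H" and f: "lLip1 f"
  shows "lLip1 (\<lambda>x. E (\<lambda>\<omega>. f (a * x + b * X \<omega>)))"
proof -
  have "random_vector H 1 (vec1 X)" using X by simp
  moreover have "(\<lambda>z. f (a * z $ 0 + b * z $ 1)) \<in> C_lLip (1 + 1)"
    by (intro C_lLip_lLip1_compose[OF f] C_lLip_intros) auto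
  ultimately have "(\<lambda>x. E (\<lambda>\<omega>. f (a * (x @\<^sub>v vec1 X \<omega>) $ 0 + b * (x @\<^sub>v vec1 X \<omega>) $ 1))) \<in> C_lLip 1"
    by (rule section_C_lLip)
  from lLip1_of_C_lLip[OF this] show ?thesis by (simp add: vec1_def)
qed

lemma stable1_transfer:
  assumes X: "X \<in> H" and Z: "Z \<in> H" "stable1 E Z"
    and eq: "\<And>f. lLip1 f \<Longrightarrow> E (\<lambda>\<omega>. f (X \<omega>)) = E (\<lambda>\<omega>. f (Z \<omega>))"
  shows "stable1 E X"
  unfolding stable1_def
proof (intro allI impI)
  fix f and a b :: real assume f: "lLip1 f" and ab: "0 \<le> a" "0 \<le> b"
  have "E (\<lambda>\<omega>'. f (a * x + b * X \<omega>')) = E (\<lambda>\<omega>'. f (a * x + b * Z \<omega>'))" for x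
    by (rule eq[of "\<lambda>r. f (a * x + b * r)"]) (intro lLip1_comp[OF f] lLip1_intros)
  then have "E (\<lambda>\<omega>. E (\<lambda>\<omega>'. f (a * X \<omega> + b * X \<omega>'))) = E (\<lambda>\<omega>. E (\<lambda>\<omega>'. f (a * X \<omega> + b * Z \<omega>')))"
    by simp
  also have "\<dots> = E (\<lambda>\<omega>. E (\<lambda>\<omega>'. f (a * Z \<omega> + b * Z \<omega>')))"
    by (rule eq[OF section_lLip1[OF Z(1) f]])
  also have "\<dots> = E (\<lambda>\<omega>. f (sqrt (a\<^sup>2 + b\<^sup>2) * Z \<omega>))"
    using Z(2) f ab by (simp add: stable1_def)
  also have "\<dots> = E (\<lambda>\<omega>. f (sqrt (a\<^sup>2 + b\<^sup>2) * X \<omega>))"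
    by (rule eq[symmetric, of "\<lambda>r. f (sqrt (a\<^sup>2 + b\<^sup>2) * r)"]) (intro lLip1_comp[OF f] lLip1_intros)
  finally show "E (\<lambda>\<omega>. E (\<lambda>\<omega>'. f (a * X \<omega> + b * X \<omega>'))) = E (\<lambda>\<omega>. f (sqrt (a\<^sup>2 + b\<^sup>2) * X \<omega>))" .
qed

end

section \<open>Normal distributions on a line\<close>

lemma SUP_mult_interval:
  fixes c :: real
  assumes "a \<le> b"
  shows "(SUP r\<in>{a..b}. c * r) = max (c * a) (c * b)"
proof (rule cSup_eq_maximum)
  show "max (c * a) (c * b) \<in> (*) c ` {a..b}" using assms by (auto simp: max_def)
  show "x \<le> max (c * a) (c * b)" if x: "x \<in> (*) c ` {a..b}" for x
  proof -
    obtain r where "r \<in> {a..b}" and "x = c * r" using x by blast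
    then have r: "x = c * r" "a \<le> r" "r \<le> b" by auto
    show ?thesis
    proof (cases "0 \<le> c")
      case True
      then have "c * r \<le> c * b" using r by (intro mult_left_mono)
      then show ?thesis using r by simp
    next
      case False
      then have "c * r \<le> c * a" using r by (intro mult_left_mono_neg) auto
      then show ?thesis using r by simp
    qed
  qed
qed

lemma outer_carrier [simp]: "u \<in> carrier_vec m \<Longrightarrow> w \<in> carrier_vec n \<Longrightarrow> outer u w \<in> carrier_mat m n"
  by (auto simp: outer_def)

lemma outer_mult_vec:
  assumes "u \<in> carrier_vec m" "w \<in> carrier_vec n" "y \<in> carrier_vec n"
  shows "outer u w *\<^sub>v y = (w \<bullet> y) \<cdot>\<^sub>v u"
  using assms by (intro eq_vecI) (auto simp: outer_def scalar_prod_def sum_distrib_left mult_ac)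

lemma trace_mult_outer:
  assumes "A \<in> carrier_mat m m" "u \<in> carrier_vec m"
  shows "mat_trace (A * (r \<cdot>\<^sub>m outer u u)) = ((A *\<^sub>v u) \<bullet> u) * r"
proof -
  have "(A * (r \<cdot>\<^sub>m outer u u)) $$ (i, i) = (A *\<^sub>v u) $ i * u $ i * r" if "i < m" for i
    using assms that by (auto simp: outer_def scalar_prod_def sum_distrib_left mult_ac)
  then show ?thesis using assms
    by (auto simp: mat_trace_def scalar_prod_def sum_distrib_right atLeast0LessThan)
qed

lemma segment_psd:
  assumes u: "u \<in> carrier_vec m" and r: "0 \<le> r"
  shows "r \<cdot>\<^sub>m outer u u \<in> psd_mats m"
  unfolding psd_mats_def sym_mats_def
proof (intro CollectI conjI ballI)
  show "r \<cdot>\<^sub>m outer u u \<in> carrier_mat m m" using u by simp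
  show "(r \<cdot>\<^sub>m outer u u)\<^sup>T = r \<cdot>\<^sub>m outer u u" using u by (intro eq_matI) (auto simp: outer_def)
  fix x :: "real vec" assume x: "x \<in> carrier_vec m"
  have "(r \<cdot>\<^sub>m outer u u) *\<^sub>v x = r \<cdot>\<^sub>v (outer u u *\<^sub>v x)"
    using u x by (intro eq_vecI) (auto simp: outer_def scalar_prod_def sum_distrib_left mult_ac)
  also have "\<dots> = r \<cdot>\<^sub>v ((u \<bullet> x) \<cdot>\<^sub>v u)" using u x by (simp add: outer_mult_vec)
  finally show "0 \<le> ((r \<cdot>\<^sub>m outer u u) *\<^sub>v x) \<bullet> x" using u x r by simp
qed

lemma segment_bounded:
  assumes u: "u \<in> carrier_vec m" and ab: "0 \<le> a"
  shows "bounded_mats {r \<cdot>\<^sub>m outer u u | r. r \<in> {a..b}}"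
  unfolding bounded_mats_def
proof (intro exI[of _ "b * (vnorm u * vnorm u)"] ballI)
  fix B assume "B \<in> {r \<cdot>\<^sub>m outer u u | r. r \<in> {a..b}}"
  then obtain r where B: "B = r \<cdot>\<^sub>m outer u u" and r: "a \<le> r" "r \<le> b" by auto
  have "\<bar>r\<bar> * (\<bar>u $ i\<bar> * \<bar>u $ j\<bar>) \<le> b * (vnorm u * vnorm u)" if "i < m" "j < m" for i j
    using that u r ab by (intro mult_mono abs_coord_le_vnorm) auto
  then show "norm_bound B (b * (vnorm u * vnorm u))"
    unfolding norm_bound_def B using u by (auto simp: outer_def abs_mult)
qed

text \<open>
  Compactness of the parameter interval covers the degenerate case \<open>u = 0\<close>, where the parameters need not converge.
\<close>

lemma segment_closed:
  assumes u: "u \<in> carrier_vec m"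
  shows "closed_mats m {r \<cdot>\<^sub>m outer u u | r. r \<in> {a..b}}"
  unfolding closed_mats_def
proof (intro allI ballI impI)
  fix B :: "nat \<Rightarrow> real mat" and L
  assume L: "L \<in> carrier_mat m m" and B: "\<forall>l. B l \<in> {r \<cdot>\<^sub>m outer u u | r. r \<in> {a..b}}"
    and lim: "\<forall>i<m. \<forall>j<m. (\<lambda>l. B l $$ (i, j)) \<longlonglongrightarrow> L $$ (i, j)"
  have "\<forall>l. \<exists>r. B l = r \<cdot>\<^sub>m outer u u \<and> r \<in> {a..b}" using B by blast
  then obtain r where r: "\<And>l. B l = r l \<cdot>\<^sub>m outer u u" "\<And>l. r l \<in> {a..b}" by metis
  obtain s \<rho> where rho: "\<rho> \<in> {a..b}" and s: "strict_mono s" "(r \<circ> s) \<longlonglongrightarrow> \<rho>"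
    using compact_Icc[of a b] r(2) unfolding compact_def by metis
  have "L $$ (i, j) = (\<rho> \<cdot>\<^sub>m outer u u) $$ (i, j)" if "i < m" "j < m" for i j
  proof (rule LIMSEQ_unique)
    have "(\<lambda>l. B l $$ (i, j)) \<longlonglongrightarrow> L $$ (i, j)" using lim that by blast
    from LIMSEQ_subseq_LIMSEQ[OF this s(1)]
    show "(\<lambda>l. (r \<circ> s) l * (u $ i * u $ j)) \<longlonglongrightarrow> L $$ (i, j)"
      using u that by (simp add: r(1) outer_def comp_def)
    show "(\<lambda>l. (r \<circ> s) l * (u $ i * u $ j)) \<longlonglongrightarrow> (\<rho> \<cdot>\<^sub>m outer u u) $$ (i, j)"
      using tendsto_mult_right[OF s(2), of "u $ i * u $ j"] u that by (simp add: outer_def)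
  qed
  then have "L = \<rho> \<cdot>\<^sub>m outer u u" using L u by (intro eq_matI) (auto simp: outer_def)
  then show "L \<in> {r \<cdot>\<^sub>m outer u u | r. r \<in> {a..b}}" using rho by blast
qed

lemma segment_convex:
  "convex_mats {r \<cdot>\<^sub>m outer u u | r. r \<in> {a..b}}"
  unfolding convex_mats_def
proof (intro ballI allI impI)
  fix A B and t :: real
  assume "A \<in> {r \<cdot>\<^sub>m outer u u | r. r \<in> {a..b}}" "B \<in> {r \<cdot>\<^sub>m outer u u | r. r \<in> {a..b}}"
    and t: "0 \<le> t" "t \<le> 1"
  then obtain r s where A: "A = r \<cdot>\<^sub>m outer u u" "r \<in> {a..b}" and B: "B = s \<cdot>\<^sub>m outer u u" "s \<in> {a..b}"
    by auto
  have "(1 - t) * r + t * s \<in> {a..b}"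
    using convexD[OF convex_real_interval(5) A(2) B(2), of "1 - t" t] t by simp
  moreover have "(1 - t) \<cdot>\<^sub>m A + t \<cdot>\<^sub>m B = ((1 - t) * r + t * s) \<cdot>\<^sub>m outer u u"
    unfolding A B by (intro eq_matI) (auto simp: algebra_simps)
  ultimately show "(1 - t) \<cdot>\<^sub>m A + t \<cdot>\<^sub>m B \<in> {r \<cdot>\<^sub>m outer u u | r. r \<in> {a..b}}" by blast
qed

context sublinear_expectation_space
begin

lemma G_normal_line:
  assumes X: "X \<in> H" "stable1 E X" and u: "u \<in> carrier_vec m"
  shows "G_normal H E m (\<lambda>\<omega>. X \<omega> \<cdot>\<^sub>v u)"
proof (rule stable_imp_G_normal)
  show "random_vector H m (\<lambda>\<omega>. X \<omega> \<cdot>\<^sub>v u)"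
    unfolding random_vector_def
  proof (intro conjI allI impI)
    fix i assume "i < m"
    then have "(\<lambda>\<omega>. (X \<omega> \<cdot>\<^sub>v u) $ i) = (\<lambda>\<omega>. u $ i * X \<omega>)" using u by auto
    then show "(\<lambda>\<omega>. (X \<omega> \<cdot>\<^sub>v u) $ i) \<in> H" using X by (simp add: scale_in)
  qed (use u in auto)
  show "stable E m (\<lambda>\<omega>. X \<omega> \<cdot>\<^sub>v u)" unfolding stable_def
  proof (intro ballI allI impI)
    fix \<phi> and a b :: real assume phi: "\<phi> \<in> C_lLip m" and ab: "0 \<le> a" "0 \<le> b"
    have "lLip1 (\<lambda>r. \<phi> (r \<cdot>\<^sub>v u))" unfolding lLip1_def
    proof (rule C_lLip_compose[OF _ _ phi])
      fix i assume "i < m"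
      then have "(\<lambda>v. (v $ 0 \<cdot>\<^sub>v u) $ i) = (\<lambda>v. v $ 0 * u $ i)" using u by auto
      then show "(\<lambda>v. (v $ 0 \<cdot>\<^sub>v u) $ i) \<in> C_lLip 1" by (auto intro!: C_lLip_intros)
    qed (use u in auto)
    note eq = X(2)[unfolded stable1_def, rule_format, OF this ab]
    have "a \<cdot>\<^sub>v (X \<omega> \<cdot>\<^sub>v u) + b \<cdot>\<^sub>v (X \<omega>' \<cdot>\<^sub>v u) = (a * X \<omega> + b * X \<omega>') \<cdot>\<^sub>v u" for \<omega> \<omega>'
      using u by (intro eq_vecI) (auto simp: algebra_simps)
    then show "E (\<lambda>\<omega>. E (\<lambda>\<omega>'. \<phi> (a \<cdot>\<^sub>v (X \<omega> \<cdot>\<^sub>v u) + b \<cdot>\<^sub>v (X \<omega>' \<cdot>\<^sub>v u))))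
        = E (\<lambda>\<omega>. \<phi> (sqrt (a\<^sup>2 + b\<^sup>2) \<cdot>\<^sub>v (X \<omega> \<cdot>\<^sub>v u)))"
      using eq by (simp add: smult_smult_assoc)
  qed
qed

lemma normal_dist_line:
  assumes X: "X \<in> H" "stable1 E X" and u: "u \<in> carrier_vec m"
    and ab: "0 \<le> a" "a \<le> b" and var: "\<And>c. E (\<lambda>\<omega>. c * (X \<omega>)\<^sup>2) = max (c * a) (c * b)"
  shows "normal_dist H E m (\<lambda>\<omega>. X \<omega> \<cdot>\<^sub>v u) {r \<cdot>\<^sub>m outer u u | r. r \<in> {a..b}}"
  unfolding normal_dist_def
proof (intro conjI ballI segment_bounded[OF u] segment_closed[OF u] segment_convex G_normal_line X u ab)
  show "{r \<cdot>\<^sub>m outer u u | r. r \<in> {a..b}} \<noteq> {}" using ab by auto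
  show "{r \<cdot>\<^sub>m outer u u | r. r \<in> {a..b}} \<subseteq> psd_mats m" using segment_psd[OF u] ab by auto
  fix A assume "A \<in> sym_mats m"
  then have A: "A \<in> carrier_mat m m" by (simp add: sym_mats_def)
  have "{r \<cdot>\<^sub>m outer u u | r. r \<in> {a..b}} = (\<lambda>r. r \<cdot>\<^sub>m outer u u) ` {a..b}" by auto
  then have "(SUP B\<in>{r \<cdot>\<^sub>m outer u u | r. r \<in> {a..b}}. mat_trace (A * B)) = (SUP r\<in>{a..b}. ((A *\<^sub>v u) \<bullet> u) * r)"
    by (simp add: image_image trace_mult_outer[OF A u])
  also have "\<dots> = E (\<lambda>\<omega>. ((A *\<^sub>v u) \<bullet> u) * (X \<omega>)\<^sup>2)"
    by (simp add: SUP_mult_interval[OF ab(2)] var)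
  also have "\<dots> = E (\<lambda>\<omega>. (A *\<^sub>v (X \<omega> \<cdot>\<^sub>v u)) \<bullet> (X \<omega> \<cdot>\<^sub>v u))"
  proof -
    have "(A *\<^sub>v (r \<cdot>\<^sub>v u)) \<bullet> (r \<cdot>\<^sub>v u) = ((A *\<^sub>v u) \<bullet> u) * r\<^sup>2" for r
      using A u by (simp add: mult_mat_vec power2_eq_square)
    then show ?thesis by simp
  qed
  finally show "1 / 2 * E (\<lambda>\<omega>. (A *\<^sub>v (X \<omega> \<cdot>\<^sub>v u)) \<bullet> (X \<omega> \<cdot>\<^sub>v u))
      = 1 / 2 * (SUP B\<in>{r \<cdot>\<^sub>m outer u u | r. r \<in> {a..b}}. mat_trace (A * B))" by simp
qed

lemma stable1_imp_normal_dist1: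
  assumes X: "X \<in> H" "stable1 E X"
    and ab: "0 \<le> a" "a \<le> b" and var: "\<And>c. E (\<lambda>\<omega>. c * (X \<omega>)\<^sup>2) = max (c * a) (c * b)"
  shows "normal_dist1 H E X {a..b}"
proof -
  let ?u = "vec 1 (\<lambda>_. 1 :: real)"
  \<comment> \<open>The line in question is the whole space \<open>\<real>\<^sup>1\<close>.\<close>
  have "vec1 X = (\<lambda>\<omega>. X \<omega> \<cdot>\<^sub>v ?u)" by (intro ext eq_vecI) (auto simp: vec1_def)
  moreover have "r \<cdot>\<^sub>m outer ?u ?u = mat 1 1 (\<lambda>_. r)" for r
    by (intro eq_matI) (auto simp: outer_def)
  then have "{r \<cdot>\<^sub>m outer ?u ?u | r. r \<in> {a..b}} = (\<lambda>r. mat 1 1 (\<lambda>_. r)) ` {a..b}" by auto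
  ultimately show ?thesis
    using normal_dist_line[OF X, of ?u 1 a b] ab var by (simp add: normal_dist1_def)
qed

lemma normal_dist1_imp_stable1:
  assumes nd: "normal_dist1 H E X {a..b}" and ab: "a \<le> b"
  shows "X \<in> H" "stable1 E X" "E (\<lambda>\<omega>. c * (X \<omega>)\<^sup>2) = max (c * a) (c * b)"
proof -
  have G: "G_normal H E 1 (vec1 X)" using nd by (simp add: normal_dist1_def normal_dist_def)
  then show "stable1 E X" using G_normal_imp_stable stable_1_iff_stable1 by blast
  show "X \<in> H" using G by (simp add: G_normal_def)
  let ?A = "mat 1 1 (\<lambda>_. c)"
  have "?A \<in> sym_mats 1" by (auto simp: sym_mats_def)
  then have "E (\<lambda>\<omega>. (?A *\<^sub>v vec1 X \<omega>) \<bullet> vec1 X \<omega>) = (SUP B\<in>(\<lambda>r. mat 1 1 (\<lambda>_. r)) ` {a..b}. mat_trace (?A * B))"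
    using nd by (simp add: normal_dist1_def normal_dist_def)
  also have "\<dots> = (SUP r\<in>{a..b}. c * r)"
    by (simp add: image_image mat_trace_def scalar_prod_def)
  also have "(\<lambda>\<omega>. (?A *\<^sub>v vec1 X \<omega>) \<bullet> vec1 X \<omega>) = (\<lambda>\<omega>. c * (X \<omega>)\<^sup>2)"
    by (auto simp: vec1_def scalar_prod_def power2_eq_square)
  finally show "E (\<lambda>\<omega>. c * (X \<omega>)\<^sup>2) = max (c * a) (c * b)" by (simp add: SUP_mult_interval[OF ab])
qed

end

text \<open>
  If some column \<open>c\<close> is nonzero, every other column is a multiple of it, since two distinct linearly
  independent columns would force the rank to be at least two; the multiples are the entries of \<open>w\<close>.
\<close>

lemma outer_of_rank_le_1:
  fixes A :: "real mat"
  assumes A: "A \<in> carrier_mat m n" and rank: "vec_space.rank m A \<le> 1"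
  shows "\<exists>u\<in>carrier_vec m. \<exists>w\<in>carrier_vec n. A = outer u w"
proof (cases "\<exists>j<n. col A j \<noteq> 0\<^sub>v m")
  case False
  then have "A $$ (i, j) = 0" if "i < m" "j < n" for i j
    using that A by (metis index_col index_zero_vec(1) carrier_matD)
  then have "A = outer (0\<^sub>v m) (0\<^sub>v n)" using A by (intro eq_matI) (auto simp: outer_def)
  then show ?thesis by (intro bexI[of _ "0\<^sub>v m"] bexI[of _ "0\<^sub>v n"]) auto
next
  case True
  then obtain j where j: "j < n" and c0: "col A j \<noteq> 0\<^sub>v m" by blast
  interpret vs: vec_space "TYPE(real)" m .
  define c where "c = col A j"
  have c: "c \<in> carrier_vec m" "c \<noteq> 0\<^sub>v m" using A j c0 by (auto simp: c_def)
  have "\<exists>t. col A k = t \<cdot>\<^sub>v c" if k: "k < n" for k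
  proof (cases "col A k = c")
    case True
    then show ?thesis by (intro exI[of _ 1]) simp
  next
    case False
    define d where "d = col A k"
    have d: "d \<in> carrier_vec m" using A k by (auto simp: d_def)
    let ?B = "mat_of_cols m [c, d]"
    have B: "?B \<in> carrier_mat m 2" and cols: "cols ?B = [c, d]" using c d by auto
    have "{c, d} \<subseteq> set (cols A)" using A j k by (auto simp: cols_def c_def d_def)
    then have "vs.lin_dep {c, d}"
      using vs.rank_ge_card_indpt[OF A, of "{c, d}"] rank False by (auto simp: d_def)
    then have dep: "vs.lin_dep (set (cols ?B))" by (simp only: cols list.set)
    have dist: "distinct (cols ?B)" unfolding cols using False by (auto simp: d_def)
    obtain v where v: "v \<in> carrier_vec 2" "v \<noteq> 0\<^sub>v 2" "?B *\<^sub>v v = 0\<^sub>v m"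
      by (rule vs.lin_depE[OF B dep dist])
    have comb: "v $ 0 * c $ i + v $ 1 * d $ i = 0" if "i < m" for i
    proof -
      have "(?B *\<^sub>v v) $ i = v $ 0 * c $ i + v $ 1 * d $ i"
        using that v(1) c d by (auto simp: scalar_prod_def mat_of_cols_def numeral_2_eq_2)
      then show ?thesis using v(3) that by simp
    qed
    have "v $ 1 \<noteq> 0"
    proof
      assume v1: "v $ 1 = 0"
      have "v $ 0 \<noteq> 0"
      proof
        assume "v $ 0 = 0"
        then have "v = 0\<^sub>v 2" using v1 v(1) by (intro eq_vecI) (auto simp: less_2_cases_iff)
        then show False using v(2) by simp
      qed
      then have "c = 0\<^sub>v m" using comb v1 c by (intro eq_vecI) auto
      then show False using c by simp
    qed
    then have "d $ i = (- v $ 0 / v $ 1) * c $ i" if "i < m" for i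
      using comb[OF that] by (simp add: field_simps eq_neg_iff_add_eq_0 add.commute)
    then have "d = (- v $ 0 / v $ 1) \<cdot>\<^sub>v c" using c d by (intro eq_vecI) auto
    then show ?thesis unfolding d_def by blast
  qed
  then obtain t where t: "\<And>k. k < n \<Longrightarrow> col A k = t k \<cdot>\<^sub>v c" by metis
  have "A = outer c (vec n t)"
  proof (rule eq_matI)
    fix i k assume ik: "i < dim_row (outer c (vec n t))" "k < dim_col (outer c (vec n t))"
    then have "i < m" "k < n" using c by (auto simp: outer_def)
    then have "A $$ (i, k) = col A k $ i" using A by simp
    then show "A $$ (i, k) = outer c (vec n t) $$ (i, k)"
      using \<open>i < m\<close> \<open>k < n\<close> c t[of k] by (simp add: outer_def)
  qed (use A c in \<open>auto simp: outer_def\<close>)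
  then show ?thesis using c(1) by (intro bexI[of _ c] bexI[of _ "vec n t"]) auto
qed

section \<open>Linear images of sequentially independent G-normal variables\<close>

text \<open>
  The setting of the theorem, with \<open>a\<close> and \<open>b\<close> for the lower and upper variance.
\<close>

locale independent_G_normal = sublinear_expectation_space H E
  for H :: "('a \<Rightarrow> real) set" and E :: "('a \<Rightarrow> real) \<Rightarrow> real" +
  fixes Y :: "'a \<Rightarrow> real vec" and n :: nat and a b :: real
  assumes a: "0 < a" and ab: "a < b" and n: "1 \<le> n"
    and Y: "random_vector H n Y"
    and Y0: "normal_dist1 H E (\<lambda>\<omega>. Y \<omega> $ 0) {a..b}"
    and Y_ident: "\<And>i. i + 1 < n \<Longrightarrow>
      ident_dist H E 1 (vec1 (\<lambda>\<omega>. Y \<omega> $ (i + 1))) (vec1 (\<lambda>\<omega>. Y \<omega> $ i))"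
    and Y_indep: "\<And>i. i + 1 < n \<Longrightarrow>
      indep H E (i + 1) (\<lambda>\<omega>. vec_first (Y \<omega>) (i + 1)) 1 (vec1 (\<lambda>\<omega>. Y \<omega> $ (i + 1)))"
begin

lemma Y_carrier [simp]: "Y \<omega> \<in> carrier_vec n"
  using Y by (simp add: random_vector_def)

lemma Y_dim [simp]: "dim_vec (Y \<omega>) = n"
  using Y_carrier by (rule carrier_vecD)

lemma Y_in: "i < n \<Longrightarrow> (\<lambda>\<omega>. Y \<omega> $ i) \<in> H"
  using Y by (simp add: random_vector_def)

lemma Y0_in: "(\<lambda>\<omega>. Y \<omega> $ 0) \<in> H"
  using Y_in n by simp

lemma Y0_stable: "stable1 E (\<lambda>\<omega>. Y \<omega> $ 0)"
  by (rule normal_dist1_imp_stable1(2)[OF Y0]) (use ab in simp)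

lemma Y0_square: "E (\<lambda>\<omega>. c * (Y \<omega> $ 0)\<^sup>2) = max (c * a) (c * b)"
  by (rule normal_dist1_imp_stable1(3)[OF Y0]) (use ab in simp)

lemma Y_dist:
  assumes "i < n" "lLip1 f"
  shows "E (\<lambda>\<omega>. f (Y \<omega> $ i)) = E (\<lambda>\<omega>. f (Y \<omega> $ 0))"
  using assms(1)
proof (induction i)
  case (Suc i)
  have "\<forall>\<phi>\<in>C_lLip 1. E (\<lambda>\<omega>. \<phi> (vec1 (\<lambda>\<omega>. Y \<omega> $ (i + 1)) \<omega>)) = E (\<lambda>\<omega>. \<phi> (vec1 (\<lambda>\<omega>. Y \<omega> $ i) \<omega>))"
    using Y_ident[of i] Suc.prems by (simp add: ident_dist_def)
  from bspec[OF this assms(2)[unfolded lLip1_def]] Suc show ?case by (simp add: vec1_def)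
qed simp

lemma Y_independent:
  assumes k: "0 < k" "k < n" and \<phi>: "\<phi> \<in> C_lLip (k + 1)"
  shows "E (\<lambda>\<omega>. \<phi> (vec_first (Y \<omega>) k @\<^sub>v vec1 (\<lambda>\<omega>. Y \<omega> $ k) \<omega>))
    = E (\<lambda>\<omega>. E (\<lambda>\<omega>'. \<phi> (vec_first (Y \<omega>) k @\<^sub>v vec1 (\<lambda>\<omega>. Y \<omega> $ k) \<omega>')))"
proof -
  have "\<forall>\<phi>\<in>C_lLip (k + 1). E (\<lambda>\<omega>. \<phi> (vec_first (Y \<omega>) k @\<^sub>v vec1 (\<lambda>\<omega>. Y \<omega> $ k) \<omega>))
    = E (\<lambda>\<omega>. E (\<lambda>\<omega>'. \<phi> (vec_first (Y \<omega>) k @\<^sub>v vec1 (\<lambda>\<omega>. Y \<omega> $ k) \<omega>')))"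
    using Y_indep[of "k - 1"] k by (simp add: indep_def)
  from bspec[OF this \<phi>] show ?thesis .
qed

text \<open>
  Conditionally on the first \<open>k\<close> coordinates, the summand \<open>w\<^sub>k Y\<^sub>k\<close> may be replaced by \<open>|w\<^sub>k|\<close> times a copy
  of the first coordinate, by independence, identity of laws and symmetry. The induction hypothesis replaces the
  partial sum by a multiple of the first coordinate, and stability merges the two. The induction hypothesis is
  applied to the function \<open>h\<close> that arises by integrating out the last summand, hence for arbitrary \<open>f\<close>.
\<close>

lemma partial_sum_dist:
  assumes "k \<le> n" "lLip1 f"
  shows "E (\<lambda>\<omega>. f (\<Sum>i<k. w i * Y \<omega> $ i)) = E (\<lambda>\<omega>. f (sqrt (\<Sum>i<k. (w i)\<^sup>2) * Y \<omega> $ 0))"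
  using assms
proof (induction k arbitrary: f)
  case 0
  then show ?case by (simp add: E_const)
next
  case (Suc k)
  note f = \<open>lLip1 f\<close>
  define S where "S = (\<lambda>\<omega>. \<Sum>i<k. w i * Y \<omega> $ i)"
  define c where "c = sqrt (\<Sum>i<k. (w i)\<^sup>2)"
  define h where "h = (\<lambda>s. E (\<lambda>\<omega>'. f (s + w k * Y \<omega>' $ 0)))"
  have c: "0 \<le> c" by (simp add: c_def sum_nonneg)
  \<comment> \<open>The scale of the next partial sum is the one that stability produces.\<close>
  have csq: "sqrt (c\<^sup>2 + \<bar>w k\<bar>\<^sup>2) = sqrt (\<Sum>i<Suc k. (w i)\<^sup>2)" by (simp add: c_def sum_nonneg)
  have h: "lLip1 h" using section_lLip1[OF Y0_in f, of 1 "w k"] by (simp add: h_def)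
  have k: "k < n" using Suc.prems by simp
  have "E (\<lambda>\<omega>. f (S \<omega> + w k * Y \<omega> $ k)) = E (\<lambda>\<omega>. h (S \<omega>))"
  \<comment> \<open>Independence is available from the second coordinate on; for \<open>k = 0\<close> the partial sum vanishes.\<close>
  proof (cases "k = 0")
    case True
    then show ?thesis by (simp add: S_def h_def E_const)
  next
    case False
    let ?\<phi> = "\<lambda>z. f ((\<Sum>i<k. w i * z $ i) + w k * z $ k)"
    have phi: "?\<phi> \<in> C_lLip (k + 1)" by (intro C_lLip_lLip1_compose[OF f] C_lLip_intros) auto
    have eq: "?\<phi> (vec_first (Y \<omega>) k @\<^sub>v vec1 (\<lambda>\<omega>. Y \<omega> $ k) \<omega>') = f (S \<omega> + w k * Y \<omega>' $ k)" for \<omega> \<omega>'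
      by (simp add: S_def vec_first_def vec1_def)
    have "E (\<lambda>\<omega>. f (S \<omega> + w k * Y \<omega> $ k)) = E (\<lambda>\<omega>. E (\<lambda>\<omega>'. f (S \<omega> + w k * Y \<omega>' $ k)))"
      using Y_independent[OF _ k phi] False unfolding eq by simp
    also have "\<dots> = E (\<lambda>\<omega>. h (S \<omega>))"
    proof -
      have "E (\<lambda>\<omega>'. f (s + w k * Y \<omega>' $ k)) = h s" for s
        unfolding h_def by (rule Y_dist[OF k, of "\<lambda>r. f (s + w k * r)"]) (intro lLip1_comp[OF f] lLip1_intros)
      then show ?thesis by simp
    qed
    finally show ?thesis .
  qed
  also have "\<dots> = E (\<lambda>\<omega>. h (c * Y \<omega> $ 0))"
    unfolding S_def c_def using Suc.IH[OF _ h] k by simp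
  also have "\<dots> = E (\<lambda>\<omega>. E (\<lambda>\<omega>'. f (c * Y \<omega> $ 0 + \<bar>w k\<bar> * Y \<omega>' $ 0)))"
    unfolding h_def by (simp only: stable1_abs_scale[OF Y0_in Y0_stable f])
  also have "\<dots> = E (\<lambda>\<omega>. f (sqrt (c\<^sup>2 + \<bar>w k\<bar>\<^sup>2) * Y \<omega> $ 0))"
    using Y0_stable c f unfolding stable1_def by simp
  finally show ?case unfolding csq by (simp add: S_def)
qed

lemma linear_form:
  assumes w: "w \<in> carrier_vec n"
  shows "(\<lambda>\<omega>. w \<bullet> Y \<omega>) \<in> H" and "stable1 E (\<lambda>\<omega>. w \<bullet> Y \<omega>)"
    and "E (\<lambda>\<omega>. c * (w \<bullet> Y \<omega>)\<^sup>2) = max (c * ((vnorm w)\<^sup>2 * a)) (c * ((vnorm w)\<^sup>2 * b))"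
proof -
  have eq: "w \<bullet> Y \<omega> = (\<Sum>i<n. w $ i * Y \<omega> $ i)" for \<omega>
    by (simp add: scalar_prod_def atLeast0LessThan)
  have nw: "sqrt (\<Sum>i<n. (w $ i)\<^sup>2) = vnorm w"
    using w by (simp add: real_sqrt_unique vnorm_square)
  have dist: "E (\<lambda>\<omega>. f (w \<bullet> Y \<omega>)) = E (\<lambda>\<omega>. f (vnorm w * Y \<omega> $ 0))" if "lLip1 f" for f
    using partial_sum_dist[OF order_refl that, of "\<lambda>i. w $ i"] unfolding eq nw by simp
  show inH: "(\<lambda>\<omega>. w \<bullet> Y \<omega>) \<in> H"
    unfolding eq by (rule comp_in[OF Y, of "\<lambda>y. \<Sum>i<n. w $ i * y $ i"]) (intro C_lLip_intros; simp)
  show "stable1 E (\<lambda>\<omega>. w \<bullet> Y \<omega>)"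
    by (rule stable1_transfer[OF inH scale_in[OF Y0_in] stable1_scale[OF Y0_stable] dist])
  have "E (\<lambda>\<omega>. c * (w \<bullet> Y \<omega>)\<^sup>2) = E (\<lambda>\<omega>. (c * (vnorm w)\<^sup>2) * (Y \<omega> $ 0)\<^sup>2)"
    using dist[of "\<lambda>r. c * r\<^sup>2"] by (simp add: lLip1_intros power_mult_distrib mult.assoc)
  then show "E (\<lambda>\<omega>. c * (w \<bullet> Y \<omega>)\<^sup>2) = max (c * ((vnorm w)\<^sup>2 * a)) (c * ((vnorm w)\<^sup>2 * b))"
    unfolding Y0_square[of "c * (vnorm w)\<^sup>2"] by (simp add: mult.assoc)
qed

text \<open>
  If the first absolute moment vanished, the interpolation \<open>x\<^sup>2 \<le> N |x| + |x|\<^sup>3 / N\<close> would bound the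
  upper variance \<open>b\<close> by \<open>E |Y\<^sub>0|\<^sup>3 / N\<close> for every \<open>N\<close>.
\<close>

lemma Y0_abs_pos: "0 < E (\<lambda>\<omega>. \<bar>Y \<omega> $ 0\<bar>)"
proof (rule ccontr)
  let ?X = "\<lambda>\<omega>. Y \<omega> $ 0"
  assume "\<not> 0 < E (\<lambda>\<omega>. \<bar>?X \<omega>\<bar>)"
  then have zero: "E (\<lambda>\<omega>. \<bar>?X \<omega>\<bar>) = 0" using E_nonneg[OF abs_in[OF Y0_in]] by simp
  define K where "K = E (\<lambda>\<omega>. \<bar>?X \<omega>\<bar> ^ 3)"
  have K: "0 \<le> K" unfolding K_def by (intro E_nonneg H_intros Y0_in) simp
  \<comment> \<open>This choice makes the resulting bound equal to \<open>b K / (K + 1) < b\<close>.\<close>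
  define N where "N = (K + 1) / b"
  have b: "0 < b" using a ab by simp
  have N: "0 < N" using K b by (simp add: N_def)
  have "b = E (\<lambda>\<omega>. 1 * (?X \<omega>)\<^sup>2)" unfolding Y0_square using ab by simp
  also have "\<dots> \<le> E (\<lambda>\<omega>. N * \<bar>?X \<omega>\<bar> + (1 / N) * \<bar>?X \<omega>\<bar> ^ 3)"
  proof (intro E_mono H_intros Y0_in)
    fix \<omega>
    define x where "x = \<bar>?X \<omega>\<bar>"
    have "0 \<le> x" by (simp add: x_def)
    have "x\<^sup>2 \<le> N * x + (1 / N) * x ^ 3"
    proof (cases "x \<le> N")
      case True
      then have "x\<^sup>2 \<le> N * x" using \<open>0 \<le> x\<close> by (simp add: power2_eq_square mult_right_mono)
      moreover have "0 \<le> (1 / N) * x ^ 3" using N \<open>0 \<le> x\<close> by simp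
      ultimately show ?thesis by linarith
    next
      case False
      then have "N * x\<^sup>2 \<le> x * x\<^sup>2" by (intro mult_right_mono) auto
      then have "x\<^sup>2 \<le> (1 / N) * x ^ 3" using N by (simp add: field_simps power3_eq_cube power2_eq_square)
      moreover have "0 \<le> N * x" using N \<open>0 \<le> x\<close> by simp
      ultimately show ?thesis by linarith
    qed
    then show "1 * (?X \<omega>)\<^sup>2 \<le> N * \<bar>?X \<omega>\<bar> + (1 / N) * \<bar>?X \<omega>\<bar> ^ 3" by (simp add: x_def)
  qed
  also have "\<dots> \<le> E (\<lambda>\<omega>. N * \<bar>?X \<omega>\<bar>) + E (\<lambda>\<omega>. (1 / N) * \<bar>?X \<omega>\<bar> ^ 3)"
    by (intro E_subadd H_intros Y0_in)
  also have "\<dots> = N * E (\<lambda>\<omega>. \<bar>?X \<omega>\<bar>) + (1 / N) * K"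
    unfolding K_def using N by (intro arg_cong2[where f = "(+)"] E_scale H_intros Y0_in) auto
  also have "\<dots> = b * (K / (K + 1))" using zero K by (simp add: N_def)
  also have "\<dots> < b * 1" using K b by (intro mult_strict_left_mono) auto
  finally show False by simp
qed

lemma pair_independent:
  assumes n2: "2 \<le> n" and \<psi>: "(\<lambda>z. \<psi> (z $ 0) (z $ 1)) \<in> C_lLip 2"
  shows "E (\<lambda>\<omega>. \<psi> (Y \<omega> $ 0) (Y \<omega> $ 1)) = E (\<lambda>\<omega>. E (\<lambda>\<omega>'. \<psi> (Y \<omega> $ 0) (Y \<omega>' $ 1)))"
proof -
  have eq: "(vec_first (Y \<omega>) 1 @\<^sub>v vec1 (\<lambda>\<omega>. Y \<omega> $ 1) \<omega>') $ 0 = Y \<omega> $ 0"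
    "(vec_first (Y \<omega>) 1 @\<^sub>v vec1 (\<lambda>\<omega>. Y \<omega> $ 1) \<omega>') $ 1 = Y \<omega>' $ 1" for \<omega> \<omega>'
    by (auto simp: vec_first_def vec1_def)
  have "0 < (1::nat)" "1 < n" using n2 by auto
  from Y_independent[OF this, of "\<lambda>z. \<psi> (z $ 0) (z $ 1)"] \<psi>
  show ?thesis unfolding eq by (simp add: numeral_2_eq_2)
qed

lemma Y1_mean_zero:
  assumes n2: "2 \<le> n" shows "E (\<lambda>\<omega>. c * Y \<omega> $ 1) = 0"
  using Y_dist[of 1 "\<lambda>r. c * r"] n2 stable1_scaled_mean_zero[OF Y0_in Y0_stable]
  by (simp add: lLip1_mult lLip1_const lLip1_id)

lemma E_add_Y1:
  assumes n2: "2 \<le> n" and "X \<in> H"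
  shows "E (\<lambda>\<omega>. X \<omega> + c * Y \<omega> $ 1) = E X"
  using Y1_mean_zero[OF n2, of c] Y1_mean_zero[OF n2, of "- c"] assms
  by (intro E_add_null H_intros Y_in) auto

text \<open>
  Given the first coordinate, the second one has mean zero.
\<close>

lemma third_moment_zero:
  assumes n2: "2 \<le> n"
  shows "E (\<lambda>\<omega>. c * ((Y \<omega> $ 0)\<^sup>2 * Y \<omega> $ 1)) = 0"
proof -
  have "(\<lambda>z. c * ((z $ 0)\<^sup>2 * z $ 1)) \<in> C_lLip 2" by (intro C_lLip_intros) auto
  from pair_independent[OF n2, of "\<lambda>x y. c * (x\<^sup>2 * y)", OF this]
  show ?thesis using Y1_mean_zero[OF n2, of "c * (Y \<omega> $ 0)\<^sup>2" for \<omega>] by (simp add: mult.assoc E_const)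
qed

text \<open>
  Integrating out the copy leaves \<open>y x\<^sup>2 + E(y Y\<^sub>0\<^sup>2)\<close>, where \<open>(x, y)\<close> are the values of the first two coordinates
  at \<open>\<omega>\<close>. Here \<open>E(y Y\<^sub>0\<^sup>2)\<close> is \<open>y b\<close> or \<open>y a\<close> according to the sign of \<open>y\<close>, i.e. \<open>m y + d |y|\<close> with
  \<open>d > 0\<close>. The terms linear in \<open>y\<close> do not contribute to the outer expectation.
\<close>

lemma third_moment_of_sum_pos:
  assumes n2: "2 \<le> n"
  shows "0 < E (\<lambda>\<omega>. E (\<lambda>\<omega>'. (Y \<omega> $ 0 + Y \<omega>' $ 0)\<^sup>2 * (Y \<omega> $ 1 + Y \<omega>' $ 1)))"
proof -
  note in0 = Y0_in
  have in1: "(\<lambda>\<omega>. Y \<omega> $ 1) \<in> H" using Y_in n2 by simp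
  define m where "m = (a + b) / 2"
  define d where "d = (b - a) / 2"
  have d: "0 < d" using ab by (simp add: d_def)
  have max_eq: "max (y * a) (y * b) = m * y + d * \<bar>y\<bar>" for y
  proof (cases "0 \<le> y")
    case True
    then have "y * a \<le> y * b" using ab by (intro mult_left_mono) auto
    then show ?thesis using True by (simp add: m_def d_def field_simps)
  next
    case False
    then have "y * b \<le> y * a" using ab by (intro mult_left_mono_neg) auto
    then show ?thesis using False by (simp add: m_def d_def field_simps)
  qed
  have inner: "E (\<lambda>\<omega>'. (x + Y \<omega>' $ 0)\<^sup>2 * (y + Y \<omega>' $ 1)) = y * x\<^sup>2 + (m * y + d * \<bar>y\<bar>)" for x y
  proof -
    have "(\<lambda>z. (x + z $ 0)\<^sup>2 * (y + z $ 1)) \<in> C_lLip 2" by (intro C_lLip_intros) auto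
    from pair_independent[OF n2, of "\<lambda>s t. (x + s)\<^sup>2 * (y + t)", OF this]
    have "E (\<lambda>\<omega>'. (x + Y \<omega>' $ 0)\<^sup>2 * (y + Y \<omega>' $ 1))
        = E (\<lambda>\<omega>. E (\<lambda>\<omega>'. (x + Y \<omega> $ 0)\<^sup>2 * (y + Y \<omega>' $ 1)))" .
    also have "\<dots> = E (\<lambda>\<omega>. (x + Y \<omega> $ 0)\<^sup>2 * y)"
    proof -
      have "E (\<lambda>\<omega>'. s * (y + Y \<omega>' $ 1)) = s * y" for s
        using E_add_Y1[OF n2 const_in[of "s * y"], of s] by (simp add: distrib_left E_const)
      then show ?thesis by simp
    qed
    also have "\<dots> = E (\<lambda>\<omega>. (y * (Y \<omega> $ 0)\<^sup>2 + y * x\<^sup>2) + (2 * x * y) * Y \<omega> $ 0)"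
      by (simp add: power2_sum algebra_simps)
    also have "\<dots> = E (\<lambda>\<omega>. y * (Y \<omega> $ 0)\<^sup>2 + y * x\<^sup>2)"
      using stable1_scaled_mean_zero[OF Y0_in Y0_stable, of "2 * x * y"] stable1_scaled_mean_zero[OF Y0_in Y0_stable, of "- (2 * x * y)"]
      by (intro E_add_null H_intros in0) auto
    also have "\<dots> = E (\<lambda>\<omega>. y * (Y \<omega> $ 0)\<^sup>2) + y * x\<^sup>2" by (intro E_add_const H_intros in0)
    finally show ?thesis by (simp add: Y0_square max_eq)
  qed
  have "E (\<lambda>\<omega>. E (\<lambda>\<omega>'. (Y \<omega> $ 0 + Y \<omega>' $ 0)\<^sup>2 * (Y \<omega> $ 1 + Y \<omega>' $ 1)))
      = E (\<lambda>\<omega>. Y \<omega> $ 1 * (Y \<omega> $ 0)\<^sup>2 + (m * Y \<omega> $ 1 + d * \<bar>Y \<omega> $ 1\<bar>))"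
    by (simp only: inner)
  also have "\<dots> = E (\<lambda>\<omega>. E (\<lambda>\<omega>'. Y \<omega>' $ 1 * (Y \<omega> $ 0)\<^sup>2 + (m * Y \<omega>' $ 1 + d * \<bar>Y \<omega>' $ 1\<bar>)))"
  proof -
    have "(\<lambda>z. z $ 1 * (z $ 0)\<^sup>2 + (m * z $ 1 + d * \<bar>z $ 1\<bar>)) \<in> C_lLip 2"
      by (intro C_lLip_intros C_lLip_lLip1_compose[OF lLip1_abs]) auto
    from pair_independent[OF n2, of "\<lambda>x y. y * x\<^sup>2 + (m * y + d * \<bar>y\<bar>)", OF this] show ?thesis .
  qed
  also have "\<dots> = E (\<lambda>\<omega>. E (\<lambda>\<omega>'. d * \<bar>Y \<omega>' $ 1\<bar>))"
  proof -
    have "E (\<lambda>\<omega>'. Y \<omega>' $ 1 * s + (m * Y \<omega>' $ 1 + d * \<bar>Y \<omega>' $ 1\<bar>)) = E (\<lambda>\<omega>'. d * \<bar>Y \<omega>' $ 1\<bar>)" for s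
      using E_add_Y1[OF n2 scale_in[OF abs_in[OF in1]], of d "s + m"] by (simp add: algebra_simps)
    then show ?thesis by simp
  qed
  also have "\<dots> = d * E (\<lambda>\<omega>. \<bar>Y \<omega> $ 0\<bar>)"
    using E_scale[OF abs_in[OF in1], of d] d Y_dist[of 1 abs] n2 by (simp add: E_const lLip1_abs)
  finally show ?thesis using d Y0_abs_pos by simp
qed

text \<open>
  Stability passes from \<open>A Y\<close> to \<open>Y\<close> by composing test functions with the inverse \<open>B\<close> of \<open>A\<close>, and for
  \<open>Y\<close> the two preceding lemmas contradict it.
\<close>

lemma not_G_normal_invertible_image:
  assumes n2: "2 \<le> n" and A: "A \<in> carrier_mat n n" and B: "B \<in> carrier_mat n n" and BA: "B * A = 1\<^sub>m n"
  shows "\<not> G_normal H E n (\<lambda>\<omega>. A *\<^sub>v Y \<omega>)"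
proof
  assume "G_normal H E n (\<lambda>\<omega>. A *\<^sub>v Y \<omega>)"
  then have st: "stable E n (\<lambda>\<omega>. A *\<^sub>v Y \<omega>)" by (rule G_normal_imp_stable)
  define \<phi> where "\<phi> = (\<lambda>x. ((B *\<^sub>v x) $ 0)\<^sup>2 * (B *\<^sub>v x) $ 1)"
  have coord: "(\<lambda>x. (B *\<^sub>v x) $ i) \<in> C_lLip n" if "i < n" for i
  proof -
    have "(\<lambda>x. (B *\<^sub>v x) $ i) \<in> C_lLip n \<longleftrightarrow> (\<lambda>x. \<Sum>j<n. B $$ (i, j) * x $ j) \<in> C_lLip n"
      using B that by (intro C_lLip_cong) (auto simp: scalar_prod_def atLeast0LessThan)
    also have "\<dots>" by (intro C_lLip_intros) auto
    finally show ?thesis .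
  qed
  have phi: "\<phi> \<in> C_lLip n" unfolding \<phi>_def using n2 by (intro C_lLip_mult C_lLip_power coord) auto
  have inv: "B *\<^sub>v (A *\<^sub>v y) = y" if "y \<in> carrier_vec n" for y
    using assoc_mult_mat_vec[OF B A that] that by (simp add: BA)
  have sum: "B *\<^sub>v (1 \<cdot>\<^sub>v (A *\<^sub>v Y \<omega>) + 1 \<cdot>\<^sub>v (A *\<^sub>v Y \<omega>')) = Y \<omega> + Y \<omega>'" for \<omega> \<omega>'
    using A B inv by (simp add: mult_add_distrib_mat_vec[of B n n] mult_mat_vec_carrier[OF A])
  have scal: "B *\<^sub>v (s \<cdot>\<^sub>v (A *\<^sub>v Y \<omega>)) = s \<cdot>\<^sub>v Y \<omega>" for s \<omega>
    using A B inv by (simp add: mult_mat_vec[of B n n] mult_mat_vec_carrier[OF A])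
  have nY: "0 < dim_vec (Y \<omega>)" "1 < dim_vec (Y \<omega>)" for \<omega> using n2 by auto
  have lhs: "\<phi> (1 \<cdot>\<^sub>v (A *\<^sub>v Y \<omega>) + 1 \<cdot>\<^sub>v (A *\<^sub>v Y \<omega>')) = (Y \<omega> $ 0 + Y \<omega>' $ 0)\<^sup>2 * (Y \<omega> $ 1 + Y \<omega>' $ 1)"
    for \<omega> \<omega>' unfolding \<phi>_def sum using nY by simp
  have rhs: "\<phi> (sqrt (1\<^sup>2 + 1\<^sup>2) \<cdot>\<^sub>v (A *\<^sub>v Y \<omega>)) = (sqrt 2 ^ 3) * ((Y \<omega> $ 0)\<^sup>2 * Y \<omega> $ 1)" for \<omega>
    unfolding \<phi>_def scal using nY by (simp add: power_mult_distrib power3_eq_cube)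
  have "E (\<lambda>\<omega>. E (\<lambda>\<omega>'. \<phi> (1 \<cdot>\<^sub>v (A *\<^sub>v Y \<omega>) + 1 \<cdot>\<^sub>v (A *\<^sub>v Y \<omega>'))))
      = E (\<lambda>\<omega>. \<phi> (sqrt (1\<^sup>2 + 1\<^sup>2) \<cdot>\<^sub>v (A *\<^sub>v Y \<omega>)))"
    using st phi unfolding stable_def by (meson zero_le_one)
  then have "E (\<lambda>\<omega>. E (\<lambda>\<omega>'. (Y \<omega> $ 0 + Y \<omega>' $ 0)\<^sup>2 * (Y \<omega> $ 1 + Y \<omega>' $ 1)))
      = E (\<lambda>\<omega>. (sqrt 2 ^ 3) * ((Y \<omega> $ 0)\<^sup>2 * Y \<omega> $ 1))"
    unfolding lhs rhs .
  then show False using third_moment_of_sum_pos[OF n2] third_moment_zero[OF n2] by simp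
qed

end

theorem theorem4p2:
  fixes H :: "('a \<Rightarrow> real) set" and E :: "('a \<Rightarrow> real) \<Rightarrow> real"
    and Y :: "'a \<Rightarrow> real vec" and A :: "real mat"
    and n m :: nat and \<sigma>l \<sigma>u :: real
  assumes "sublinear_expectation_space H E"
    and "0 < \<sigma>l\<^sup>2" and "\<sigma>l\<^sup>2 < \<sigma>u\<^sup>2"
    and "1 \<le> n"
    and "random_vector H n Y"
    and "normal_dist1 H E (\<lambda>\<omega>. Y \<omega> $ 0) {\<sigma>l\<^sup>2 .. \<sigma>u\<^sup>2}"
    and "\<And>i. i + 1 < n \<Longrightarrow>
           ident_dist H E 1 (vec1 (\<lambda>\<omega>. Y \<omega> $ (i + 1))) (vec1 (\<lambda>\<omega>. Y \<omega> $ i))"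
    and "\<And>i. i + 1 < n \<Longrightarrow>
           indep H E (i + 1) (\<lambda>\<omega>. vec_first (Y \<omega>) (i + 1)) 1 (vec1 (\<lambda>\<omega>. Y \<omega> $ (i + 1)))"
    and "A \<in> carrier_mat m n"
  shows
    "(\<forall>v\<in>carrier_vec m.
        normal_dist1 H E (\<lambda>\<omega>. v \<bullet> (A *\<^sub>v Y \<omega>))
          {(vnorm (transpose_mat A *\<^sub>v v))\<^sup>2 * \<sigma>l\<^sup>2 .. (vnorm (transpose_mat A *\<^sub>v v))\<^sup>2 * \<sigma>u\<^sup>2})
   \<and> (vec_space.rank m A \<le> 1 \<longrightarrow>
        G_normal H E m (\<lambda>\<omega>. A *\<^sub>v Y \<omega>) \<and>
        (\<exists>u\<in>carrier_vec m. \<exists>w\<in>carrier_vec n. A = outer u w) \<and>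
        (\<forall>u\<in>carrier_vec m. \<forall>w\<in>carrier_vec n. A = outer u w \<longrightarrow>
           normal_dist H E m (\<lambda>\<omega>. A *\<^sub>v Y \<omega>)
             {r \<cdot>\<^sub>m outer u u | r. r \<in> {(vnorm w)\<^sup>2 * \<sigma>l\<^sup>2 .. (vnorm w)\<^sup>2 * \<sigma>u\<^sup>2}}))
   \<and> (2 \<le> n \<longrightarrow>
        (invertible_mat A \<longrightarrow> \<not> G_normal H E m (\<lambda>\<omega>. A *\<^sub>v Y \<omega>)) \<and>
        \<not> G_normal H E n Y)"
proof -
  interpret sublinear_expectation_space H E by (rule assms(1))
  interpret independent_G_normal H E Y n "\<sigma>l\<^sup>2" "\<sigma>u\<^sup>2"
    by unfold_locales (use assms in auto)
  note A = assms(9)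
  have interval: "0 \<le> (vnorm w)\<^sup>2 * \<sigma>l\<^sup>2" "(vnorm w)\<^sup>2 * \<sigma>l\<^sup>2 \<le> (vnorm w)\<^sup>2 * \<sigma>u\<^sup>2" for w
    using ab by (auto intro: mult_left_mono)
  have projection: "normal_dist1 H E (\<lambda>\<omega>. v \<bullet> (A *\<^sub>v Y \<omega>))
      {(vnorm (A\<^sup>T *\<^sub>v v))\<^sup>2 * \<sigma>l\<^sup>2 .. (vnorm (A\<^sup>T *\<^sub>v v))\<^sup>2 * \<sigma>u\<^sup>2}" if v: "v \<in> carrier_vec m" for v
  proof -
    have w: "A\<^sup>T *\<^sub>v v \<in> carrier_vec n" using A v by simp
    have "v \<bullet> (A *\<^sub>v Y \<omega>) = (A\<^sup>T *\<^sub>v v) \<bullet> Y \<omega>" for \<omega>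
      using transpose_vec_mult_scalar[OF A Y_carrier v] by simp
    then show ?thesis using stable1_imp_normal_dist1[OF linear_form(1,2)[OF w] interval linear_form(3)[OF w]]
      by simp
  qed
  have line: "normal_dist H E m (\<lambda>\<omega>. A *\<^sub>v Y \<omega>)
      {r \<cdot>\<^sub>m outer u u | r. r \<in> {(vnorm w)\<^sup>2 * \<sigma>l\<^sup>2 .. (vnorm w)\<^sup>2 * \<sigma>u\<^sup>2}}"
    if u: "u \<in> carrier_vec m" and w: "w \<in> carrier_vec n" and eq: "A = outer u w" for u w
    using normal_dist_line[OF linear_form(1,2)[OF w] u interval linear_form(3)[OF w]]
    by (simp add: eq outer_mult_vec[OF u w Y_carrier])
  have not_normal: "\<not> G_normal H E m (\<lambda>\<omega>. A *\<^sub>v Y \<omega>)" if n2: "2 \<le> n" and inv: "invertible_mat A"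
  proof -
    have mn: "m = n" using inv A by (simp add: invertible_mat_def square_mat.simps)
    obtain B where B: "inverts_mat A B" "inverts_mat B A" using inv by (auto simp: invertible_mat_def)
    have "dim_col B = n" using B(1) A mn by (metis carrier_matD(1) index_mult_mat(3) index_one_mat(3) inverts_mat_def)
    moreover have "dim_row B = n" using B(2) A mn by (metis carrier_matD(2) index_mult_mat(3) index_one_mat(3) inverts_mat_def)
    ultimately show ?thesis
      using not_G_normal_invertible_image[OF n2, of A B] A B(2) mn by (auto simp: inverts_mat_def)
  qed
  have not_normal_Y: "\<not> G_normal H E n Y" if n2: "2 \<le> n"
    using not_G_normal_invertible_image[OF n2, of "1\<^sub>m n" "1\<^sub>m n"] one_mult_mat_vec[OF Y_carrier] by simp
  show ?thesis
    using projection line outer_of_rank_le_1[OF A] not_normal not_normal_Y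
    unfolding normal_dist_def by blast
qed

end
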